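(* Fix $\alpha\in(0,1)$ and $p>\alpha$ with $p\ne1$. For $\theta>0$ let $(V_i^{(\alpha,\theta)})$ be $\mathrm{PD}(\alpha,\theta)$-distributed, $H_p^{(\alpha,\theta)}=\sum_{i}(V_i^{(\alpha,\theta)})^p$, and $$W_p^{(\alpha,\theta)}=\sqrt\theta\Big(\frac{\Gamma(1-\alpha)}{\Gamma(p-\alpha)}\theta^{p-1}H_p^{(\alpha,\theta)}-1\Big).$$ Then as $\theta\to\infty$, $W_p^{(\alpha,\theta)}$ converges in law to a normal random variable with mean $0$ and variance $$\sigma_{\alpha,p}^2=\frac{\Gamma(1-\alpha)\Gamma(2p-\alpha)}{\Gamma(p-\alpha)^2}+\alpha-p^2,$$ and $\sigma_{\alpha,p}^2>0$.
   Context: $\mathrm{PD}(\alpha,\theta)$ (for $0\le\alpha<1$, $\theta>-\alpha$): let $Y_1,Y_2,\dots$ be independent with $Y_i\sim\mathrm{Beta}(1-\alpha,\theta+i\alpha)$, put $\tilde V_1=Y_1$, $\tilde V_i=(1-Y_1)\cdots(1-Y_{i-1})Y_i$, and let $V_1\ge V_2\ge\cdots$ be the decreasing rearrangement of $(\tilde V_i)$; $\mathrm{PD}(\alpha,\theta)$ is the law of $(V_i)$. *)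

theory Defs
  imports "HOL-Probability.Probability"
begin

definition beta_measure :: "real \<Rightarrow> real \<Rightarrow> real measure" where
  "beta_measure a b = density lborel
     (\<lambda>x. ennreal (indicator {0<..<1} x * x powr (a - 1) * (1 - x) powr (b - 1) / Beta a b))"

text \<open>Stick-breaking: from Y (index 0 = Y_1) to V~ (index 0 = V~_1),
  V~_i = (1-Y_1)...(1-Y_{i-1}) Y_i.\<close>
definition stick_breaking :: "(nat \<Rightarrow> real) \<Rightarrow> nat \<Rightarrow> real" where
  "stick_breaking y i = (\<Prod>j<i. 1 - y j) * y i"

text \<open>Decreasing rearrangement of a nonnegative sequence tending to 0:
  entry k (0-based) is the (k+1)-th largest term, counted with multiplicity.\<close>
definition decr_rearr :: "(nat \<Rightarrow> real) \<Rightarrow> nat \<Rightarrow> real" where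
  "decr_rearr x k = Inf {t. 0 \<le> t \<and> finite {i. x i > t} \<and> card {i. x i > t} \<le> k}"

text \<open>PD(alpha,theta) as a measure on sequences (index 0 = V_1).\<close>
definition PD :: "real \<Rightarrow> real \<Rightarrow> (nat \<Rightarrow> real) measure" where
  "PD \<alpha> \<theta> = distr (PiM UNIV (\<lambda>i. beta_measure (1 - \<alpha>) (\<theta> + real (Suc i) * \<alpha>)))
                     (PiM UNIV (\<lambda>_. borel))
                     (\<lambda>y. decr_rearr (stick_breaking y))"

definition H_p :: "real \<Rightarrow> (nat \<Rightarrow> real) \<Rightarrow> real" where
  "H_p p V = (\<Sum>i. V i powr p)"

definition W_p :: "real \<Rightarrow> real \<Rightarrow> real \<Rightarrow> (nat \<Rightarrow> real) \<Rightarrow> real" where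
  "W_p \<alpha> \<theta> p V = sqrt \<theta> * (Gamma (1 - \<alpha>) / Gamma (p - \<alpha>) * \<theta> powr (p - 1) * H_p p V - 1)"

definition W_law :: "real \<Rightarrow> real \<Rightarrow> real \<Rightarrow> real measure" where
  "W_law \<alpha> \<theta> p = distr (PD \<alpha> \<theta>) borel (W_p \<alpha> \<theta> p)"

definition sigma2 :: "real \<Rightarrow> real \<Rightarrow> real" where
  "sigma2 \<alpha> p = Gamma (1 - \<alpha>) * Gamma (2 * p - \<alpha>) / (Gamma (p - \<alpha>))\<^sup>2 + \<alpha> - p\<^sup>2"

end

theory Submission
  imports Defs "HOL-Real_Asymp.Real_Asymp"
begin

text \<open>
  Splitting off the first stick gives \<open>H(\<theta>) = Y\<^sup>p + (1 - Y)\<^sup>p H(\<theta> + \<alpha>)\<close> with \<open>Y \<sim> Beta (1 - \<alpha>, \<theta> + \<alpha>)\<close>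
  independent of \<open>H(\<theta> + \<alpha>)\<close>. Mean \<open>m(\<theta>)\<close> and variance \<open>v(\<theta>)\<close> of \<open>H(\<theta>)\<close> are explicit Gamma quotients
  solving the corresponding recursions, and unfolding them writes \<open>H(\<theta>) - m(\<theta>)\<close> as the sum of the
  martingale increments \<open>R\<^sub>k\<^sup>p \<zeta>\<^sub>k\<close>, where \<open>R\<^sub>k\<close> is the product of \<open>1 - Y\<^sub>j\<close> over \<open>j < k\<close> and the \<open>\<zeta>\<^sub>k\<close>
  are independent and centred. Replacing \<open>R\<^sub>k\<^sup>p\<close> by its mean costs only \<open>O(v(\<theta>) / \<theta>)\<close> in squared
  \<open>L\<^sup>2\<close> distance, because \<open>Var (R\<^sub>k\<^sup>p) = O(1 / \<theta>) E R\<^sub>k\<^bsup>2p\<^esup>\<close> uniformly in \<open>k\<close>. The remaining sum of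
  independent variables satisfies Lyapunov's condition: its fourth moments add up to at most a
  multiple of the mean for exponent \<open>4p\<close>. All series telescope, so that only Gamma quotient
  asymptotics are left: \<open>\<theta>\<^bsup>2p-1\<^esup> v(\<theta>)\<close> converges by the second-difference estimate
  \<open>\<Gamma>(\<theta>) \<Gamma>(\<theta> + 2p) / \<Gamma>(\<theta> + p)\<^sup>2 = 1 + p\<^sup>2 / \<theta> + o(1 / \<theta>)\<close>.
\<close>

section \<open>Asymptotics of Gamma quotients\<close>

text \<open>The increments depend on each other through \<open>R_k\<close>, which rules out a
  classical central limit theorem. Linearising helps because one stick gives
  \<open>(1 - Y)^p\<close> a relative variance of order
  \<open>1 / (\<theta> + j * \<alpha>)\<^sup>2\<close>, and these sum to order
  \<open>1 / \<theta>\<close> even over infinitely many sticks. The delicate point is the variance.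
  After scaling, the pair term and the squared mean are each of order \<open>\<theta>\<close> and
  only their difference is of order 1, so leading-order Gamma asymptotics say nothing about it. The
  difference produces \<open>\<alpha>\<close> (from the factor \<open>\<theta> + \<alpha>\<close> of
  \<open>pd_pair\<close>) and \<open>- p\<^sup>2\<close> (from the second difference of log Gamma);
  the Gamma quotient in \<open>sigma2\<close> is the mean for exponent \<open>2 * p\<close>. The
  centring also needs more than leading order, namely a relative error of
  \<open>o(1 / sqrt \<theta>)\<close>. These rates rest on the functional equation: differences of
  log Gamma quotients are elementary logarithms, and bounds on them are summed. Two limits are kept
  apart: an explicit inequality holds for every number \<open>N\<close> of sticks, \<open>N\<close>
  tends to infinity at fixed \<open>\<theta>\<close>, and only then does \<open>\<theta>\<close>
  grow.\<close>

lemma Gamma_real_Suc: "x > 0 \<Longrightarrow> Gamma (x + 1) = x * Gamma (x::real)"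
  by (rule Gamma_plus1) (auto elim!: nonpos_Ints_cases)

lemma Gamma_real_shift: "x > 0 \<Longrightarrow> y = x + 1 \<Longrightarrow> Gamma y = x * Gamma (x::real)"
  by (simp add: Gamma_real_Suc)

lemma ln_Gamma_real_Suc: "x > 0 \<Longrightarrow> ln (Gamma (x + 1)) = ln x + ln (Gamma (x::real))"
  using Gamma_real_pos[of x] by (simp add: Gamma_real_Suc ln_mult_pos)

text \<open>Wendel's inequality. Log-convexity of \<open>Gamma\<close> between \<open>y\<close> and
  \<open>y + 1\<close> gives the upper bound; the lower one is the upper bound started at
  \<open>x + a\<close> with exponent \<open>1 - a\<close>.\<close>

lemma Gamma_quotient_bounds:
  fixes x a :: real
  assumes "x > 0" "0 \<le> a" "a \<le> 1"
  shows "Gamma (x + a) \<le> x powr a * Gamma x"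
    and "x * Gamma x \<le> (x + a) powr (1 - a) * Gamma (x + a)"
proof -
  have *: "Gamma (y + b) \<le> y powr b * Gamma y" if "y > 0" "0 \<le> b" "b \<le> 1" for y b :: real
  proof -
    have "ln (Gamma ((1 - b) *\<^sub>R y + b *\<^sub>R (y + 1))) \<le> (1 - b) * ln (Gamma y) + b * ln (Gamma (y + 1))"
      using convex_onD[OF log_convex_Gamma_real, of b y "y + 1"] that by auto
    also have "(1 - b) *\<^sub>R y + b *\<^sub>R (y + 1) = y + b"
      by (simp add: algebra_simps)
    also have "(1 - b) * ln (Gamma y) + b * ln (Gamma (y + 1)) = ln (y powr b * Gamma y)"
    proof -
      have "Gamma y > 0" using that by (intro Gamma_real_pos)
      then show ?thesis
        using that by (simp add: Gamma_real_Suc ln_mult ln_powr distrib_left left_diff_distrib)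
    qed
    finally show ?thesis
      using that by (subst (asm) ln_le_cancel_iff) (auto intro!: Gamma_real_pos mult_pos_pos)
  qed
  show "Gamma (x + a) \<le> x powr a * Gamma x"
    by (rule *) fact+
  show "x * Gamma x \<le> (x + a) powr (1 - a) * Gamma (x + a)"
    using *[of "x + a" "1 - a"] Gamma_real_Suc[of x] assms by (simp add: add.commute)
qed

lemma tendsto_Gamma_quotient_unit:
  fixes a :: real
  assumes "0 \<le> a" "a \<le> 1"
  shows "((\<lambda>x. Gamma (x + a) / (Gamma x * x powr a)) \<longlongrightarrow> 1) at_top"
proof (rule tendsto_sandwich)
  show "\<forall>\<^sub>F x in at_top. (x / (x + a)) powr (1 - a) \<le> Gamma (x + a) / (Gamma x * x powr a)"
    using eventually_gt_at_top[of 0]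
  proof eventually_elim
    case (elim x)
    have "(x / (x + a)) powr (1 - a) * (Gamma x * x powr a) = x * Gamma x / (x + a) powr (1 - a)"
    proof -
      have "(x / (x + a)) powr (1 - a) * (Gamma x * x powr a)
          = (x powr (1 - a) * x powr a) * Gamma x / (x + a) powr (1 - a)"
        using elim assms by (simp add: powr_divide)
      also have "x powr (1 - a) * x powr a = x"
        using elim by (simp flip: powr_add)
      finally show ?thesis .
    qed
    also have "\<dots> \<le> Gamma (x + a)"
      using Gamma_quotient_bounds(2)[OF elim assms] elim assms
      by (simp add: divide_le_eq mult.commute)
    finally show ?case
      using elim by (subst pos_le_divide_eq) (auto intro!: mult_pos_pos Gamma_real_pos)
  qed
  show "\<forall>\<^sub>F x in at_top. Gamma (x + a) / (Gamma x * x powr a) \<le> 1"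
    using eventually_gt_at_top[of 0]
  proof eventually_elim
    case (elim x)
    then show ?case
      using Gamma_quotient_bounds(1)[OF elim assms]
      by (subst pos_divide_le_eq) (auto intro!: mult_pos_pos Gamma_real_pos simp: mult.commute)
  qed
  show "((\<lambda>x. (x / (x + a)) powr (1 - a)) \<longlongrightarrow> 1) at_top"
    by real_asymp
qed auto

lemma tendsto_Gamma_quotient:
  fixes a :: real
  assumes "0 \<le> a"
  shows "((\<lambda>x. Gamma (x + a) / (Gamma x * x powr a)) \<longlongrightarrow> 1) at_top"
proof -
  have "((\<lambda>x. Gamma (x + (b + real n)) / (Gamma x * x powr (b + real n))) \<longlongrightarrow> 1) at_top"
    if "0 \<le> b" "b \<le> 1" for b n
  proof (induction n)
    case 0
    then show ?case using tendsto_Gamma_quotient_unit[OF that] by simp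
  next
    case (Suc n)
    have "((\<lambda>x. (x + (b + real n)) / x) \<longlongrightarrow> 1) at_top"
      by real_asymp
    from tendsto_mult[OF Suc this]
    have "((\<lambda>x. Gamma (x + (b + real n)) / (Gamma x * x powr (b + real n)) * ((x + (b + real n)) / x)) \<longlongrightarrow> 1) at_top"
      by simp
    then show ?case
    proof (rule Lim_transform_eventually)
      show "\<forall>\<^sub>F x in at_top. Gamma (x + (b + real n)) / (Gamma x * x powr (b + real n)) * ((x + (b + real n)) / x)
          = Gamma (x + (b + real (Suc n))) / (Gamma x * x powr (b + real (Suc n)))"
        using eventually_gt_at_top[of 0]
      proof eventually_elim
        case (elim x)
        have "Gamma (x + (b + real (Suc n))) = (x + (b + real n)) * Gamma (x + (b + real n))"
          using Gamma_real_Suc[of "x + (b + real n)"] elim that by (simp add: add_ac)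
        moreover have "x powr (b + real (Suc n)) = x powr (b + real n) * x"
          using elim by (simp add: powr_add algebra_simps)
        ultimately show ?case by (simp add: mult_ac)
      qed
    qed
  qed
  \<comment> \<open>Fractional and integer part: log-convexity covers exponents up to 1, the
    functional equation each further unit.\<close>
  from this[of "a - of_int \<lfloor>a\<rfloor>" "nat \<lfloor>a\<rfloor>"] show ?thesis
    using assms by (simp add: of_int_floor_le) linarith
qed

text \<open>Comparing \<open>1 / y\<^sup>2\<close> with \<open>1 / ((y - 1) * y)\<close> sums the
  differences from \<open>x\<close> to infinity to at most \<open>K / (x - 1)\<close>;
  \<open>x \<ge> 2\<close> accounts for the factor 2. Every rate for Gamma quotients below is
  obtained this way.\<close>

lemma abs_le_of_telescoping_bound:
  fixes g :: "real \<Rightarrow> real"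
  assumes diff: "\<And>x. x \<ge> x0 \<Longrightarrow> \<bar>g x - g (x + 1)\<bar> \<le> K / x\<^sup>2"
    and lim: "(g \<longlongrightarrow> 0) at_top" and x: "x \<ge> x0" "x \<ge> 2" and "K \<ge> 0"
  shows "\<bar>g x\<bar> \<le> 2 * K / x"
proof -
  have fin: "\<bar>g x - g (x + real n)\<bar> \<le> K / (x - 1) - K / (x + real n - 1)" for n
  proof (induction n)
    case (Suc n)
    have "\<bar>g x - g (x + real (Suc n))\<bar> \<le> \<bar>g x - g (x + real n)\<bar> + \<bar>g (x + real n) - g (x + real n + 1)\<bar>"
      by (simp add: add_ac)
    also have "\<dots> \<le> K / (x - 1) - K / (x + real n - 1) + K / (x + real n)\<^sup>2"
      using x by (intro add_mono Suc diff) auto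
    also have "K / (x + real n)\<^sup>2 \<le> K / ((x + real n - 1) * (x + real n))"
      using x \<open>K \<ge> 0\<close> by (intro divide_left_mono) (auto simp: power2_eq_square intro!: mult_mono mult_pos_pos)
    also have "\<dots> = K / (x + real n - 1) - K / (x + real n)"
      using x by (simp add: field_simps)
    finally show ?case by simp
  qed auto
  have "(\<lambda>n. g (x + real n)) \<longlonglongrightarrow> 0"
    by (rule filterlim_compose[OF lim]) real_asymp
  then have "(\<lambda>n. \<bar>g x - g (x + real n)\<bar>) \<longlonglongrightarrow> \<bar>g x - 0\<bar>"
    by (intro tendsto_intros)
  moreover have "(\<lambda>n. K / (x - 1) - K / (x + real n - 1)) \<longlonglongrightarrow> K / (x - 1) - 0"
    by (intro tendsto_intros) real_asymp
  ultimately have "\<bar>g x\<bar> \<le> K / (x - 1)"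
    using fin by (intro LIMSEQ_le[of "\<lambda>n. \<bar>g x - g (x + real n)\<bar>" "\<bar>g x\<bar>"]) auto
  also have "\<dots> \<le> 2 * K / x"
    using x \<open>K \<ge> 0\<close> by (simp add: field_simps mult_left_mono)
  finally show ?thesis .
qed

lemma bigo_of_telescoping:
  fixes g d :: "real \<Rightarrow> real"
  assumes diff: "\<And>x. x > 0 \<Longrightarrow> g x - g (x + 1) = d x"
    and d: "d \<in> O(\<lambda>x. 1 / x ^ 2)"
    and lim: "(g \<longlongrightarrow> 0) at_top"
  shows "g \<in> O(\<lambda>x. 1 / x)"
proof -
  from d obtain c where c: "c > 0" "eventually (\<lambda>x. norm (d x) \<le> c * norm (1 / x ^ 2)) at_top"
    by (elim landau_o.bigE)
  then obtain x0 where x0: "\<And>x. x \<ge> x0 \<Longrightarrow> norm (d x) \<le> c * norm (1 / x ^ 2)"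
    by (auto simp: eventually_at_top_linorder)
  have "\<bar>g x\<bar> \<le> 2 * c / x" if "x \<ge> max x0 2" for x
    using that c x0 diff
    by (intro abs_le_of_telescoping_bound[of "max x0 2" g c x] lim) (auto simp: diff)
  then have "eventually (\<lambda>x. norm (g x) \<le> (2 * c) * norm (1 / x)) at_top"
    by (intro eventually_at_top_linorderI[of "max x0 2"]) auto
  then show ?thesis by (rule bigoI)
qed

text \<open>By the functional equation the logarithm of the quotient has elementary differences of
  size \<open>O(1 / x\<^sup>2)\<close>. Hence the quotient is \<open>1 + O(1 / x)\<close>, which
  beats \<open>sqrt x\<close>. The centring of \<open>W_p\<close> requires this rate.\<close>

lemma Gamma_quotient_rate:
  fixes a :: real
  assumes "0 \<le> a"
  shows "((\<lambda>x. sqrt x * (Gamma (x + a) / (Gamma x * x powr a) - 1)) \<longlongrightarrow> 0) at_top"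
proof -
  define g where "g x = ln (Gamma (x + a) / (Gamma x * x powr a))" for x
  have lim: "(g \<longlongrightarrow> 0) at_top"
    using tendsto_ln[OF tendsto_Gamma_quotient[OF assms]] by (simp add: g_def[abs_def])
  have "g \<in> O(\<lambda>x. 1 / x)"
  proof (rule bigo_of_telescoping[OF _ _ lim])
    show "g x - g (x + 1) = ln x - ln (x + a) + a * (ln (x + 1) - ln x)" if "x > 0" for x
    proof -
      have "g y = ln (Gamma (y + a)) - ln (Gamma y) - a * ln y" if "y > 0" for y
      proof -
        have "Gamma (y + a) > 0" "Gamma y > 0" "y powr a > 0"
          using that assms by (auto intro: Gamma_real_pos)
        then show ?thesis using that by (simp add: g_def ln_divide_pos ln_mult_pos ln_powr)
      qed
      from this[of x] this[of "x + 1"] show ?thesis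
        using that assms ln_Gamma_real_Suc[of x] ln_Gamma_real_Suc[of "x + a"]
        by (simp add: algebra_simps)
    qed
    show "(\<lambda>x. ln x - ln (x + a) + a * (ln (x + 1) - ln x)) \<in> O(\<lambda>x. 1 / x ^ 2)"
      by real_asymp
  qed
  moreover have "(\<lambda>x. exp (g x) - 1) \<in> O(g)"
  proof -
    have "(\<lambda>y. exp y - 1) \<in> O[nhds 0](\<lambda>y::real. y)"
    proof (rule bigoI[where c = 2])
      show "\<forall>\<^sub>F x in nhds 0. norm (exp x - 1) \<le> 2 * norm (x::real)"
      proof -
        have "eventually (\<lambda>x::real. \<bar>x\<bar> < 1) (nhds 0)"
          using eventually_nhds_metric[of "\<lambda>x::real. \<bar>x\<bar> < 1" 0] by (auto simp: dist_real_def intro!: exI[of _ 1])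
        then show ?thesis
        proof eventually_elim
          case (elim x)
          show ?case
          proof (cases "x \<ge> 0")
            case True
            have "exp x \<le> 1 + x + x\<^sup>2" using elim True by (intro exp_bound) auto
            moreover have "x\<^sup>2 \<le> x" using elim True by (simp add: power2_eq_square mult_left_le)
            ultimately show ?thesis using True by (simp)
          next
            case False
            have "1 - exp x \<le> - 2 * x" using exp_ge_add_one_self[of x] False by linarith
            then show ?thesis using False by simp
          qed
        qed
      qed
    qed
    then show ?thesis
      by (rule landau_o.big.compose[OF _ lim])
  qed
  ultimately have "(\<lambda>x. exp (g x) - 1) \<in> O(\<lambda>x. 1 / x)"
    by (rule landau_o.big_trans[rotated])
  moreover have "eventually (\<lambda>x. exp (g x) - 1 = Gamma (x + a) / (Gamma x * x powr a) - 1) at_top"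
    using eventually_gt_at_top[of 0]
  proof eventually_elim
    case (elim x)
    then show ?case using assms unfolding g_def
      by (subst exp_ln) (auto intro!: divide_pos_pos mult_pos_pos Gamma_real_pos)
  qed
  ultimately have *: "(\<lambda>x. Gamma (x + a) / (Gamma x * x powr a) - 1) \<in> O(\<lambda>x. 1 / x)"
    by (simp cong: landau_o.big.in_cong)
  have "(\<lambda>x. sqrt x * (Gamma (x + a) / (Gamma x * x powr a) - 1)) \<in> O(\<lambda>x. sqrt x * (1 / x))"
    by (intro landau_o.big.mult * landau_o.big_refl)
  also have "(\<lambda>x::real. sqrt x * (1 / x)) \<in> o(\<lambda>_. 1)"
    by real_asymp
  finally show ?thesis
    by (auto dest: smalloD_tendsto)
qed

text \<open>\<open>ln D\<close> decreases by about \<open>p\<^sup>2 / x\<^sup>2\<close> per unit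
  step. Subtracting \<open>p\<^sup>2 / x\<close>, which decreases at the same rate, leaves a
  function with differences \<open>o(1 / x\<^sup>2)\<close>, and telescoping makes that function
  \<open>o(1 / x)\<close>.\<close>

lemma Gamma_second_difference:
  fixes p :: real
  assumes "p > 0"
  shows "((\<lambda>x. x * (Gamma x * Gamma (x + 2 * p) / (Gamma (x + p))\<^sup>2 - 1)) \<longlongrightarrow> p\<^sup>2) at_top"
proof -
  define D where "D x = Gamma x * Gamma (x + 2 * p) / (Gamma (x + p))\<^sup>2" for x
  have pos: "D x > 0" if "x > 0" for x
    using that assms by (auto simp: D_def intro!: divide_pos_pos mult_pos_pos Gamma_real_pos zero_less_power)
  have D1: "(D \<longlongrightarrow> 1) at_top"
  proof -
    have "((\<lambda>x. (Gamma (x + 2 * p) / (Gamma x * x powr (2 * p))) / (Gamma (x + p) / (Gamma x * x powr p))\<^sup>2) \<longlongrightarrow> 1 / 1\<^sup>2) at_top"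
      using assms by (intro tendsto_intros tendsto_Gamma_quotient) auto
    then have "((\<lambda>x. (Gamma (x + 2 * p) / (Gamma x * x powr (2 * p))) / (Gamma (x + p) / (Gamma x * x powr p))\<^sup>2) \<longlongrightarrow> 1) at_top"
      by simp
    then show ?thesis
    proof (rule Lim_transform_eventually)
      show "\<forall>\<^sub>F x in at_top. (Gamma (x + 2 * p) / (Gamma x * x powr (2 * p))) / (Gamma (x + p) / (Gamma x * x powr p))\<^sup>2 = D x"
        using eventually_gt_at_top[of 0]
      proof eventually_elim
        case (elim x)
        then have "Gamma x > 0" "x powr p > 0" by (auto intro: Gamma_real_pos)
        moreover have "x powr (2 * p) = (x powr p)\<^sup>2"
          using elim by (simp add: powr_power mult.commute)
        ultimately show ?case
          by (simp add: D_def field_simps power2_eq_square)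
      qed
    qed
  qed
  define h where "h x = ln (D x) - p\<^sup>2 / x" for x
  have h0: "(h \<longlongrightarrow> 0) at_top"
  proof -
    have "((\<lambda>x. p\<^sup>2 / x) \<longlongrightarrow> 0) at_top" by real_asymp
    from tendsto_diff[OF tendsto_ln[OF D1] this] show ?thesis by (simp add: h_def[abs_def])
  qed
  have hd: "h x - h (x + 1) = 2 * ln (x + p) - ln x - ln (x + 2 * p) - p\<^sup>2 / (x * (x + 1))" if "x > 0" for x
  proof -
    have "ln (D x) - ln (D (x + 1)) = 2 * ln (x + p) - ln x - ln (x + 2 * p)"
    proof -
      have "ln (D y) = ln (Gamma y) + ln (Gamma (y + 2 * p)) - 2 * ln (Gamma (y + p))" if "y > 0" for y
      proof -
        have "Gamma y > 0" "Gamma (y + p) > 0" "Gamma (y + 2 * p) > 0"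
          using that assms by (auto intro!: Gamma_real_pos)
        then show ?thesis using that by (simp add: D_def ln_divide_pos ln_mult_pos ln_realpow)
      qed
      from this[of x] this[of "x + 1"] show ?thesis
        using that assms ln_Gamma_real_Suc[of x] ln_Gamma_real_Suc[of "x + p"]
          ln_Gamma_real_Suc[of "x + 2 * p"]
        by (simp add: algebra_simps)
    qed
    moreover have "p\<^sup>2 / x - p\<^sup>2 / (x + 1) = p\<^sup>2 / (x * (x + 1))"
      using that by (simp add: field_simps)
    ultimately show ?thesis by (simp add: h_def)
  qed
  have small: "(\<lambda>x. 2 * ln (x + p) - ln x - ln (x + 2 * p) - p\<^sup>2 / (x * (x + 1))) \<in> o(\<lambda>x. 1 / x ^ 2)"
  proof -
    \<comment> \<open>Since \<open>(x + p)\<^sup>2 = x * (x + 2 * p) + p\<^sup>2\<close>, the three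
      logarithms merge into one logarithm near 1.\<close>
    have "(\<lambda>x. ln (1 + p\<^sup>2 / (x * (x + 2 * p))) - p\<^sup>2 / x ^ 2) \<in> o(\<lambda>x. 1 / x ^ 2)"
      using assms by real_asymp
    moreover have "eventually (\<lambda>x. ln (1 + p\<^sup>2 / (x * (x + 2 * p))) - p\<^sup>2 / x ^ 2
        = 2 * ln (x + p) - ln x - ln (x + 2 * p) - p\<^sup>2 / x ^ 2) at_top"
      using eventually_gt_at_top[of 0]
    proof eventually_elim
      case (elim x)
      have "1 + p\<^sup>2 / (x * (x + 2 * p)) = (x + p)\<^sup>2 / (x * (x + 2 * p))"
      proof -
        have "x * (x + 2 * p) > 0" using elim assms by (intro mult_pos_pos) auto
        then show ?thesis by (simp add: add_divide_eq_iff power2_eq_square algebra_simps)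
      qed
      then show ?case
        using elim assms by (simp add: ln_divide_pos ln_mult_pos ln_realpow)
    qed
    ultimately have "(\<lambda>x. 2 * ln (x + p) - ln x - ln (x + 2 * p) - p\<^sup>2 / x ^ 2) \<in> o(\<lambda>x. 1 / x ^ 2)"
      by (rule landau_o.small.in_cong[THEN iffD1, rotated])
    moreover have "(\<lambda>x. p\<^sup>2 / x ^ 2 - p\<^sup>2 / (x * (x + 1))) \<in> o(\<lambda>x. 1 / x ^ 2)"
      using assms by real_asymp
    ultimately have "(\<lambda>x. (2 * ln (x + p) - ln x - ln (x + 2 * p) - p\<^sup>2 / x ^ 2)
        + (p\<^sup>2 / x ^ 2 - p\<^sup>2 / (x * (x + 1)))) \<in> o(\<lambda>x. 1 / x ^ 2)"
      by (rule sum_in_smallo(1))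
    then show ?thesis by (simp add: algebra_simps)
  qed
  have ho: "((\<lambda>x. x * h x) \<longlongrightarrow> 0) at_top"
  proof (rule tendstoI)
    fix e :: real assume "e > 0"
    \<comment> \<open>The telescoping bound yields \<open>2 * K = e / 2\<close>, strictly below
      \<open>e\<close>.\<close>
    define K where "K = e / 4"
    have "K > 0" using \<open>e > 0\<close> by (simp add: K_def)
    from landau_o.smallD[OF small this]
    obtain x0 where x0: "\<And>x. x \<ge> x0 \<Longrightarrow>
      norm (2 * ln (x + p) - ln x - ln (x + 2 * p) - p\<^sup>2 / (x * (x + 1))) \<le> K * norm (1 / x ^ 2)"
      by (auto simp: eventually_at_top_linorder)
    have "\<bar>h x\<bar> \<le> 2 * K / x" if "x \<ge> max x0 2" for x
      using that \<open>K > 0\<close> x0 h0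
      by (intro abs_le_of_telescoping_bound[of "max x0 2" h K x]) (auto simp: hd)
    then have "x * \<bar>h x\<bar> \<le> 2 * K" if "x \<ge> max x0 2" for x
      using that by (simp add: pos_le_divide_eq mult.commute)
    then show "eventually (\<lambda>x. dist (x * h x) 0 < e) at_top"
      using \<open>e > 0\<close>
      by (intro eventually_at_top_linorderI[of "max x0 2"]) (force simp: abs_mult K_def)
  qed
  have L: "((\<lambda>x. x * ln (D x)) \<longlongrightarrow> p\<^sup>2) at_top"
  proof -
    have "((\<lambda>x. x * h x + p\<^sup>2) \<longlongrightarrow> 0 + p\<^sup>2) at_top"
      by (intro tendsto_intros ho)
    moreover have "eventually (\<lambda>x. x * h x + p\<^sup>2 = x * ln (D x)) at_top"
      using eventually_gt_at_top[of 0] by eventually_elim (simp add: h_def field_simps)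
    ultimately show ?thesis by (auto intro: Lim_transform_eventually)
  qed
  \<comment> \<open>\<open>1 - 1 / D \<le> ln D \<le> D - 1\<close> leads from the logarithm back to
    \<open>D - 1\<close>.\<close>
  have bounds: "\<forall>\<^sub>F x in at_top. x * ln (D x) \<le> x * (D x - 1)"
      "\<forall>\<^sub>F x in at_top. x * (D x - 1) \<le> x * ln (D x) * D x"
  proof -
    show "\<forall>\<^sub>F x in at_top. x * ln (D x) \<le> x * (D x - 1)"
      using eventually_gt_at_top[of 0]
      by eventually_elim (use pos ln_le_minus_one in \<open>auto intro!: mult_left_mono\<close>)
    show "\<forall>\<^sub>F x in at_top. x * (D x - 1) \<le> x * ln (D x) * D x"
      using eventually_gt_at_top[of 0]
    proof eventually_elim
      case (elim x)
      have "ln (1 / D x) \<le> 1 / D x - 1" using pos[OF elim] by (intro ln_le_minus_one) auto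
      then have "1 - 1 / D x \<le> ln (D x)" using pos[OF elim] by (simp add: ln_div)
      then have "D x - 1 \<le> ln (D x) * D x" using pos[OF elim] by (simp add: field_simps)
      then show ?case using elim by (simp add: mult.assoc mult_left_mono)
    qed
  qed
  have "((\<lambda>x. x * (D x - 1)) \<longlongrightarrow> p\<^sup>2) at_top"
    using tendsto_mult[OF L D1] by (intro tendsto_sandwich[OF bounds L]) simp
  then show ?thesis unfolding D_def .
qed

section \<open>Normal approximation of characteristic functions\<close>

lemma abs_exp_minus_linear:
  fixes x :: real
  assumes "x \<ge> 0"
  shows "\<bar>exp (- x) - (1 - x)\<bar> \<le> x\<^sup>2"
proof -
  have "exp (- x) \<le> 1 / (1 + x)"
    using exp_ge_add_one_self[of x] assms by (simp add: exp_minus divide_simps)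
  \<comment> \<open>The product is \<open>1 + x ^ 3\<close>.\<close>
  also have "1 \<le> (1 - x + x\<^sup>2) * (1 + x)"
    using assms by (simp add: algebra_simps power2_eq_square)
  then have "1 / (1 + x) \<le> 1 - x + x\<^sup>2"
    using assms by (simp add: divide_simps)
  finally show ?thesis
    using exp_ge_add_one_self[of "- x"] by (simp add: abs_le_iff)
qed

text \<open>A weighted AM-GM inequality: it reduces third moments to second and fourth ones, for
  which recursions and telescoping sums are available. The weight \<open>e\<close> will be
  \<open>1 / sqrt \<theta>\<close>.\<close>

lemma cube_le_square_fourth:
  fixes x e :: real
  assumes "e > 0"
  shows "\<bar>x\<bar> ^ 3 \<le> (e * x\<^sup>2 + x ^ 4 / e) / 2"
proof -
  have "0 \<le> x\<^sup>2 * (e - \<bar>x\<bar>)\<^sup>2" by simp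
  also have "\<dots> = e\<^sup>2 * x\<^sup>2 + x ^ 4 - 2 * e * \<bar>x\<bar> ^ 3"
    by (simp add: power2_eq_square power3_eq_cube power4_eq_xxxx algebra_simps)
  finally show ?thesis
    using assms by (simp add: field_simps power2_eq_square)
qed

lemma (in prob_space) square_expectation_le:
  fixes X :: "'a \<Rightarrow> real"
  assumes [measurable]: "random_variable borel X" and "integrable M (\<lambda>x. (X x)\<^sup>2)"
  shows "(expectation X)\<^sup>2 \<le> expectation (\<lambda>x. (X x)\<^sup>2)"
proof -
  have "integrable M X"
    by (rule square_integrable_imp_integrable) fact+
  then show ?thesis
    using variance_eq[of X] variance_positive[of X] assms by simp
qed

text \<open>Lyapunov's condition with fourth moments; the third moments of the Taylor remainder are
  split by the free parameter \<open>e\<close>.\<close>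
lemma (in prob_space) char_sum_normal_bound:
  fixes X :: "'i \<Rightarrow> 'a \<Rightarrow> real"
  assumes indep: "indep_vars (\<lambda>_. borel) X A" and "finite A"
    and int4: "\<And>k. k \<in> A \<Longrightarrow> integrable M (\<lambda>x. X k x ^ 4)"
    and mean: "\<And>k. k \<in> A \<Longrightarrow> expectation (X k) = 0"
    and "e > 0"
  defines "s2 \<equiv> \<Sum>k\<in>A. expectation (\<lambda>x. (X k x)\<^sup>2)" and "s4 \<equiv> \<Sum>k\<in>A. expectation (\<lambda>x. X k x ^ 4)"
  shows "cmod (char (distr M borel (\<lambda>\<omega>. \<Sum>k\<in>A. X k \<omega>)) u - complex_of_real (exp (- (u\<^sup>2 * s2 / 2))))
    \<le> \<bar>u\<bar> ^ 3 / 12 * (e * s2 + s4 / e) + u ^ 4 / 4 * s4"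
proof -
  have rv: "random_variable borel (X k)" if "k \<in> A" for k
    using indep that unfolding indep_vars_def2 by simp
  have int2: "integrable M (\<lambda>x. (X k x)\<^sup>2)" if "k \<in> A" for k
  proof (rule Bochner_Integration.integrable_bound)
    show "integrable M (\<lambda>x. 1 + X k x ^ 4)" using int4[OF that] by simp
    show "AE x in M. norm ((X k x)\<^sup>2) \<le> norm (1 + X k x ^ 4)"
    proof (intro AE_I2)
      fix x
      \<comment> \<open>The right-hand side is twice \<open>1 + z\<^sup>2 - z\<close> for
        \<open>z\<close> the square of \<open>X k x\<close>.\<close>
      have "0 \<le> ((X k x)\<^sup>2 - 1)\<^sup>2 + 1 + X k x ^ 4" by simp
      then show "norm ((X k x)\<^sup>2) \<le> norm (1 + X k x ^ 4)"
        by (simp add: power2_eq_square power4_eq_xxxx algebra_simps)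
    qed
  qed (use rv[OF that] in measurable)
  define \<phi> where "\<phi> k = char (distr M borel (X k)) u" for k
  define \<psi> where "\<psi> k = complex_of_real (exp (- (u\<^sup>2 * expectation (\<lambda>x. (X k x)\<^sup>2) / 2)))" for k
  have term_bound: "cmod (\<phi> k - \<psi> k) \<le> \<bar>u\<bar> ^ 3 / 12 * (e * expectation (\<lambda>x. (X k x)\<^sup>2) + expectation (\<lambda>x. X k x ^ 4) / e)
      + u ^ 4 / 4 * expectation (\<lambda>x. X k x ^ 4)" if k: "k \<in> A" for k
  proof -
    note [measurable] = rv[OF k]
    let ?v = "expectation (\<lambda>x. (X k x)\<^sup>2)"
    have int1: "integrable M (X k)"
      by (rule square_integrable_imp_integrable[OF rv int2]) fact+
    \<comment> \<open>The minimum in the Taylor remainder is integrable because of its quadratic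
      branch and is estimated by its cubic one.\<close>
    have "cmod (\<phi> k - (1 - u\<^sup>2 * ?v / 2)) \<le> (u\<^sup>2 / 6) * expectation (\<lambda>x. min (6 * (X k x)^2) (\<bar>u\<bar> * \<bar>X k x\<bar>^3))"
      unfolding \<phi>_def using int1 int2[OF k] mean[OF k]
      by (intro char_approx3') auto
    also have "\<dots> \<le> (u\<^sup>2 / 6) * expectation (\<lambda>x. \<bar>u\<bar> * ((e * (X k x)\<^sup>2 + X k x ^ 4 / e) / 2))"
    proof (rule mult_left_mono, rule integral_mono)
      show "integrable M (\<lambda>x. \<bar>u\<bar> * ((e * (X k x)\<^sup>2 + X k x ^ 4 / e) / 2))"
        by (intro integrable_mult_right integrable_divide Bochner_Integration.integrable_add int2[OF k] int4[OF k])
      show "integrable M (\<lambda>x. min (6 * (X k x)^2) (\<bar>u\<bar> * \<bar>X k x\<bar>^3))"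
      proof (rule Bochner_Integration.integrable_bound)
        show "integrable M (\<lambda>x. 6 * (X k x)\<^sup>2)"
          by (intro integrable_mult_right int2[OF k])
        show "AE x in M. norm (min (6 * (X k x)^2) (\<bar>u\<bar> * \<bar>X k x\<bar>^3)) \<le> norm (6 * (X k x)\<^sup>2)"
        proof (rule AE_I2)
          fix x
          have "0 \<le> \<bar>u\<bar> * \<bar>X k x\<bar>^3" "0 \<le> 6 * (X k x)^2" by simp_all
          then show "norm (min (6 * (X k x)^2) (\<bar>u\<bar> * \<bar>X k x\<bar>^3)) \<le> norm (6 * (X k x)\<^sup>2)"
            unfolding real_norm_def by linarith
        qed
      qed measurable
      fix x
      show "min (6 * (X k x)^2) (\<bar>u\<bar> * \<bar>X k x\<bar>^3) \<le> \<bar>u\<bar> * ((e * (X k x)\<^sup>2 + X k x ^ 4 / e) / 2)"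
        by (rule min.coboundedI2) (intro mult_left_mono cube_le_square_fourth \<open>e > 0\<close> abs_ge_zero)
    qed simp
    also have "\<dots> = \<bar>u\<bar> ^ 3 / 12 * (e * ?v + expectation (\<lambda>x. X k x ^ 4) / e)"
      using int2[OF k] int4[OF k] by (simp add: power3_eq_cube power2_eq_square)
    finally have 1: "cmod (\<phi> k - (1 - u\<^sup>2 * ?v / 2)) \<le> \<bar>u\<bar> ^ 3 / 12 * (e * ?v + expectation (\<lambda>x. X k x ^ 4) / e)" .
    have "cmod ((1 - u\<^sup>2 * ?v / 2) - \<psi> k) = \<bar>exp (- (u\<^sup>2 * ?v / 2)) - (1 - u\<^sup>2 * ?v / 2)\<bar>"
      unfolding \<psi>_def norm_of_real[symmetric, where 'a = complex] by (subst norm_minus_commute) simp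
    also have "\<dots> \<le> (u\<^sup>2 * ?v / 2)\<^sup>2"
      by (intro abs_exp_minus_linear) simp
    also have "\<dots> = u ^ 4 / 4 * ?v\<^sup>2"
      by (simp add: power2_eq_square power4_eq_xxxx)
    \<comment> \<open>Jensen: the error of linearising the Gaussian factor is charged to the fourth
      moment as well.\<close>
    also have "?v\<^sup>2 \<le> expectation (\<lambda>x. ((X k x)\<^sup>2)\<^sup>2)"
      using int4[OF k] by (intro square_expectation_le) auto
    then have "u ^ 4 / 4 * ?v\<^sup>2 \<le> u ^ 4 / 4 * expectation (\<lambda>x. X k x ^ 4)"
      by (intro mult_left_mono) auto
    finally have 2: "cmod ((1 - u\<^sup>2 * ?v / 2) - \<psi> k) \<le> u ^ 4 / 4 * expectation (\<lambda>x. X k x ^ 4)" .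
    show ?thesis
      using norm_diff_triangle_le[OF 1 2] by simp
  qed
  have "char (distr M borel (\<lambda>\<omega>. \<Sum>k\<in>A. X k \<omega>)) u = (\<Prod>k\<in>A. \<phi> k)"
    unfolding \<phi>_def by (rule char_distr_sum) fact
  moreover have "complex_of_real (exp (- (u\<^sup>2 * s2 / 2))) = (\<Prod>k\<in>A. \<psi> k)"
    unfolding \<psi>_def s2_def using \<open>finite A\<close>
    by (simp add: sum_distrib_left sum_divide_distrib exp_sum flip: sum_negf of_real_prod)
  moreover have "cmod ((\<Prod>k\<in>A. \<phi> k) - (\<Prod>k\<in>A. \<psi> k)) \<le> (\<Sum>k\<in>A. cmod (\<phi> k - \<psi> k))"
  proof (rule norm_prod_diff)
    show "cmod (\<phi> k) \<le> 1" if "k \<in> A" for k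
    proof -
      interpret D: real_distribution "distr M borel (X k)"
        by (rule real_distribution_distr) (rule rv[OF that])
      show ?thesis unfolding \<phi>_def by (rule D.cmod_char_le_1)
    qed
    show "cmod (\<psi> k) \<le> 1" if "k \<in> A" for k
      by (simp add: \<psi>_def)
  qed
  moreover have "(\<Sum>k\<in>A. cmod (\<phi> k - \<psi> k)) \<le> \<bar>u\<bar> ^ 3 / 12 * (e * s2 + s4 / e) + u ^ 4 / 4 * s4"
  proof -
    have "(\<Sum>k\<in>A. cmod (\<phi> k - \<psi> k)) \<le> (\<Sum>k\<in>A. \<bar>u\<bar> ^ 3 / 12 * (e * expectation (\<lambda>x. (X k x)\<^sup>2) + expectation (\<lambda>x. X k x ^ 4) / e)
      + u ^ 4 / 4 * expectation (\<lambda>x. X k x ^ 4))"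
      by (rule sum_mono[OF term_bound])
    also have "\<dots> = \<bar>u\<bar> ^ 3 / 12 * (e * s2 + s4 / e) + u ^ 4 / 4 * s4"
      unfolding s2_def s4_def
      by (simp add: sum.distrib distrib_left flip: sum_distrib_left sum_divide_distrib)
    finally show ?thesis .
  qed
  ultimately show ?thesis by simp
qed

text \<open>\<open>iexp\<close> is Lipschitz with constant 1, so an \<open>L^1\<close> bound on
  \<open>X - Y\<close> suffices. The majorant \<open>Z\<close> allows several error terms with known
  expectations to be collected first.\<close>

lemma (in prob_space) cmod_char_distr_diff_le:
  fixes X Y :: "'a \<Rightarrow> real"
  assumes [measurable]: "random_variable borel X" "random_variable borel Y"
    and int: "integrable M Z" and le: "AE x in M. \<bar>X x - Y x\<bar> \<le> Z x"
  shows "cmod (char (distr M borel X) u - char (distr M borel Y) u) \<le> \<bar>u\<bar> * expectation Z"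
proof -
  have i: "integrable M (\<lambda>x. iexp (u * X x))" "integrable M (\<lambda>x. iexp (u * Y x))"
    by (auto intro!: integrable_const_bound[of _ 1])
  have "char (distr M borel X) u - char (distr M borel Y) u
      = (CLINT x|M. iexp (u * X x) - iexp (u * Y x))"
    using i by (simp add: char_def integral_distr)
  also have "cmod \<dots> \<le> expectation (\<lambda>x. cmod (iexp (u * X x) - iexp (u * Y x)))"
    by (rule integral_norm_bound)
  also have "\<dots> \<le> expectation (\<lambda>x. \<bar>u\<bar> * Z x)"
  proof (rule integral_mono_AE)
    show "AE x in M. cmod (iexp (u * X x) - iexp (u * Y x)) \<le> \<bar>u\<bar> * Z x"
      using le
    proof eventually_elim
      case (elim x)
      have "iexp (u * X x) - iexp (u * Y x) = iexp (u * Y x) * (iexp (u * (X x - Y x)) - 1)"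
        by (simp add: algebra_simps flip: exp_add)
      then have "cmod (iexp (u * X x) - iexp (u * Y x)) = cmod (iexp (u * (X x - Y x)) - 1)"
        by (simp add: norm_mult)
      also have "\<dots> \<le> \<bar>u * (X x - Y x)\<bar>"
        using iexp_approx1[of "u * (X x - Y x)" 0] by simp
      also have "\<dots> \<le> \<bar>u\<bar> * Z x"
        using elim by (simp add: abs_mult mult_left_mono)
      finally show ?case .
    qed
  qed (use i int in auto)
  finally show ?thesis by simp
qed

lemma char_normal_density:
  assumes "s > 0"
  shows "real_distribution (density lborel (\<lambda>x. ennreal (normal_density 0 s x)))"
    and "char (density lborel (\<lambda>x. ennreal (normal_density 0 s x))) u = complex_of_real (exp (- (u\<^sup>2 * s\<^sup>2 / 2)))"
proof -
  interpret S: prob_space std_normal_distribution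
    using real_dist_normal_dist by (simp add: real_distribution_def)
  have "distributed std_normal_distribution lborel (\<lambda>x. x) std_normal_density"
    by (simp add: distributed_def distr_id2)
  from S.normal_density_affine[OF this, of s 0] assms
  have D: "density lborel (\<lambda>x. ennreal (normal_density 0 s x)) = distr std_normal_distribution borel (\<lambda>x. s * x)"
    by (simp add: distributed_def cong: distr_cong)
  show "real_distribution (density lborel (\<lambda>x. ennreal (normal_density 0 s x)))"
    unfolding D by (rule S.real_distribution_distr) simp
  have "char (distr std_normal_distribution borel (\<lambda>x. s * x)) u = char std_normal_distribution (u * s)"
    by (simp add: char_def integral_distr mult_ac)
  then show "char (density lborel (\<lambda>x. ennreal (normal_density 0 s x))) u = complex_of_real (exp (- (u\<^sup>2 * s\<^sup>2 / 2)))"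
    unfolding D char_std_normal_distribution by (simp add: power_mult_distrib)
qed

section \<open>Positivity of the limit variance\<close>

text \<open>Moments of the unnormalised Gamma density of shape \<open>1 - \<alpha>\<close>. The
  point 0 is removed because \<open>0 powr 0 = 0\<close>, whereas expanding the square in
  \<open>sigma2_pos\<close> uses \<open>t powr 0 = 1\<close>.\<close>

lemma Gamma_weighted_integral:
  fixes \<alpha> q :: real
  assumes "0 < \<alpha>" "\<alpha> < 1" "q \<ge> 0"
  shows "((\<lambda>t. t powr (-\<alpha>) * t powr q / exp t) has_integral Gamma (q + 1 - \<alpha>)) {0<..}"
proof -
  have "((\<lambda>t. t powr (q + 1 - \<alpha> - 1) / exp t) has_integral Gamma (q + 1 - \<alpha>)) {0..}"
    using assms by (intro Gamma_integral_real) auto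
  then have "((\<lambda>t. t powr (q + 1 - \<alpha> - 1) / exp t) has_integral Gamma (q + 1 - \<alpha>)) {0<..}"
    by (rule has_integral_spike_set_eq[THEN iffD1, rotated 2])
       (rule negligible_subset[of "{0::real}"]; force)+
  then show ?thesis
    by (rule has_integral_eq[rotated]) (simp add: powr_add[symmetric])
qed

text \<open>Otherwise the derivative \<open>p * x powr (p - 1)\<close> would be constant on the open
  interval, and comparing it at two points would force \<open>p = 1\<close>.\<close>

lemma powr_not_affine:
  fixes p a b :: real
  assumes "p > 0" "p \<noteq> 1"
  shows "\<exists>x\<in>{1..2}. x powr p \<noteq> a * x + b"
proof (rule ccontr)
  assume "\<not> ?thesis"
  then have eq: "x powr p = a * x + b" if "x \<in> {1..2}" for x using that by auto
  have d: "p * x powr (p - 1) = a" if "x \<in> {1<..<2}" for x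
  proof -
    have "((\<lambda>x. x powr p) has_real_derivative p * x powr (p - 1)) (at x)"
      using that by (auto intro!: derivative_eq_intros)
    moreover have "((\<lambda>x. x powr p) has_real_derivative a) (at x)"
    proof (rule DERIV_cong_ev[THEN iffD2, OF refl _ refl])
      have "eventually (\<lambda>y. y \<in> {1<..<2}) (nhds x)"
        using that by (intro eventually_nhds_in_open) auto
      then show "\<forall>\<^sub>F y in nhds x. y powr p = a * y + b"
        by eventually_elim (auto intro: eq)
      show "((\<lambda>y. a * y + b) has_real_derivative a) (at x)"
        by (auto intro!: derivative_eq_intros)
    qed
    ultimately show ?thesis by (rule DERIV_unique)
  qed
  from d[of "5/4"] d[of "3/2"] have "(5/4) powr (p - 1) = (3/2::real) powr (p - 1)"
    using assms by auto
  then have "(p - 1) * ln (5/4) = (p - 1) * ln (3/2)"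
    by (metis ln_powr divide_pos_pos zero_less_numeral less_numeral_extra(3))
  then show False using assms by simp
qed

text \<open>Up to a positive factor, \<open>sigma2\<close> is the variance of \<open>X\<^sup>p - p c X\<close> for \<open>X\<close> Gamma-distributed
  with shape \<open>1 - \<alpha>\<close>; the constant \<open>k\<close> below is the mean.\<close>
lemma sigma2_pos:
  assumes "0 < \<alpha>" "\<alpha> < 1" "p > \<alpha>" "p \<noteq> 1"
  shows "sigma2 \<alpha> p > 0"
proof -
  define c where "c = Gamma (p - \<alpha>) / Gamma (1 - \<alpha>)"
  \<comment> \<open>With this coefficient the variance of \<open>X^p - a * X\<close> becomes exactly
    \<open>(2 * p - \<alpha>) * c\<^sup>2 * sigma2 \<alpha> p\<close>; the closing identity for
    \<open>I\<close> checks this. At \<open>p = 1\<close> one would get \<open>a = 1\<close>,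
    \<open>k = 0\<close> and a vanishing integrand.\<close>
  define a where "a = p * c"
  define k where "k = (p - \<alpha>) * c - a * (1 - \<alpha>)"
  let ?w = "\<lambda>q t :: real. t powr (-\<alpha>) * t powr q / exp t"
  let ?F = "\<lambda>t :: real. t powr (-\<alpha>) * (t powr p - (a * t + k))\<^sup>2 / exp t"
  define I where "I = Gamma (2 * p + 1 - \<alpha>) + (a\<^sup>2 * Gamma (2 + 1 - \<alpha>) + (k\<^sup>2 * Gamma (0 + 1 - \<alpha>)
     + ((- 2 * a) * Gamma ((p + 1) + 1 - \<alpha>) + ((-2 * k) * Gamma (p + 1 - \<alpha>) + (2 * a * k) * Gamma (1 + 1 - \<alpha>)))))"
  have "((\<lambda>t. ?w (2 * p) t + (a\<^sup>2 * ?w 2 t + (k\<^sup>2 * ?w 0 t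
     + ((- 2 * a) * ?w (p + 1) t + ((-2 * k) * ?w p t + (2 * a * k) * ?w 1 t))))) has_integral I) {0<..}"
    unfolding I_def using assms
    by (intro has_integral_add has_integral_mult_right Gamma_weighted_integral) auto
  then have int: "(?F has_integral I) {0<..}"
  proof (rule has_integral_eq[rotated])
    fix t :: real assume "t \<in> {0<..}"
    then have t: "t > 0" by simp
    have "t powr (2 * p) = (t powr p)\<^sup>2" "t powr 2 = t\<^sup>2" "t powr (p + 1) = t powr p * t" "t powr 0 = 1" "t powr 1 = t"
      using t by (simp_all add: powr_power mult.commute powr_add)
    then show "?w (2 * p) t + (a\<^sup>2 * ?w 2 t + (k\<^sup>2 * ?w 0 t
     + ((- 2 * a) * ?w (p + 1) t + ((-2 * k) * ?w p t + (2 * a * k) * ?w 1 t)))) = ?F t"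
      by (simp add: divide_simps power2_eq_square) (simp add: algebra_simps)
  qed
  \<comment> \<open>Nonnegativity of the integrand gives only \<open>I \<ge> 0\<close>. Strictness
    comes from a compact interval on which it is continuous and not identically zero.\<close>
  have sub: "(?F has_integral integral {1..2} ?F) {1..2}"
    by (intro integrable_integral integrable_continuous_interval continuous_intros) auto
  have "integral {1..2} ?F > 0"
  proof (rule ccontr)
    assume "\<not> ?thesis"
    moreover have "integral {1..2} ?F \<ge> 0"
      by (rule has_integral_nonneg[OF sub]) auto
    ultimately have 0: "integral {1..2} ?F = 0" by simp
    have z: "?F x = 0" if "x \<in> {1..2}" for x
    proof (rule has_integral_0_cbox_imp_0[of 1 2 ?F])
      show "continuous_on (cbox 1 2) ?F" by (auto intro!: continuous_intros)
      show "(?F has_integral 0) (cbox 1 2)" using sub 0 by simp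
    qed (use that in auto)
    obtain x where x: "x \<in> {1..2}" "x powr p \<noteq> a * x + k"
      using powr_not_affine[of p a k] assms by auto
    then show False using z[OF x(1)] by auto
  qed
  also have "integral {1..2} ?F \<le> I"
    by (rule has_integral_subset_le[OF _ sub int]) auto
  finally have "I > 0" .
  have G: "Gamma (1 - \<alpha>) > 0" "Gamma (p - \<alpha>) > 0" using assms by (auto intro!: Gamma_real_pos)
  have c: "Gamma (p - \<alpha>) = c * Gamma (1 - \<alpha>)" using G by (simp add: c_def)
  have e1: "Gamma (2 * p + 1 - \<alpha>) = (2 * p - \<alpha>) * Gamma (2 * p - \<alpha>)"
    using assms by (intro Gamma_real_shift) auto
  have e2: "Gamma (p + 1 - \<alpha>) = (p - \<alpha>) * Gamma (p - \<alpha>)"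
    using assms by (intro Gamma_real_shift) auto
  have e3: "Gamma (p + 1 + 1 - \<alpha>) = (p + 1 - \<alpha>) * Gamma (p + 1 - \<alpha>)"
    using assms by (intro Gamma_real_shift) auto
  have e4: "Gamma (1 + 1 - \<alpha>) = (1 - \<alpha>) * Gamma (1 - \<alpha>)"
    using assms by (intro Gamma_real_shift) auto
  have e5: "Gamma (2 + 1 - \<alpha>) = (1 + 1 - \<alpha>) * Gamma (1 + 1 - \<alpha>)"
    using assms by (intro Gamma_real_shift) auto
  have "c > 0" using G by (simp add: c_def)
  define X where "X = Gamma (2 * p - \<alpha>) / Gamma (1 - \<alpha>)"
  have X: "Gamma (2 * p - \<alpha>) = X * Gamma (1 - \<alpha>)" using G by (simp add: X_def)
  have "I = (2 * p - \<alpha>) * c\<^sup>2 * Gamma (1 - \<alpha>) * (X / c\<^sup>2 + \<alpha> - p\<^sup>2)"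
    unfolding I_def e1 e5 e3 e2 e4 c X k_def a_def using \<open>c > 0\<close>
    by (simp add: field_simps power2_eq_square)
  moreover have "sigma2 \<alpha> p = X / c\<^sup>2 + \<alpha> - p\<^sup>2"
    using G by (simp add: sigma2_def X_def c_def power2_eq_square field_simps)
  ultimately have "0 < ((2 * p - \<alpha>) * c\<^sup>2 * Gamma (1 - \<alpha>)) * sigma2 \<alpha> p"
    using \<open>I > 0\<close> by simp
  moreover have "(2 * p - \<alpha>) * c\<^sup>2 * Gamma (1 - \<alpha>) > 0"
    using assms G \<open>c > 0\<close> by (intro mult_pos_pos) auto
  ultimately show ?thesis
    by (simp add: zero_less_mult_iff)
qed

section \<open>The decreasing rearrangement\<close>

text \<open>If \<open>t\<close> is not an admissible threshold, the finitely many terms above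
  \<open>t\<close> have a least value \<open>u > t\<close>. Any threshold below \<open>u\<close>
  still has all of them above it, so the infimum is at least \<open>u\<close>.\<close>

lemma decr_rearr_gt_iff:
  fixes x :: "nat \<Rightarrow> real"
  assumes fin: "\<And>t. t > 0 \<Longrightarrow> finite {i. x i > t}" and "t > 0"
  shows "decr_rearr x k > t \<longleftrightarrow> k < card {i. x i > t}"
proof -
  define A where "A = {t. 0 \<le> t \<and> finite {i. x i > t} \<and> card {i. x i > t} \<le> k}"
  have eq: "decr_rearr x k = Inf A" by (simp add: decr_rearr_def A_def)
  have bdd: "bdd_below A" by (rule bdd_belowI[of _ 0]) (auto simp: A_def)
  show ?thesis
  proof (cases "t \<in> A")
    case True
    then have "Inf A \<le> t" using bdd by (rule cInf_lower)
    then show ?thesis using True by (auto simp: eq A_def)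
  next
    case False
    let ?B = "{i. x i > t}"
    have B: "finite ?B" "k < card ?B"
      using False \<open>t > 0\<close> fin by (auto simp: A_def)
    then have "?B \<noteq> {}" by (metis card.empty not_less_zero)
    define u where "u = Min (x ` ?B)"
    have u: "u > t" using B \<open>?B \<noteq> {}\<close> by (auto simp: u_def)
    have lower: "u \<le> s" if "s \<in> A" for s
    proof (rule ccontr)
      assume "\<not> u \<le> s"
      then have "?B \<subseteq> {i. x i > s}"
        using B by (auto simp: u_def not_le intro: less_le_trans[OF _ Min_le])
      then have "card ?B \<le> card {i. x i > s}"
        using that by (intro card_mono) (auto simp: A_def)
      then show False using that B by (auto simp: A_def)
    qed
    \<comment> \<open>Nonemptiness of \<open>A\<close>: the infimum of the empty set would carry no
      information.\<close>
    have "Max (x ` ?B) \<in> A"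
    proof -
      have "x i \<le> Max (x ` ?B)" for i
      proof (cases "i \<in> ?B")
        case False
        then have "x i \<le> t" by simp
        also have "t \<le> u" using u by simp
        also have "u \<le> Max (x ` ?B)" unfolding u_def using B \<open>?B \<noteq> {}\<close> by (intro Min_le Max_in) auto
        finally show ?thesis .
      qed (use B in auto)
      then have "{i. x i > Max (x ` ?B)} = {}" by (auto simp: not_less)
      moreover have "u \<le> Max (x ` ?B)" unfolding u_def using B \<open>?B \<noteq> {}\<close> by (intro Min_le Max_in) auto
      ultimately show ?thesis using u \<open>t > 0\<close> by (auto simp: A_def)
    qed
    then have "u \<le> Inf A" using lower by (intro cInf_greatest) auto
    then show ?thesis using u B by (simp add: eq)
  qed
qed

lemma ennreal_powr_layer_cake:
  fixes v p :: real
  assumes "v \<ge> 0" "p > 0"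
  shows "ennreal (v powr p) = (\<integral>\<^sup>+t. indicator {t. 0 < t \<and> t powr (1 / p) < v} t \<partial>lborel)"
proof -
  have "{t. 0 < t \<and> t powr (1 / p) < v} = {0<..<v powr p}"
  proof (intro set_eqI iffI; clarsimp)
    fix t :: real assume t: "0 < t" "t powr (1 / p) < v"
    then have "(t powr (1 / p)) powr p < v powr p"
      using assms by (intro powr_less_mono2) auto
    then show "t < v powr p" using t assms by (simp add: powr_powr)
  next
    fix t :: real assume t: "0 < t" "t < v powr p"
    then have "t powr (1 / p) < (v powr p) powr (1 / p)"
      using assms by (intro powr_less_mono2) auto
    then show "t powr (1 / p) < v" using assms by (simp add: powr_powr)
  qed
  then show ?thesis by simp
qed

text \<open>Layer cake: both sums are integrals over \<open>t\<close> of the number of terms above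
  \<open>t powr (1 / p)\<close>, and these counts agree by \<open>decr_rearr_gt_iff\<close>. A
  bijection of the indices would not do, since zero terms disappear from the rearrangement when
  infinitely many terms are positive.\<close>

lemma suminf_decr_rearr_powr:
  fixes x :: "nat \<Rightarrow> real"
  assumes nonneg: "\<And>i. x i \<ge> 0" and p: "p > 0"
    and fin: "\<And>t. t > 0 \<Longrightarrow> finite {i. x i > t}"
  shows "(\<Sum>k. ennreal (decr_rearr x k powr p)) = (\<Sum>i. ennreal (x i powr p))"
proof -
  have nn: "decr_rearr x k \<ge> 0" for k
  proof -
    have "\<exists>t. 0 \<le> t \<and> finite {i. x i > t} \<and> card {i. x i > t} \<le> k"
    proof -
      have f: "finite {i. x i > 1}" using fin by simp
      define T where "T = Max (insert 1 (x ` {i. x i > 1}))"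
      have "1 \<le> T" unfolding T_def using f by (intro Max_ge) auto
      moreover have "x i \<le> T" for i
      proof (cases "x i > 1")
        case True then show ?thesis unfolding T_def using f by (intro Max_ge) auto
      next
        case False then show ?thesis using \<open>1 \<le> T\<close> by simp
      qed
      then have "{i. x i > T} = {}" by (auto simp: not_less)
      ultimately show ?thesis by (intro exI[of _ T]) auto
    qed
    then show ?thesis
      unfolding decr_rearr_def by (intro cInf_greatest) auto
  qed
  have *: "(\<Sum>k. ennreal (y k powr p)) =
      (\<integral>\<^sup>+t. (if t > 0 then emeasure (count_space UNIV) {k. y k > t powr (1 / p)} else 0) \<partial>lborel)"
    if "\<And>k. y k \<ge> 0" for y :: "nat \<Rightarrow> real"
  proof -
    have "(\<Sum>k. ennreal (y k powr p)) = (\<Sum>k. \<integral>\<^sup>+t. indicator {t. 0 < t \<and> t powr (1 / p) < y k} t \<partial>lborel)"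
      by (intro suminf_cong ennreal_powr_layer_cake that p)
    also have "\<dots> = (\<integral>\<^sup>+t. (\<Sum>k. indicator {t. 0 < t \<and> t powr (1 / p) < y k} t) \<partial>lborel)"
      by (rule nn_integral_suminf[symmetric]) measurable
    also have "\<dots> = (\<integral>\<^sup>+t. (if t > 0 then emeasure (count_space UNIV) {k. y k > t powr (1 / p)} else 0) \<partial>lborel)"
    proof (intro nn_integral_cong)
      fix t :: real
      show "(\<Sum>k. indicator {t. 0 < t \<and> t powr (1 / p) < y k} t)
          = (if t > 0 then emeasure (count_space UNIV) {k. y k > t powr (1 / p)} else 0)"
      proof (cases "t > 0")
        case True
        have "(\<Sum>k. indicator {t. 0 < t \<and> t powr (1 / p) < y k} t) = (\<Sum>k. indicator {k. y k > t powr (1 / p)} k :: ennreal)"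
          using True by (intro suminf_cong) (auto simp: indicator_def)
        also have "\<dots> = (\<integral>\<^sup>+k. indicator {k. y k > t powr (1 / p)} k \<partial>count_space UNIV)"
          by (simp add: nn_integral_count_space_nat)
        finally show ?thesis using True by simp
      qed simp
    qed
    finally show ?thesis .
  qed
  have "{k. decr_rearr x k > t powr (1 / p)} = {..<card {i. x i > t powr (1 / p)}}" if "t > 0" for t
    using decr_rearr_gt_iff[OF fin, where t = "t powr (1 / p)"] that by auto
  then have "emeasure (count_space UNIV) {k. decr_rearr x k > t powr (1 / p)}
    = emeasure (count_space UNIV) {i. x i > t powr (1 / p)}" if "t > 0" for t
    using that fin[of "t powr (1 / p)"] by (simp add: emeasure_count_space)
  then show ?thesis
    unfolding *[of "decr_rearr x", OF nn] *[of x, OF nonneg] by (intro nn_integral_cong) auto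
qed

text \<open>Sequences without any admissible threshold must be covered too. Admissibility
  \<open>Q\<close> is upward closed in \<open>t\<close>, so comparing the infimum with
  \<open>c\<close> involves only rational thresholds.\<close>

lemma decr_rearr_measurable [measurable]:
  "(\<lambda>x. decr_rearr x k) \<in> borel_measurable (PiM UNIV (\<lambda>_. borel))"
proof (rule borel_measurableI_less)
  fix c :: real
  let ?P = "PiM (UNIV :: nat set) (\<lambda>_. borel :: real measure)"
  define Q where "Q t x \<longleftrightarrow> 0 \<le> t \<and> finite {i. x i > t} \<and> card {i. x i > t} \<le> k" for t and x :: "nat \<Rightarrow> real"
  have Qmono: "Q s x" if "Q t x" "t \<le> s" for s t x
  proof -
    have "{i. x i > s} \<subseteq> {i. x i > t}" using that by auto
    then show ?thesis
      using that unfolding Q_def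
      by (meson card_mono finite_subset le_trans order_trans)
  qed
  have Qmeas [measurable]: "Measurable.pred ?P (Q t)" for t
  proof -
    \<comment> \<open>The cardinality condition becomes the existence of an exceptional index set
      \<open>F\<close>, of which there are countably many.\<close>
    have Qeq: "Q t x \<longleftrightarrow> (\<exists>F \<in> {F. finite F \<and> card F \<le> k}. 0 \<le> t \<and> (\<forall>i. i \<notin> F \<longrightarrow> x i \<le> t))" for x
    proof
      assume "Q t x"
      then show "\<exists>F \<in> {F. finite F \<and> card F \<le> k}. 0 \<le> t \<and> (\<forall>i. i \<notin> F \<longrightarrow> x i \<le> t)"
        unfolding Q_def by (intro bexI[of _ "{i. x i > t}"]) auto
    next
      assume "\<exists>F \<in> {F. finite F \<and> card F \<le> k}. 0 \<le> t \<and> (\<forall>i. i \<notin> F \<longrightarrow> x i \<le> t)"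
      then obtain F where F: "finite F" "card F \<le> k" "0 \<le> t" "\<And>i. i \<notin> F \<Longrightarrow> x i \<le> t" by auto
      then have "{i. x i > t} \<subseteq> F" by force
      then show "Q t x" using F unfolding Q_def
        by (meson card_mono finite_subset le_trans)
    qed
    have cnt: "countable {F :: nat set. finite F \<and> card F \<le> k}"
      by (rule countable_subset[OF _ countable_Collect_finite]) auto
    have "Measurable.pred ?P (\<lambda>x. 0 \<le> t \<and> (\<forall>i. i \<notin> F \<longrightarrow> x i \<le> t))" for F
      by measurable
    then show ?thesis
      unfolding Qeq[abs_def] pred_def by (intro sets.sets_Collect_countable_Ex' cnt)
  qed
  \<comment> \<open>By upward closure natural numbers detect whether some threshold is admissible.
    If none is, the entry is the constant \<open>Inf {}\<close>.\<close>
  have "decr_rearr x k < c \<longleftrightarrow>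
      (if \<exists>n::nat. Q (real n) x then \<exists>r\<in>\<rat>. r < c \<and> Q r x else Inf {} < c)" for x
  proof (cases "\<exists>t. Q t x")
    case True
    then obtain t where "Q t x" by auto
    then have n: "\<exists>n::nat. Q (real n) x" using Qmono real_arch_simple by blast
    have eq: "decr_rearr x k = Inf {t. Q t x}" by (simp add: decr_rearr_def Q_def)
    have bdd: "bdd_below {t. Q t x}" by (rule bdd_belowI[of _ 0]) (auto simp: Q_def)
    have "Inf {t. Q t x} < c \<longleftrightarrow> (\<exists>t. Q t x \<and> t < c)"
      using True bdd by (subst cInf_less_iff) auto
    also have "\<dots> \<longleftrightarrow> (\<exists>r\<in>\<rat>. r < c \<and> Q r x)"
    proof
      assume "\<exists>t. Q t x \<and> t < c"
      then obtain t where t: "Q t x" "t < c" by auto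
      obtain r where "r \<in> \<rat>" "t < r" "r < c" using Rats_dense_in_real[OF t(2)] by auto
      then show "\<exists>r\<in>\<rat>. r < c \<and> Q r x" using Qmono[OF t(1), of r] by auto
    qed auto
    finally show ?thesis using n eq by simp
  next
    case False
    then have "{t. 0 \<le> t \<and> finite {i. t < x i} \<and> card {i. t < x i} \<le> k} = {}" by (auto simp: Q_def)
    then have "decr_rearr x k = Inf {}" by (simp only: decr_rearr_def)
    then show ?thesis using False by auto
  qed
  moreover have "Measurable.pred ?P (\<lambda>x. if \<exists>n::nat. Q (real n) x then \<exists>r\<in>\<rat>. r < c \<and> Q r x else Inf {} < c)"
  proof -
    have "Measurable.pred ?P (\<lambda>x. \<exists>r\<in>\<rat>. r < c \<and> Q r x)"
      unfolding pred_def by (intro sets.sets_Collect_countable_Ex' countable_rat) measurable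
    moreover have "Measurable.pred ?P (\<lambda>x. \<exists>n::nat. Q (real n) x)"
      by measurable
    ultimately show ?thesis by measurable
  qed
  ultimately have "Measurable.pred ?P (\<lambda>x. decr_rearr x k < c)"
    by simp
  then show "{x \<in> space ?P. decr_rearr x k < c} \<in> sets ?P"
    by (simp add: pred_def)
qed

lemma stick_breaking_measurable [measurable]:
  "stick_breaking \<in> measurable (PiM UNIV (\<lambda>_. borel)) (PiM UNIV (\<lambda>_. borel))"
  unfolding stick_breaking_def[abs_def] by (rule measurable_PiM_single') (auto simp: space_PiM)

lemma decr_rearr_measurable_PiM [measurable]:
  "decr_rearr \<in> measurable (PiM UNIV (\<lambda>_. borel)) (PiM UNIV (\<lambda>_. borel))"
  by (rule measurable_PiM_single'[where f = "\<lambda>i x. decr_rearr x i", simplified])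
     (auto simp: space_PiM)

lemma W_p_measurable [measurable]:
  "W_p \<alpha> \<theta> p \<in> borel_measurable (PiM UNIV (\<lambda>_. borel))"
  unfolding W_p_def[abs_def] H_p_def by measurable

section \<open>Moments of the Beta distribution\<close>

lemma Gamma_real_nonzero: "x > 0 \<Longrightarrow> Gamma x \<noteq> (0::real)"
  using Gamma_real_pos[of x] by linarith

lemma (in prob_space) has_bochner_integral_constant: "has_bochner_integral M (\<lambda>_. c) (c :: real)"
  by (simp add: has_bochner_integral_iff prob_space)

lemma Beta_real_pos: "a > 0 \<Longrightarrow> b > 0 \<Longrightarrow> Beta a b > (0::real)"
  by (simp add: Beta_def Gamma_real_pos)

lemma sets_beta_measure [simp, measurable_cong]: "sets (beta_measure a b) = sets borel"
  by (simp add: beta_measure_def)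

lemma space_beta_measure [simp]: "space (beta_measure a b) = UNIV"
  by (simp add: beta_measure_def)

lemma AE_beta_measure: "AE x in beta_measure a b. 0 < x \<and> x < 1"
  unfolding beta_measure_def by (subst AE_density) (auto simp: indicator_def split: if_splits)

lemma nn_integral_beta_measure:
  fixes a b s t :: real
  assumes "a > 0" "b > 0" "a + s > 0" "b + t > 0"
  shows "(\<integral>\<^sup>+x. ennreal (x powr s * (1 - x) powr t) \<partial>beta_measure a b) = ennreal (Beta (a + s) (b + t) / Beta a b)"
proof -
  let ?f = "\<lambda>x::real. indicator {0<..<1} x * (x powr (a + s - 1) * (1 - x) powr (b + t - 1))"
  have B: "Beta a b > 0" using assms by (intro Beta_real_pos)
  have "((\<lambda>x. x powr (a + s - 1) * (1 - x) powr (b + t - 1)) has_integral Beta (a + s) (b + t)) {0..1}"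
    using assms by (intro has_integral_Beta_real)
  then have "((\<lambda>x. x powr (a + s - 1) * (1 - x) powr (b + t - 1)) has_integral Beta (a + s) (b + t)) {0<..<1}"
    by (simp add: has_integral_Icc_iff_Ioo)
  then have "((\<lambda>x. if x \<in> {0<..<1} then x powr (a + s - 1) * (1 - x) powr (b + t - 1) else 0) has_integral Beta (a + s) (b + t)) UNIV"
    by (subst has_integral_restrict_UNIV)
  then have "(?f has_integral Beta (a + s) (b + t)) UNIV"
    by (rule has_integral_eq[rotated]) (auto simp: indicator_def)
  then have int: "(\<integral>\<^sup>+x. ennreal (?f x) \<partial>lborel) = ennreal (Beta (a + s) (b + t))"
    by (intro nn_integral_has_integral_lborel) auto
  have "(\<integral>\<^sup>+x. ennreal (x powr s * (1 - x) powr t) \<partial>beta_measure a b)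
      = (\<integral>\<^sup>+x. ennreal (indicator {0<..<1} x * x powr (a - 1) * (1 - x) powr (b - 1) / Beta a b)
            * ennreal (x powr s * (1 - x) powr t) \<partial>lborel)"
    unfolding beta_measure_def by (subst nn_integral_density) auto
  also have "\<dots> = (\<integral>\<^sup>+x. ennreal (1 / Beta a b) * ennreal (?f x) \<partial>lborel)"
  proof (intro nn_integral_cong)
    fix x :: real
    show "ennreal (indicator {0<..<1} x * x powr (a - 1) * (1 - x) powr (b - 1) / Beta a b)
            * ennreal (x powr s * (1 - x) powr t) = ennreal (1 / Beta a b) * ennreal (?f x)"
    proof (cases "x \<in> {0<..<1}")
      case True
      have "x powr (a + s - 1) = x powr (a - 1) * x powr s"
        using True by (simp flip: powr_add add: algebra_simps)
      moreover have "(1 - x) powr (b + t - 1) = (1 - x) powr (b - 1) * (1 - x) powr t"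
        using True by (simp flip: powr_add add: algebra_simps)
      ultimately show ?thesis
        using True B by (simp add: mult_ac flip: ennreal_mult')
    qed auto
  qed
  also have "\<dots> = ennreal (1 / Beta a b) * ennreal (Beta (a + s) (b + t))"
    by (subst nn_integral_cmult) (auto simp: int)
  also have "\<dots> = ennreal (Beta (a + s) (b + t) / Beta a b)"
    using B by (simp flip: ennreal_mult')
  finally show ?thesis .
qed

lemma prob_space_beta_measure:
  assumes "a > 0" "b > 0"
  shows "prob_space (beta_measure a b)"
proof
  have "emeasure (beta_measure a b) (space (beta_measure a b)) = (\<integral>\<^sup>+x. 1 \<partial>beta_measure a b)"
    by simp
  \<comment> \<open>An equality almost everywhere only, because \<open>0 powr 0 = 0\<close>.\<close>
  also have "\<dots> = (\<integral>\<^sup>+x. ennreal (x powr 0 * (1 - x) powr 0) \<partial>beta_measure a b)"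
    using AE_beta_measure[of a b] by (intro nn_integral_cong_AE) auto
  also have "\<dots> = 1"
    using assms Beta_real_pos[of a b] by (subst nn_integral_beta_measure) auto
  finally show "emeasure (beta_measure a b) (space (beta_measure a b)) = 1" .
qed

lemma has_bochner_integral_beta_measure:
  fixes a b s t :: real
  assumes "a > 0" "b > 0" "a + s > 0" "b + t > 0"
  shows "has_bochner_integral (beta_measure a b) (\<lambda>x. x powr s * (1 - x) powr t) (Beta (a + s) (b + t) / Beta a b)"
proof (rule has_bochner_integral_nn_integral)
  show "0 \<le> Beta (a + s) (b + t) / Beta a b"
    using assms by (intro divide_nonneg_nonneg less_imp_le Beta_real_pos)
qed (auto simp: nn_integral_beta_measure[OF assms])

text \<open>For \<open>Y \<sim> Beta (1 - \<alpha>, \<theta> + \<alpha>)\<close>, \<open>y_mom\<close> is \<open>E Y\<^sup>q\<close> and \<open>rem_mom\<close> is \<open>E (1 - Y)\<^sup>q\<close>. Under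
  \<open>PD \<alpha> \<theta>\<close>, \<open>pd_mean\<close> and \<open>pd_var\<close> are mean and variance of \<open>H_p\<close>, and \<open>pd_pair\<close> is the expectation of
  the sum of \<open>V\<^sub>i\<^sup>p V\<^sub>j\<^sup>p\<close> over \<open>i \<noteq> j\<close>; the formulas come from size-biased sampling.\<close>

definition y_mom :: "real \<Rightarrow> real \<Rightarrow> real \<Rightarrow> real" where
  "y_mom \<alpha> q \<theta> = Gamma (1 - \<alpha> + q) / Gamma (1 - \<alpha>) * (Gamma (\<theta> + 1) / Gamma (\<theta> + 1 + q))"

definition rem_mom :: "real \<Rightarrow> real \<Rightarrow> real \<Rightarrow> real" where
  "rem_mom \<alpha> q \<theta> = Gamma (\<theta> + 1) * Gamma (\<theta> + \<alpha> + q) / (Gamma (\<theta> + \<alpha>) * Gamma (\<theta> + 1 + q))"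

definition pd_mean :: "real \<Rightarrow> real \<Rightarrow> real \<Rightarrow> real" where
  "pd_mean \<alpha> q \<theta> = Gamma (q - \<alpha>) / Gamma (1 - \<alpha>) * (Gamma (\<theta> + 1) / Gamma (\<theta> + q))"

definition pd_pair :: "real \<Rightarrow> real \<Rightarrow> real \<Rightarrow> real" where
  "pd_pair \<alpha> p \<theta> = (Gamma (p - \<alpha>) / Gamma (1 - \<alpha>))\<^sup>2 * ((\<theta> + \<alpha>) * Gamma (\<theta> + 1) / Gamma (\<theta> + 2 * p))"

definition pd_var :: "real \<Rightarrow> real \<Rightarrow> real \<Rightarrow> real" where
  "pd_var \<alpha> p \<theta> = pd_mean \<alpha> (2 * p) \<theta> + pd_pair \<alpha> p \<theta> - (pd_mean \<alpha> p \<theta>)\<^sup>2"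

text \<open>The variable \<open>\<zeta>\<close> of the overview: the conditional mean of
  \<open>H_p\<close> given the first stick, minus the mean of \<open>H_p\<close>.\<close>

definition innov :: "real \<Rightarrow> real \<Rightarrow> real \<Rightarrow> real \<Rightarrow> real" where
  "innov \<alpha> p \<theta> y = y powr p + (1 - y) powr p * pd_mean \<alpha> p (\<theta> + \<alpha>) - pd_mean \<alpha> p \<theta>"

definition innov_var :: "real \<Rightarrow> real \<Rightarrow> real \<Rightarrow> real" where
  "innov_var \<alpha> p \<theta> = (\<integral>y. (innov \<alpha> p \<theta> y)\<^sup>2 \<partial>beta_measure (1 - \<alpha>) (\<theta> + \<alpha>))"

lemma innov_measurable [measurable]: "innov \<alpha> p \<theta> \<in> borel_measurable borel"
  unfolding innov_def[abs_def] by measurable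

section \<open>One-step recursions for mean, pair term and variance\<close>

locale pd_param =
  fixes \<alpha> :: real
  assumes \<alpha>: "0 < \<alpha>" "\<alpha> < 1"
begin

abbreviation "BM \<theta> \<equiv> beta_measure (1 - \<alpha>) (\<theta> + \<alpha>)"

lemma prob_space_BM: "\<theta> > 0 \<Longrightarrow> prob_space (BM \<theta>)"
  using \<alpha> by (intro prob_space_beta_measure) auto

lemma BM_mixed:
  assumes "\<theta> > 0" "q \<ge> 0" "r \<ge> 0"
  shows "has_bochner_integral (BM \<theta>) (\<lambda>x. x powr q * (1 - x) powr r)
     (Gamma (1 - \<alpha> + q) * Gamma (\<theta> + \<alpha> + r) * Gamma (\<theta> + 1) / (Gamma (\<theta> + 1 + q + r) * Gamma (1 - \<alpha>) * Gamma (\<theta> + \<alpha>)))"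
proof -
  have "1 - \<alpha> + q + (\<theta> + \<alpha> + r) = \<theta> + 1 + q + r" "1 - \<alpha> + (\<theta> + \<alpha>) = \<theta> + 1" by simp_all
  then have "Beta (1 - \<alpha> + q) (\<theta> + \<alpha> + r) / Beta (1 - \<alpha>) (\<theta> + \<alpha>)
    = Gamma (1 - \<alpha> + q) * Gamma (\<theta> + \<alpha> + r) * Gamma (\<theta> + 1) / (Gamma (\<theta> + 1 + q + r) * Gamma (1 - \<alpha>) * Gamma (\<theta> + \<alpha>))"
    unfolding Beta_def by (simp only: times_divide_eq_left times_divide_eq_right divide_divide_eq_left divide_divide_eq_right mult_ac)
  then show ?thesis
    using has_bochner_integral_beta_measure[of "1 - \<alpha>" "\<theta> + \<alpha>" q r] \<alpha> assms by simp
qed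

lemma BM_y_mom:
  assumes "\<theta> > 0" "q \<ge> 0"
  shows "has_bochner_integral (BM \<theta>) (\<lambda>x. x powr q) (y_mom \<alpha> q \<theta>)"
proof -
  have "has_bochner_integral (BM \<theta>) (\<lambda>x. x powr q * (1 - x) powr 0) (y_mom \<alpha> q \<theta>)"
    using BM_mixed[OF assms, of 0] assms \<alpha> Gamma_real_nonzero[of "\<theta> + \<alpha>"] by (simp add: y_mom_def mult_ac)
  moreover have "AE x in BM \<theta>. x powr q * (1 - x) powr 0 = x powr q"
    using AE_beta_measure[of "1 - \<alpha>" "\<theta> + \<alpha>"] by eventually_elim auto
  ultimately show ?thesis
    by (subst has_bochner_integral_cong_AE[where g = "\<lambda>x. x powr q * (1 - x) powr 0"]) auto
qed

lemma BM_rem_mom: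
  assumes "\<theta> > 0" "q \<ge> 0"
  shows "has_bochner_integral (BM \<theta>) (\<lambda>x. (1 - x) powr q) (rem_mom \<alpha> q \<theta>)"
proof -
  have "has_bochner_integral (BM \<theta>) (\<lambda>x. x powr 0 * (1 - x) powr q) (rem_mom \<alpha> q \<theta>)"
    using BM_mixed[of \<theta> 0 q] assms \<alpha> Gamma_real_nonzero[of "1 - \<alpha>"] by (simp add: rem_mom_def mult_ac)
  moreover have "AE x in BM \<theta>. x powr 0 * (1 - x) powr q = (1 - x) powr q"
    using AE_beta_measure[of "1 - \<alpha>" "\<theta> + \<alpha>"] by eventually_elim auto
  ultimately show ?thesis
    by (subst has_bochner_integral_cong_AE[where g = "\<lambda>x. x powr 0 * (1 - x) powr q"]) auto
qed

lemma pd_mean_pos: "q > \<alpha> \<Longrightarrow> \<theta> > 0 \<Longrightarrow> pd_mean \<alpha> q \<theta> > 0"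
  using \<alpha> by (auto simp: pd_mean_def intro!: mult_pos_pos divide_pos_pos Gamma_real_pos)

lemma y_mom_pos: "q \<ge> 0 \<Longrightarrow> \<theta> > 0 \<Longrightarrow> y_mom \<alpha> q \<theta> > 0"
  using \<alpha> by (auto simp: y_mom_def intro!: mult_pos_pos divide_pos_pos Gamma_real_pos)

lemma rem_mom_pos: "q \<ge> 0 \<Longrightarrow> \<theta> > 0 \<Longrightarrow> rem_mom \<alpha> q \<theta> > 0"
  using \<alpha> by (auto simp: rem_mom_def intro!: mult_pos_pos divide_pos_pos Gamma_real_pos)

text \<open>The sticks after the first carry the fraction
  \<open>(\<theta> + \<alpha>) / (\<theta> + q)\<close> of the mean, and by \<open>y_mom_eq\<close>
  the first carries the rest. Iterated, this fraction becomes the product that makes tails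
  vanish.\<close>

lemma rem_mom_pd_mean:
  assumes "q > \<alpha>" "\<theta> > 0"
  shows "rem_mom \<alpha> q \<theta> * pd_mean \<alpha> q (\<theta> + \<alpha>) = pd_mean \<alpha> q \<theta> * ((\<theta> + \<alpha>) / (\<theta> + q))"
proof -
  have "Gamma (\<theta> + 1 + q) = (\<theta> + q) * Gamma (\<theta> + q)" "Gamma (\<theta> + \<alpha> + 1) = (\<theta> + \<alpha>) * Gamma (\<theta> + \<alpha>)"
    using assms \<alpha> by (auto intro!: Gamma_real_shift)
  moreover have "Gamma (\<theta> + \<alpha> + q) > 0" "Gamma (\<theta> + \<alpha>) > 0"
    using assms \<alpha> by (auto intro!: Gamma_real_pos)
  ultimately show ?thesis
    by (simp add: rem_mom_def pd_mean_def mult_ac)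
qed

lemma y_mom_eq:
  assumes "q > \<alpha>" "\<theta> > 0"
  shows "y_mom \<alpha> q \<theta> = pd_mean \<alpha> q \<theta> * ((q - \<alpha>) / (\<theta> + q))"
proof -
  have "Gamma (\<theta> + 1 + q) = (\<theta> + q) * Gamma (\<theta> + q)" "Gamma (1 - \<alpha> + q) = (q - \<alpha>) * Gamma (q - \<alpha>)"
    using assms \<alpha> by (auto intro!: Gamma_real_shift)
  then show ?thesis by (simp add: y_mom_def pd_mean_def mult_ac)
qed

lemma pd_mean_rec:
  assumes "q > \<alpha>" "\<theta> > 0"
  shows "pd_mean \<alpha> q \<theta> = y_mom \<alpha> q \<theta> + rem_mom \<alpha> q \<theta> * pd_mean \<alpha> q (\<theta> + \<alpha>)"
proof -
  have "(q - \<alpha>) / (\<theta> + q) + (\<theta> + \<alpha>) / (\<theta> + q) = 1"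
    using assms \<alpha> by (simp flip: add_divide_distrib)
  then show ?thesis
    unfolding y_mom_eq[OF assms] rem_mom_pd_mean[OF assms] by (simp only: mult_1_right flip: distrib_left)
qed

text \<open>The analogue for pairs: those avoiding the first stick carry the fraction
  \<open>(\<theta> + 2 * \<alpha>) / (\<theta> + 2 * p)\<close>.\<close>

lemma rem_mom_pd_pair:
  assumes "p > \<alpha>" "\<theta> > 0"
  shows "rem_mom \<alpha> (2 * p) \<theta> * pd_pair \<alpha> p (\<theta> + \<alpha>) = pd_pair \<alpha> p \<theta> * ((\<theta> + 2 * \<alpha>) / (\<theta> + 2 * p))"
proof -
  have "Gamma (\<theta> + 1 + 2 * p) = (\<theta> + 2 * p) * Gamma (\<theta> + 2 * p)" "Gamma (\<theta> + \<alpha> + 1) = (\<theta> + \<alpha>) * Gamma (\<theta> + \<alpha>)"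
    using assms \<alpha> by (auto intro!: Gamma_real_shift)
  moreover have "Gamma (\<theta> + \<alpha> + 2 * p) > 0" "Gamma (\<theta> + \<alpha>) > 0"
    using assms \<alpha> by (auto intro!: Gamma_real_pos)
  ultimately show ?thesis
    by (simp add: rem_mom_def pd_pair_def mult_ac)
qed

lemma innov_mean:
  assumes "p > \<alpha>" "\<theta> > 0"
  shows "has_bochner_integral (BM \<theta>) (innov \<alpha> p \<theta>) 0"
proof -
  interpret prob_space "BM \<theta>" by (rule prob_space_BM) fact
  have "has_bochner_integral (BM \<theta>) (innov \<alpha> p \<theta>)
     (y_mom \<alpha> p \<theta> + rem_mom \<alpha> p \<theta> * pd_mean \<alpha> p (\<theta> + \<alpha>) - pd_mean \<alpha> p \<theta>)"
    unfolding innov_def[abs_def] using assms \<alpha>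
    by (intro has_bochner_integral_add has_bochner_integral_diff has_bochner_integral_mult_left
         has_bochner_integral_constant BM_y_mom BM_rem_mom) auto
  then show ?thesis
    using pd_mean_rec[OF assms] by simp
qed

lemma pd_var_rec:
  assumes p: "p > \<alpha>" and "\<theta> > 0"
  shows "integrable (BM \<theta>) (\<lambda>y. (innov \<alpha> p \<theta> y)\<^sup>2)"
    and "pd_var \<alpha> p \<theta> = innov_var \<alpha> p \<theta> + rem_mom \<alpha> (2 * p) \<theta> * pd_var \<alpha> p (\<theta> + \<alpha>)"
proof -
  interpret prob_space "BM \<theta>" by (rule prob_space_BM) fact
  define m where "m = pd_mean \<alpha> p \<theta>"
  define m' where "m' = pd_mean \<alpha> p (\<theta> + \<alpha>)"
  define X where "X = Gamma (1 - \<alpha> + p) * Gamma (\<theta> + \<alpha> + p) * Gamma (\<theta> + 1) / (Gamma (\<theta> + 1 + p + p) * Gamma (1 - \<alpha>) * Gamma (\<theta> + \<alpha>))"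
  \<comment> \<open>The square of \<open>f - m\<close> with \<open>f = innov + m\<close>, expanded
    so that the term linear in \<open>f\<close> is integrated by \<open>innov_mean\<close>.\<close>
  have "has_bochner_integral (BM \<theta>) (\<lambda>y. y powr (2 * p) + y powr p * (1 - y) powr p * (2 * m') + (1 - y) powr (2 * p) * m'\<^sup>2
       - (innov \<alpha> p \<theta> y + m) * (2 * m) + m\<^sup>2)
     (y_mom \<alpha> (2 * p) \<theta> + X * (2 * m') + rem_mom \<alpha> (2 * p) \<theta> * m'\<^sup>2 - (0 + m) * (2 * m) + m\<^sup>2)"
    unfolding X_def using assms \<alpha>
    by (intro has_bochner_integral_add has_bochner_integral_diff has_bochner_integral_mult_left
         has_bochner_integral_constant BM_y_mom BM_rem_mom BM_mixed innov_mean) auto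
  moreover have "AE y in BM \<theta>. (innov \<alpha> p \<theta> y)\<^sup>2 = y powr (2 * p) + y powr p * (1 - y) powr p * (2 * m') + (1 - y) powr (2 * p) * m'\<^sup>2
       - (innov \<alpha> p \<theta> y + m) * (2 * m) + m\<^sup>2"
    using AE_beta_measure[of "1 - \<alpha>" "\<theta> + \<alpha>"]
  proof eventually_elim
    case (elim y)
    have "y powr (2 * p) = (y powr p)\<^sup>2" "(1 - y) powr (2 * p) = ((1 - y) powr p)\<^sup>2"
      using elim by (simp_all add: powr_power mult.commute)
    then show ?case
      unfolding innov_def m_def[symmetric] m'_def[symmetric] by (simp add: power2_eq_square algebra_simps)
  qed
  ultimately have *: "has_bochner_integral (BM \<theta>) (\<lambda>y. (innov \<alpha> p \<theta> y)\<^sup>2)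
     (y_mom \<alpha> (2 * p) \<theta> + X * (2 * m') + rem_mom \<alpha> (2 * p) \<theta> * m'\<^sup>2 - m\<^sup>2)"
    by (subst has_bochner_integral_cong_AE) (auto simp: prob_space power2_eq_square algebra_simps)
  then show "integrable (BM \<theta>) (\<lambda>y. (innov \<alpha> p \<theta> y)\<^sup>2)"
    by (rule integrable.intros)
  have e: "innov_var \<alpha> p \<theta> = y_mom \<alpha> (2 * p) \<theta> + X * (2 * m') + rem_mom \<alpha> (2 * p) \<theta> * m'\<^sup>2 - m\<^sup>2"
    unfolding innov_var_def by (rule has_bochner_integral_integral_eq) fact
  \<comment> \<open>The contribution of pairs containing the first stick; its fraction and that of
    \<open>rem_mom_pd_pair\<close> add up to 1.\<close>
  have "X * (2 * m') = pd_pair \<alpha> p \<theta> * (2 * (p - \<alpha>) / (\<theta> + 2 * p))"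
  proof -
    have "Gamma (\<theta> + 1 + p + p) = (\<theta> + 2 * p) * Gamma (\<theta> + 2 * p)" "Gamma (\<theta> + \<alpha> + 1) = (\<theta> + \<alpha>) * Gamma (\<theta> + \<alpha>)"
        "Gamma (1 - \<alpha> + p) = (p - \<alpha>) * Gamma (p - \<alpha>)"
      using assms \<alpha> by (auto intro!: Gamma_real_shift)
    moreover have "Gamma (\<theta> + \<alpha> + p) > 0" "Gamma (\<theta> + \<alpha>) > 0"
      using assms \<alpha> by (auto intro!: Gamma_real_pos)
    ultimately show ?thesis
      by (simp add: X_def m'_def pd_mean_def pd_pair_def mult_ac power2_eq_square)
  qed
  moreover have "2 * (p - \<alpha>) / (\<theta> + 2 * p) + (\<theta> + 2 * \<alpha>) / (\<theta> + 2 * p) = 1"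
    using assms \<alpha> by (simp flip: add_divide_distrib)
  ultimately have "X * (2 * m') + rem_mom \<alpha> (2 * p) \<theta> * pd_pair \<alpha> p (\<theta> + \<alpha>) = pd_pair \<alpha> p \<theta>"
    unfolding rem_mom_pd_pair[OF assms] by (simp only: mult_1_right flip: distrib_left)
  moreover have "pd_mean \<alpha> (2 * p) \<theta> = y_mom \<alpha> (2 * p) \<theta> + rem_mom \<alpha> (2 * p) \<theta> * pd_mean \<alpha> (2 * p) (\<theta> + \<alpha>)"
    using assms \<alpha> by (intro pd_mean_rec) auto
  ultimately show "pd_var \<alpha> p \<theta> = innov_var \<alpha> p \<theta> + rem_mom \<alpha> (2 * p) \<theta> * pd_var \<alpha> p (\<theta> + \<alpha>)"
    unfolding e pd_var_def m_def[symmetric] m'_def[symmetric] by (simp add: algebra_simps)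
qed

end

section \<open>Estimates for a single stick\<close>

text \<open>For exponents at least 1 this is the mean value theorem; smaller \<open>p\<close>
  reduces to exponent 1 because the base is at most 1. It is the origin of the constant
  \<open>max 1 p\<close> in all later bounds.\<close>

lemma one_minus_powr_bounds:
  fixes y p :: real
  assumes "0 \<le> y" "y < 1" "p > 0"
  shows "0 \<le> 1 - (1 - y) powr p" "1 - (1 - y) powr p \<le> max 1 p * y"
proof -
  show "0 \<le> 1 - (1 - y) powr p" using assms by (simp add: powr_le1)
  have K: "1 - (1 - y) powr k \<le> k * y" if "k \<ge> 1" for k
  proof (cases "y = 0")
    case False
    have "\<exists>z>1 - y. z < 1 \<and> 1 powr k - (1 - y) powr k = (1 - (1 - y)) * (k * z powr (k - 1))"
      using assms False by (intro MVT2) (auto intro!: derivative_eq_intros)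
    then obtain z where z: "1 - y < z" "z < 1" "1 - (1 - y) powr k = y * (k * z powr (k - 1))"
      by auto
    have "z powr (k - 1) \<le> 1" using z assms that by (intro powr_le1) auto
    then have "y * (k * z powr (k - 1)) \<le> y * (k * 1)"
      using assms that by (intro mult_left_mono) auto
    then show ?thesis using z by (simp add: mult.commute)
  qed simp
  have "(1 - y) powr max 1 p \<le> (1 - y) powr p"
    using assms by (intro powr_mono') auto
  then show "1 - (1 - y) powr p \<le> max 1 p * y"
    using K[of "max 1 p"] by simp
qed

lemma fourth_power_sum_le: "(a + b) ^ 4 \<le> 8 * (a ^ 4 + b ^ 4)" for a b :: real
proof -
  have *: "(a + b)\<^sup>2 \<le> 2 * (a\<^sup>2 + b\<^sup>2)" for a b :: real
    using sum_squares_bound[of a b] by (simp add: power2_sum)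
  have "((a + b)\<^sup>2)\<^sup>2 \<le> (2 * (a\<^sup>2 + b\<^sup>2))\<^sup>2"
    by (intro power_mono *) auto
  then show ?thesis using *[of "a\<^sup>2" "b\<^sup>2"] unfolding power_mult_distrib by simp
qed

context pd_param
begin

lemma y_mom_1_le: "\<theta> > 0 \<Longrightarrow> y_mom \<alpha> 1 \<theta> \<le> 1 / \<theta>"
proof -
  assume "\<theta> > 0"
  have G: "Gamma (1 - \<alpha> + 1) = (1 - \<alpha>) * Gamma (1 - \<alpha>)" "Gamma (\<theta> + 1 + 1) = (\<theta> + 1) * Gamma (\<theta> + 1)"
    using \<alpha> \<open>\<theta> > 0\<close> by (auto intro!: Gamma_real_shift)
  have "Gamma (1 - \<alpha>) \<noteq> 0" "Gamma (\<theta> + 1) \<noteq> 0" using \<alpha> \<open>\<theta> > 0\<close> by (auto intro!: Gamma_real_nonzero)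
  then have "y_mom \<alpha> 1 \<theta> = (1 - \<alpha>) / (\<theta> + 1)" unfolding y_mom_def G by simp
  also have "\<dots> \<le> 1 / \<theta>" using \<alpha> \<open>\<theta> > 0\<close> by (intro frac_le) auto
  finally show ?thesis .
qed

lemma y_mom_2_le: "\<theta> > 0 \<Longrightarrow> y_mom \<alpha> 2 \<theta> \<le> 2 / \<theta>\<^sup>2"
proof -
  assume "\<theta> > 0"
  have G: "Gamma (1 - \<alpha> + 2) = (2 - \<alpha>) * Gamma (2 - \<alpha>)" "Gamma (2 - \<alpha>) = (1 - \<alpha>) * Gamma (1 - \<alpha>)"
     "Gamma (\<theta> + 1 + 2) = (\<theta> + 2) * Gamma (\<theta> + 2)" "Gamma (\<theta> + 2) = (\<theta> + 1) * Gamma (\<theta> + 1)"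
    using \<alpha> \<open>\<theta> > 0\<close> by (auto intro!: Gamma_real_shift)
  have "Gamma (1 - \<alpha>) \<noteq> 0" "Gamma (\<theta> + 1) \<noteq> 0" using \<alpha> \<open>\<theta> > 0\<close> by (auto intro!: Gamma_real_nonzero)
  then have "y_mom \<alpha> 2 \<theta> = (2 - \<alpha>) * (1 - \<alpha>) / ((\<theta> + 2) * (\<theta> + 1))" unfolding y_mom_def G by simp
  also have "\<dots> \<le> (2 * 1) / (\<theta> * \<theta>)" using \<alpha> \<open>\<theta> > 0\<close> by (intro frac_le mult_mono) auto
  finally show ?thesis by (simp add: power2_eq_square)
qed

lemma integrable_BM_powr: "\<theta> > 0 \<Longrightarrow> q \<ge> 0 \<Longrightarrow> integrable (BM \<theta>) (\<lambda>y. y powr q)"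
  using BM_y_mom by (rule integrable.intros)

lemma integrable_BM_rem: "\<theta> > 0 \<Longrightarrow> q \<ge> 0 \<Longrightarrow> integrable (BM \<theta>) (\<lambda>y. (1 - y) powr q)"
  using BM_rem_mom by (rule integrable.intros)

lemma integral_BM_powr: "\<theta> > 0 \<Longrightarrow> q \<ge> 0 \<Longrightarrow> (\<integral>y. y powr q \<partial>BM \<theta>) = y_mom \<alpha> q \<theta>"
  using BM_y_mom by (rule has_bochner_integral_integral_eq)

lemma integral_BM_rem: "\<theta> > 0 \<Longrightarrow> q \<ge> 0 \<Longrightarrow> (\<integral>y. (1 - y) powr q \<partial>BM \<theta>) = rem_mom \<alpha> q \<theta>"
  using BM_rem_mom by (rule has_bochner_integral_integral_eq)

lemma integral_BM_square:
  assumes "\<theta> > 0" "q \<ge> 0"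
  shows "integrable (BM \<theta>) (\<lambda>y. (y powr q)\<^sup>2)" "(\<integral>y. (y powr q)\<^sup>2 \<partial>BM \<theta>) = y_mom \<alpha> (2 * q) \<theta>"
    and "integrable (BM \<theta>) (\<lambda>y. ((1 - y) powr q)\<^sup>2)" "(\<integral>y. ((1 - y) powr q)\<^sup>2 \<partial>BM \<theta>) = rem_mom \<alpha> (2 * q) \<theta>"
proof -
  have *: "AE y in BM \<theta>. (y powr q)\<^sup>2 = y powr (2 * q)" "AE y in BM \<theta>. ((1 - y) powr q)\<^sup>2 = (1 - y) powr (2 * q)"
    using AE_beta_measure[of "1 - \<alpha>" "\<theta> + \<alpha>"] by (eventually_elim, simp add: powr_power mult.commute)+
  show "integrable (BM \<theta>) (\<lambda>y. (y powr q)\<^sup>2)"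
    using integrable_BM_powr[of \<theta> "2 * q"] assms * by (subst integrable_cong_AE) auto
  show "integrable (BM \<theta>) (\<lambda>y. ((1 - y) powr q)\<^sup>2)"
    using integrable_BM_rem[of \<theta> "2 * q"] assms * by (subst integrable_cong_AE) auto
  show "(\<integral>y. (y powr q)\<^sup>2 \<partial>BM \<theta>) = y_mom \<alpha> (2 * q) \<theta>"
    using integral_BM_powr[of \<theta> "2 * q"] assms * by (subst integral_cong_AE) auto
  show "(\<integral>y. ((1 - y) powr q)\<^sup>2 \<partial>BM \<theta>) = rem_mom \<alpha> (2 * q) \<theta>"
    using integral_BM_rem[of \<theta> "2 * q"] assms * by (subst integral_cong_AE) auto
qed

lemma y_mom_square_le: "\<theta> > 0 \<Longrightarrow> q \<ge> 0 \<Longrightarrow> (y_mom \<alpha> q \<theta>)\<^sup>2 \<le> y_mom \<alpha> (2 * q) \<theta>"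
  using prob_space.square_expectation_le[OF prob_space_BM, of \<theta> "\<lambda>y. y powr q"]
    integral_BM_square[of \<theta> q] integral_BM_powr[of \<theta> q] by simp

lemma rem_mom_square_le: "\<theta> > 0 \<Longrightarrow> q \<ge> 0 \<Longrightarrow> (rem_mom \<alpha> q \<theta>)\<^sup>2 \<le> rem_mom \<alpha> (2 * q) \<theta>"
  using prob_space.square_expectation_le[OF prob_space_BM, of \<theta> "\<lambda>y. (1 - y) powr q"]
    integral_BM_square[of \<theta> q] integral_BM_rem[of \<theta> q] by simp

lemma one_minus_rem_mom_le:
  assumes "\<theta> > 0" "p > 0"
  shows "0 \<le> 1 - rem_mom \<alpha> p \<theta>" "1 - rem_mom \<alpha> p \<theta> \<le> max 1 p * y_mom \<alpha> 1 \<theta>"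
proof -
  interpret prob_space "BM \<theta>" by (rule prob_space_BM) fact
  have ae: "AE y in BM \<theta>. 0 \<le> 1 - (1 - y) powr p" "AE y in BM \<theta>. 1 - (1 - y) powr p \<le> max 1 p * y powr 1"
    using AE_beta_measure[of "1 - \<alpha>" "\<theta> + \<alpha>"]
    by (eventually_elim, use one_minus_powr_bounds[OF _ _ \<open>p > 0\<close>] in simp)+
  have e: "1 - rem_mom \<alpha> p \<theta> = (\<integral>y. 1 - (1 - y) powr p \<partial>BM \<theta>)"
    using integral_BM_rem[of \<theta> p] integrable_BM_rem[of \<theta> p] assms prob_space
    by (subst Bochner_Integration.integral_diff) auto
  show "0 \<le> 1 - rem_mom \<alpha> p \<theta>"
    unfolding e by (rule integral_nonneg_AE) (rule ae)
  have "(\<integral>y. 1 - (1 - y) powr p \<partial>BM \<theta>) \<le> (\<integral>y. max 1 p * y powr 1 \<partial>BM \<theta>)"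
    using assms integrable_BM_powr[of \<theta> 1] integrable_BM_rem[of \<theta> p] ae
    by (intro integral_mono_AE) auto
  also have "\<dots> = max 1 p * y_mom \<alpha> 1 \<theta>"
    using integral_BM_powr[of \<theta> 1] assms by (subst integral_mult_right_zero) simp
  finally show "1 - rem_mom \<alpha> p \<theta> \<le> max 1 p * y_mom \<alpha> 1 \<theta>" unfolding e .
qed

text \<open>The variance of \<open>(1 - Y)^p\<close> is at most its second moment about 1, hence at
  most \<open>K\<^sup>2 * E Y\<^sup>2\<close>, which is at most
  \<open>2 * K\<^sup>2 / \<theta>\<^sup>2\<close>. The threshold on \<open>\<theta>\<close> gives
  \<open>a \<ge> 1 / 2\<close>, which makes the bound relative and turns 2 into 8. The exponential
  form is chosen for multiplication over the sticks.\<close>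

lemma rem_mom_double_le:
  assumes "p > 0" "\<theta> \<ge> 2 * max 1 p"
  shows "rem_mom \<alpha> (2 * p) \<theta> \<le> (rem_mom \<alpha> p \<theta>)\<^sup>2 * exp (8 * (max 1 p)\<^sup>2 / \<theta>\<^sup>2)"
proof -
  define K where "K = max 1 p"
  have K: "K \<ge> 1" "\<theta> \<ge> 2 * K" using assms by (auto simp: K_def)
  then have "\<theta> > 0" by simp
  interpret prob_space "BM \<theta>" by (rule prob_space_BM) fact
  define a where "a = rem_mom \<alpha> p \<theta>"
  have "1 - a \<le> K * y_mom \<alpha> 1 \<theta>"
    unfolding a_def K_def using assms \<open>\<theta> > 0\<close> by (intro one_minus_rem_mom_le)
  also have "\<dots> \<le> K * (1 / \<theta>)" using K \<open>\<theta> > 0\<close> by (intro mult_left_mono y_mom_1_le) auto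
  also have "\<dots> \<le> 1 / 2" using K \<open>\<theta> > 0\<close> by (simp add: field_simps)
  finally have a: "a \<ge> 1 / 2" by simp
  have "rem_mom \<alpha> (2 * p) \<theta> - a\<^sup>2 \<le> (\<integral>y. (1 - (1 - y) powr p)\<^sup>2 \<partial>BM \<theta>)"
  proof -
    have "(\<integral>y. (1 - (1 - y) powr p)\<^sup>2 \<partial>BM \<theta>) = (\<integral>y. 1 - 2 * (1 - y) powr p + ((1 - y) powr p)\<^sup>2 \<partial>BM \<theta>)"
      by (intro Bochner_Integration.integral_cong) (auto simp: power2_diff)
    also have "\<dots> = 1 - 2 * a + rem_mom \<alpha> (2 * p) \<theta>"
      unfolding a_def using integrable_BM_rem[of \<theta> p] integral_BM_rem[of \<theta> p] integral_BM_square(3,4)[of \<theta> p]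
        \<open>\<theta> > 0\<close> \<open>p > 0\<close> prob_space by simp
    also have "\<dots> = rem_mom \<alpha> (2 * p) \<theta> - a\<^sup>2 + (1 - a)\<^sup>2"
      by (simp add: power2_diff)
    finally show ?thesis by simp
  qed
  also have "\<dots> \<le> (\<integral>y. K\<^sup>2 * (y powr 1)\<^sup>2 \<partial>BM \<theta>)"
  proof (rule integral_mono_AE')
    show "integrable (BM \<theta>) (\<lambda>y. K\<^sup>2 * (y powr 1)\<^sup>2)"
      using integral_BM_square(1)[of \<theta> 1] \<open>\<theta> > 0\<close> by (intro integrable_mult_right) auto
    show "AE y in BM \<theta>. (1 - (1 - y) powr p)\<^sup>2 \<le> K\<^sup>2 * (y powr 1)\<^sup>2"
      using AE_beta_measure[of "1 - \<alpha>" "\<theta> + \<alpha>"]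
    proof eventually_elim
      case (elim y)
      have "(1 - (1 - y) powr p)\<^sup>2 \<le> (K * y)\<^sup>2"
        unfolding K_def using elim assms by (intro power_mono one_minus_powr_bounds) auto
      then show ?case using elim by (simp add: power_mult_distrib)
    qed
  qed auto
  also have "\<dots> = K\<^sup>2 * y_mom \<alpha> 2 \<theta>"
    using integral_BM_square(2)[of \<theta> 1] \<open>\<theta> > 0\<close> by (subst integral_mult_right_zero) simp
  also have "\<dots> \<le> K\<^sup>2 * (2 / \<theta>\<^sup>2)"
    using \<open>\<theta> > 0\<close> by (intro mult_left_mono y_mom_2_le) auto
  also have "\<dots> = (1/2)\<^sup>2 * (8 * K\<^sup>2 / \<theta>\<^sup>2)" by (simp add: power2_eq_square)
  also have "\<dots> \<le> a\<^sup>2 * (8 * K\<^sup>2 / \<theta>\<^sup>2)"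
    using a by (intro mult_right_mono power_mono) auto
  finally have "rem_mom \<alpha> (2 * p) \<theta> \<le> a\<^sup>2 * (1 + 8 * K\<^sup>2 / \<theta>\<^sup>2)"
    by (simp add: algebra_simps)
  also have "\<dots> \<le> a\<^sup>2 * exp (8 * K\<^sup>2 / \<theta>\<^sup>2)"
    by (intro mult_left_mono exp_ge_add_one_self) auto
  finally show ?thesis by (simp add: a_def K_def)
qed

text \<open>By \<open>pd_mean_rec\<close> the innovation is a centred power of \<open>y\<close> plus
  \<open>pd_mean\<close> times a centred power of \<open>1 - y\<close>. Two uses of
  \<open>fourth_power_sum_le\<close> give the factor 64; Jensen absorbs the fourth powers of the
  means and doubles it.\<close>

lemma innov_fourth_le:
  assumes p: "p > \<alpha>" and "\<theta> > 0"
  shows "integrable (BM \<theta>) (\<lambda>y. innov \<alpha> p \<theta> y ^ 4)"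
    and "(\<integral>y. innov \<alpha> p \<theta> y ^ 4 \<partial>BM \<theta>)
      \<le> 128 * (y_mom \<alpha> (4 * p) \<theta> + (max 1 p * pd_mean \<alpha> p (\<theta> + \<alpha>)) ^ 4 * y_mom \<alpha> 4 \<theta>)"
proof -
  interpret prob_space "BM \<theta>" by (rule prob_space_BM) fact
  have p0: "p > 0" using assms \<alpha> by simp
  define K where "K = max 1 p"
  define m' where "m' = pd_mean \<alpha> p (\<theta> + \<alpha>)"
  define u where "u = y_mom \<alpha> p \<theta>"
  define z where "z = 1 - rem_mom \<alpha> p \<theta>"
  define w where "w = y_mom \<alpha> 1 \<theta>"
  have K: "K \<ge> 1" by (simp add: K_def)
  have m': "m' > 0" unfolding m'_def using assms \<alpha> by (intro pd_mean_pos) auto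
  have z: "0 \<le> z" "z \<le> K * w" unfolding z_def K_def w_def using assms p0 by (intro one_minus_rem_mom_le; simp)+
  let ?g = "\<lambda>y. 64 * (y powr (4 * p) + u ^ 4 + (K * m') ^ 4 * y powr 4 + (K * m') ^ 4 * w ^ 4)"
  have fourth: "(y powr q) ^ 4 = y powr (4 * q)" if "y > 0" for y q :: real
    using that by (simp add: powr_power mult.commute)
  have int: "integrable (BM \<theta>) ?g"
    using assms p0 by (intro integrable_mult_right Bochner_Integration.integrable_add integrable_BM_powr) auto
  have le: "AE y in BM \<theta>. innov \<alpha> p \<theta> y ^ 4 \<le> ?g y"
    using AE_beta_measure[of "1 - \<alpha>" "\<theta> + \<alpha>"]
  proof eventually_elim
    case (elim y)
    define U where "U = y powr p"
    define Z where "Z = 1 - (1 - y) powr p"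
    have "innov \<alpha> p \<theta> y = (U + (- u)) + (m' * z + (- m' * Z))"
      unfolding innov_def pd_mean_rec[OF assms] U_def Z_def u_def z_def m'_def by (simp add: algebra_simps)
    also have "\<dots> ^ 4 \<le> 8 * ((U + (- u)) ^ 4 + (m' * z + (- m' * Z)) ^ 4)"
      by (rule fourth_power_sum_le)
    also have "\<dots> \<le> 8 * (8 * (U ^ 4 + (- u) ^ 4) + 8 * ((m' * z) ^ 4 + (- m' * Z) ^ 4))"
      by (intro mult_left_mono add_mono fourth_power_sum_le) auto
    also have "\<dots> = 64 * (U ^ 4 + u ^ 4 + (m' * Z) ^ 4 + (m' * z) ^ 4)"
      by (simp add: power_mult_distrib)
    also have "\<dots> \<le> 64 * (U ^ 4 + u ^ 4 + (m' * (K * y)) ^ 4 + (m' * (K * w)) ^ 4)"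
    proof (intro mult_left_mono add_mono order.refl power_mono)
      show "Z \<le> K * y" "0 \<le> m' * Z" unfolding Z_def K_def
        using one_minus_powr_bounds[of y p] elim p0 m' by auto
      show "0 \<le> m' * z" using z m' by auto
    qed (use z m' in auto)
    also have "\<dots> = ?g y"
      using elim fourth[of y p] by (simp add: U_def power_mult_distrib powr_numeral)
    finally show ?case .
  qed
  show i: "integrable (BM \<theta>) (\<lambda>y. innov \<alpha> p \<theta> y ^ 4)"
  proof (rule Bochner_Integration.integrable_bound[OF int])
    show "AE y in BM \<theta>. norm (innov \<alpha> p \<theta> y ^ 4) \<le> norm (?g y)"
      using le by eventually_elim (auto simp: abs_le_iff intro: order.trans[OF _ abs_ge_self] order.trans)
  qed measurable
  have "(\<integral>y. innov \<alpha> p \<theta> y ^ 4 \<partial>BM \<theta>) \<le> (\<integral>y. ?g y \<partial>BM \<theta>)"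
    by (intro integral_mono_AE i int le)
  also have "\<dots> = 64 * (y_mom \<alpha> (4 * p) \<theta> + u ^ 4 + (K * m') ^ 4 * y_mom \<alpha> 4 \<theta> + (K * m') ^ 4 * w ^ 4)"
    using assms p0 integrable_BM_powr[of \<theta> "4 * p"] integrable_BM_powr[of \<theta> 4] integral_BM_powr[of \<theta> "4 * p"] integral_BM_powr[of \<theta> 4]
      prob_space by simp
  also have "\<dots> \<le> 64 * (y_mom \<alpha> (4 * p) \<theta> + y_mom \<alpha> (4 * p) \<theta> + (K * m') ^ 4 * y_mom \<alpha> 4 \<theta> + (K * m') ^ 4 * y_mom \<alpha> 4 \<theta>)"
  proof -
    have *: "y_mom \<alpha> q \<theta> ^ 4 \<le> y_mom \<alpha> (4 * q) \<theta>" if "q \<ge> 0" for q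
    proof -
      have "((y_mom \<alpha> q \<theta>)\<^sup>2)\<^sup>2 \<le> (y_mom \<alpha> (2 * q) \<theta>)\<^sup>2"
        using that assms by (intro power_mono y_mom_square_le) auto
      also have "\<dots> \<le> y_mom \<alpha> (2 * (2 * q)) \<theta>"
        using that assms by (intro y_mom_square_le) auto
      finally show ?thesis by simp
    qed
    show ?thesis
      using *[of p] *[of 1] p0 unfolding u_def w_def
      by (intro mult_left_mono add_mono) auto
  qed
  also have "\<dots> = 128 * (y_mom \<alpha> (4 * p) \<theta> + (K * m') ^ 4 * y_mom \<alpha> 4 \<theta>)"
    by simp
  finally show "(\<integral>y. innov \<alpha> p \<theta> y ^ 4 \<partial>BM \<theta>)
      \<le> 128 * (y_mom \<alpha> (4 * p) \<theta> + (max 1 p * pd_mean \<alpha> p (\<theta> + \<alpha>)) ^ 4 * y_mom \<alpha> 4 \<theta>)"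
    by (simp add: K_def m'_def)
qed

end

section \<open>Asymptotics of the moments for large \<theta>\<close>

definition Gamma_ratio :: "real \<Rightarrow> real \<Rightarrow> real" where
  "Gamma_ratio q x = Gamma (x + q) / (Gamma x * x powr q)"

lemma Gamma_ratio_pos: "q \<ge> 0 \<Longrightarrow> x > 0 \<Longrightarrow> Gamma_ratio q x > 0"
  by (auto simp: Gamma_ratio_def intro!: divide_pos_pos mult_pos_pos Gamma_real_pos)

lemma Gamma_quotient_eq_ratio:
  assumes "\<theta> > 0" "q \<ge> 0"
  shows "Gamma (\<theta> + 1) / Gamma (\<theta> + q) = \<theta> powr (1 - q) / Gamma_ratio q \<theta>"
proof -
  have "Gamma (\<theta> + 1) = \<theta> * Gamma \<theta>" using assms by (intro Gamma_real_Suc)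
  moreover have "\<theta> powr (1 - q) * \<theta> powr q = \<theta>" using assms by (simp flip: powr_add)
  moreover have "Gamma (\<theta> + q) \<noteq> 0" "Gamma \<theta> \<noteq> 0" using assms by (auto intro!: Gamma_real_nonzero)
  ultimately show ?thesis
    using assms unfolding Gamma_ratio_def by (simp add: field_simps)
qed

lemma tendsto_Gamma_ratio: "q \<ge> 0 \<Longrightarrow> (Gamma_ratio q \<longlongrightarrow> 1) at_top"
  unfolding Gamma_ratio_def by (rule tendsto_Gamma_quotient)

context pd_param
begin

lemma pd_mean_eq_ratio:
  assumes "\<theta> > 0" "q \<ge> 0"
  shows "pd_mean \<alpha> q \<theta> = Gamma (q - \<alpha>) / Gamma (1 - \<alpha>) * (\<theta> powr (1 - q) / Gamma_ratio q \<theta>)"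
  unfolding pd_mean_def Gamma_quotient_eq_ratio[OF assms] ..

lemma tendsto_pd_mean:
  assumes "q > \<alpha>"
  shows "((\<lambda>\<theta>. pd_mean \<alpha> q \<theta> * \<theta> powr (q - 1)) \<longlongrightarrow> Gamma (q - \<alpha>) / Gamma (1 - \<alpha>)) at_top"
proof -
  have "((\<lambda>\<theta>. Gamma (q - \<alpha>) / Gamma (1 - \<alpha>) * (1 / Gamma_ratio q \<theta>)) \<longlongrightarrow> Gamma (q - \<alpha>) / Gamma (1 - \<alpha>) * (1 / 1)) at_top"
    using assms \<alpha> by (intro tendsto_intros tendsto_Gamma_ratio) auto
  then have "((\<lambda>\<theta>. Gamma (q - \<alpha>) / Gamma (1 - \<alpha>) * (1 / Gamma_ratio q \<theta>)) \<longlongrightarrow> Gamma (q - \<alpha>) / Gamma (1 - \<alpha>)) at_top"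
    by simp
  then show ?thesis
  proof (rule Lim_transform_eventually)
    show "\<forall>\<^sub>F \<theta> in at_top. Gamma (q - \<alpha>) / Gamma (1 - \<alpha>) * (1 / Gamma_ratio q \<theta>) = pd_mean \<alpha> q \<theta> * \<theta> powr (q - 1)"
      using eventually_gt_at_top[of 0]
    proof eventually_elim
      case (elim \<theta>)
      have "\<theta> powr (1 - q) * \<theta> powr (q - 1) = 1" using elim by (simp flip: powr_add)
      then show ?case using pd_mean_eq_ratio[of \<theta> q] elim assms \<alpha> by (simp add: mult.assoc)
    qed
  qed
qed

lemma tendsto_pd_mean_shift:
  assumes "q > \<alpha>"
  shows "((\<lambda>\<theta>. pd_mean \<alpha> q (\<theta> + \<alpha>) * \<theta> powr (q - 1)) \<longlongrightarrow> Gamma (q - \<alpha>) / Gamma (1 - \<alpha>)) at_top"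
proof -
  have "((\<lambda>\<theta>. pd_mean \<alpha> q (\<theta> + \<alpha>) * (\<theta> + \<alpha>) powr (q - 1)) \<longlongrightarrow> Gamma (q - \<alpha>) / Gamma (1 - \<alpha>)) at_top"
    by (rule filterlim_compose[OF tendsto_pd_mean[OF assms]]) real_asymp
  moreover have "((\<lambda>\<theta>. (\<theta> / (\<theta> + \<alpha>)) powr (q - 1)) \<longlongrightarrow> 1) at_top"
    by real_asymp
  ultimately have "((\<lambda>\<theta>. pd_mean \<alpha> q (\<theta> + \<alpha>) * (\<theta> + \<alpha>) powr (q - 1) * (\<theta> / (\<theta> + \<alpha>)) powr (q - 1)) \<longlongrightarrow> Gamma (q - \<alpha>) / Gamma (1 - \<alpha>) * 1) at_top"
    by (rule tendsto_mult)
  then have "((\<lambda>\<theta>. pd_mean \<alpha> q (\<theta> + \<alpha>) * (\<theta> + \<alpha>) powr (q - 1) * (\<theta> / (\<theta> + \<alpha>)) powr (q - 1)) \<longlongrightarrow> Gamma (q - \<alpha>) / Gamma (1 - \<alpha>)) at_top"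
    by simp
  then show ?thesis
  proof (rule Lim_transform_eventually)
    show "\<forall>\<^sub>F \<theta> in at_top. pd_mean \<alpha> q (\<theta> + \<alpha>) * (\<theta> + \<alpha>) powr (q - 1) * (\<theta> / (\<theta> + \<alpha>)) powr (q - 1) = pd_mean \<alpha> q (\<theta> + \<alpha>) * \<theta> powr (q - 1)"
      using eventually_gt_at_top[of 0] by eventually_elim (use \<alpha> in \<open>simp add: powr_divide\<close>)
  qed
qed

lemma tendsto_y_mom:
  assumes "q \<ge> 0"
  shows "((\<lambda>\<theta>. y_mom \<alpha> q \<theta> * \<theta> powr q) \<longlongrightarrow> Gamma (1 - \<alpha> + q) / Gamma (1 - \<alpha>)) at_top"
proof -
  have "((\<lambda>\<theta>. Gamma_ratio q (\<theta> + 1)) \<longlongrightarrow> 1) at_top"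
    by (rule filterlim_compose[OF tendsto_Gamma_ratio[OF assms]]) real_asymp
  moreover have "((\<lambda>\<theta>. (\<theta> / (\<theta> + 1)) powr q) \<longlongrightarrow> 1) at_top"
    by real_asymp
  ultimately have "((\<lambda>\<theta>. Gamma (1 - \<alpha> + q) / Gamma (1 - \<alpha>) * ((\<theta> / (\<theta> + 1)) powr q / Gamma_ratio q (\<theta> + 1))) \<longlongrightarrow> Gamma (1 - \<alpha> + q) / Gamma (1 - \<alpha>) * (1 / 1)) at_top"
    by (intro tendsto_intros) auto
  then have "((\<lambda>\<theta>. Gamma (1 - \<alpha> + q) / Gamma (1 - \<alpha>) * ((\<theta> / (\<theta> + 1)) powr q / Gamma_ratio q (\<theta> + 1))) \<longlongrightarrow> Gamma (1 - \<alpha> + q) / Gamma (1 - \<alpha>)) at_top"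
    by simp
  then show ?thesis
  proof (rule Lim_transform_eventually)
    show "\<forall>\<^sub>F \<theta> in at_top. Gamma (1 - \<alpha> + q) / Gamma (1 - \<alpha>) * ((\<theta> / (\<theta> + 1)) powr q / Gamma_ratio q (\<theta> + 1)) = y_mom \<alpha> q \<theta> * \<theta> powr q"
      using eventually_gt_at_top[of 0]
    proof eventually_elim
      case (elim \<theta>)
      then have "Gamma (\<theta> + 1 + q) \<noteq> 0" "Gamma (\<theta> + 1) \<noteq> 0" using assms by (auto intro!: Gamma_real_nonzero)
      then have "(\<theta> / (\<theta> + 1)) powr q / Gamma_ratio q (\<theta> + 1) = Gamma (\<theta> + 1) / Gamma (\<theta> + 1 + q) * \<theta> powr q"
        using elim by (simp add: Gamma_ratio_def powr_divide)
      then show ?case by (simp add: y_mom_def)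
    qed
  qed
qed

text \<open>Both terms of \<open>innov_fourth_le\<close> have order
  \<open>\<theta> powr (- 4 * p)\<close>, since \<open>pd_mean\<close> has order
  \<open>\<theta> powr (1 - p)\<close>. Expressing the bound through \<open>y_mom\<close> at
  \<open>4 * p\<close> makes the later sum over sticks telescope to \<open>pd_mean\<close> at
  \<open>4 * p\<close>.\<close>

lemma eventually_innov_fourth_le:
  assumes p: "p > \<alpha>"
  obtains C \<theta>0 where "C > 0" "\<theta>0 > 0"
    "\<And>\<theta>. \<theta> \<ge> \<theta>0 \<Longrightarrow> (\<integral>y. innov \<alpha> p \<theta> y ^ 4 \<partial>BM \<theta>) \<le> C * y_mom \<alpha> (4 * p) \<theta>"
proof -
  define c where "c = Gamma (p - \<alpha>) / Gamma (1 - \<alpha>)"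
  define h where "h q = Gamma (1 - \<alpha> + q) / Gamma (1 - \<alpha>)" for q
  have p0: "p > 0" using assms \<alpha> by simp
  have "((\<lambda>\<theta>. (max 1 p * (pd_mean \<alpha> p (\<theta> + \<alpha>) * \<theta> powr (p - 1))) ^ 4 * (y_mom \<alpha> 4 \<theta> * \<theta> powr 4) / (y_mom \<alpha> (4 * p) \<theta> * \<theta> powr (4 * p)))
     \<longlongrightarrow> (max 1 p * c) ^ 4 * h 4 / h (4 * p)) at_top"
    unfolding c_def h_def using p0 p \<alpha>
    by (intro tendsto_intros tendsto_pd_mean_shift tendsto_y_mom)
       (auto intro!: Gamma_real_nonzero)
  then have "\<forall>\<^sub>F \<theta> in at_top. (max 1 p * (pd_mean \<alpha> p (\<theta> + \<alpha>) * \<theta> powr (p - 1))) ^ 4 * (y_mom \<alpha> 4 \<theta> * \<theta> powr 4) / (y_mom \<alpha> (4 * p) \<theta> * \<theta> powr (4 * p))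
     < (max 1 p * c) ^ 4 * h 4 / h (4 * p) + 1"
    by (rule order_tendstoD) simp
  moreover define L where "L = (max 1 p * c) ^ 4 * h 4 / h (4 * p) + 1"
  have "c > 0" "h 4 > 0" "h (4 * p) > 0"
    unfolding c_def h_def using p0 p \<alpha> by (auto intro!: divide_pos_pos Gamma_real_pos)
  then have "L > 0" unfolding L_def by (intro add_nonneg_pos divide_nonneg_nonneg mult_nonneg_nonneg) auto
  ultimately obtain \<theta>1 where \<theta>1: "\<And>\<theta>. \<theta> \<ge> \<theta>1 \<Longrightarrow> (max 1 p * (pd_mean \<alpha> p (\<theta> + \<alpha>) * \<theta> powr (p - 1))) ^ 4 * (y_mom \<alpha> 4 \<theta> * \<theta> powr 4) / (y_mom \<alpha> (4 * p) \<theta> * \<theta> powr (4 * p)) < L"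
    by (auto simp: eventually_at_top_linorder L_def)
  show ?thesis
  proof (rule that[of "128 * (1 + L)" "max \<theta>1 1"])
    fix \<theta> assume \<theta>: "\<theta> \<ge> max \<theta>1 1"
    then have \<theta>0: "\<theta> > 0" by simp
    have y: "y_mom \<alpha> (4 * p) \<theta> > 0" using \<theta>0 p0 by (intro y_mom_pos) auto
    have e: "(\<theta> powr (p - 1)) ^ 4 * \<theta> powr 4 = \<theta> powr (4 * p)"
    proof -
      have "(\<theta> powr (p - 1)) ^ 4 = \<theta> powr (4 * p - 4)"
        using \<theta>0 by (simp add: powr_power algebra_simps)
      then show ?thesis by (simp only: powr_add[symmetric]) simp
    qed
    have n: "(max 1 p * (pd_mean \<alpha> p (\<theta> + \<alpha>) * \<theta> powr (p - 1))) ^ 4 * (y_mom \<alpha> 4 \<theta> * \<theta> powr 4)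
        = (max 1 p * pd_mean \<alpha> p (\<theta> + \<alpha>)) ^ 4 * y_mom \<alpha> 4 \<theta> * ((\<theta> powr (p - 1)) ^ 4 * \<theta> powr 4)"
      by (simp only: power_mult_distrib mult_ac)
    have "(max 1 p * pd_mean \<alpha> p (\<theta> + \<alpha>)) ^ 4 * y_mom \<alpha> 4 \<theta> / y_mom \<alpha> (4 * p) \<theta>
       = (max 1 p * (pd_mean \<alpha> p (\<theta> + \<alpha>) * \<theta> powr (p - 1))) ^ 4 * (y_mom \<alpha> 4 \<theta> * \<theta> powr 4) / (y_mom \<alpha> (4 * p) \<theta> * \<theta> powr (4 * p))"
      unfolding n e using \<theta>0 y by simp
    also have "\<dots> < L" using \<theta> by (intro \<theta>1) auto
    finally have "(max 1 p * pd_mean \<alpha> p (\<theta> + \<alpha>)) ^ 4 * y_mom \<alpha> 4 \<theta> \<le> L * y_mom \<alpha> (4 * p) \<theta>"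
      using y by (simp add: pos_divide_less_eq)
    then show "(\<integral>y. innov \<alpha> p \<theta> y ^ 4 \<partial>BM \<theta>) \<le> 128 * (1 + L) * y_mom \<alpha> (4 * p) \<theta>"
      using innov_fourth_le(2)[OF p \<theta>0] by (simp add: algebra_simps)
  qed (use \<open>L > 0\<close> in auto)
qed

text \<open>The normalised mean is exactly \<open>1 / Gamma_ratio p \<theta>\<close>, so
  \<open>Gamma_quotient_rate\<close> applies.\<close>

lemma pd_centering:
  assumes p: "p > \<alpha>"
  shows "((\<lambda>\<theta>. sqrt \<theta> * (Gamma (1 - \<alpha>) / Gamma (p - \<alpha>) * \<theta> powr (p - 1) * pd_mean \<alpha> p \<theta> - 1)) \<longlongrightarrow> 0) at_top"
proof -
  have p0: "p > 0" using assms \<alpha> by simp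
  have "((\<lambda>\<theta>. - (sqrt \<theta> * (Gamma_ratio p \<theta> - 1)) / Gamma_ratio p \<theta>) \<longlongrightarrow> - 0 / 1) at_top"
    unfolding Gamma_ratio_def using p0 by (intro tendsto_intros Gamma_quotient_rate tendsto_Gamma_quotient) auto
  then have "((\<lambda>\<theta>. - (sqrt \<theta> * (Gamma_ratio p \<theta> - 1)) / Gamma_ratio p \<theta>) \<longlongrightarrow> 0) at_top" by simp
  then show ?thesis
  proof (rule Lim_transform_eventually)
    show "\<forall>\<^sub>F \<theta> in at_top. - (sqrt \<theta> * (Gamma_ratio p \<theta> - 1)) / Gamma_ratio p \<theta> = sqrt \<theta> * (Gamma (1 - \<alpha>) / Gamma (p - \<alpha>) * \<theta> powr (p - 1) * pd_mean \<alpha> p \<theta> - 1)"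
      using eventually_gt_at_top[of 0]
    proof eventually_elim
      case (elim \<theta>)
      have "\<theta> powr (p - 1) * \<theta> powr (1 - p) = 1" using elim by (simp flip: powr_add)
      moreover have "Gamma (1 - \<alpha>) \<noteq> 0" "Gamma (p - \<alpha>) \<noteq> 0" using p \<alpha> by (auto intro!: Gamma_real_nonzero)
      ultimately have e: "Gamma (1 - \<alpha>) / Gamma (p - \<alpha>) * \<theta> powr (p - 1) * pd_mean \<alpha> p \<theta> = 1 / Gamma_ratio p \<theta>"
        using pd_mean_eq_ratio[of \<theta> p] elim p0 by (simp add: mult_ac)
      show ?case unfolding e using Gamma_ratio_pos[of p \<theta>] elim p0 by (simp add: field_simps)
    qed
  qed
qed

text \<open>With \<open>x\<close> and \<open>y\<close> the Gamma ratios for \<open>p\<close> and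
  \<open>2 * p\<close>, the scaled variance is \<open>d / (c\<^sup>2 * y) + (\<theta> + \<alpha>) /
  y - \<theta> / x\<^sup>2\<close>. The two terms of order \<open>\<theta>\<close> combine to
  \<open>- \<theta> * (y / x\<^sup>2 - 1) / y\<close>, where \<open>Gamma_second_difference\<close>
  gives the limit \<open>- p\<^sup>2\<close>.\<close>

lemma tendsto_pd_var:
  assumes p: "p > \<alpha>"
  shows "((\<lambda>\<theta>. (Gamma (1 - \<alpha>) / Gamma (p - \<alpha>) * \<theta> powr (p - 1 / 2))\<^sup>2 * pd_var \<alpha> p \<theta>) \<longlongrightarrow> sigma2 \<alpha> p) at_top"
proof -
  have p0: "p > 0" using assms \<alpha> by simp
  define c where "c = Gamma (p - \<alpha>) / Gamma (1 - \<alpha>)"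
  define d where "d = Gamma (2 * p - \<alpha>) / Gamma (1 - \<alpha>)"
  have c: "c > 0" unfolding c_def using p \<alpha> by (auto intro!: divide_pos_pos Gamma_real_pos)
  have s: "sigma2 \<alpha> p = (d / c\<^sup>2 + \<alpha>) / 1 - p\<^sup>2 / 1"
  proof -
    have "Gamma (1 - \<alpha>) \<noteq> 0" "Gamma (p - \<alpha>) \<noteq> 0" using p \<alpha> by (auto intro!: Gamma_real_nonzero)
    then show ?thesis by (simp add: sigma2_def c_def d_def power2_eq_square)
  qed
  have "((\<lambda>\<theta>. (d / c\<^sup>2 + \<alpha>) / Gamma_ratio (2 * p) \<theta>
       - (\<theta> * (Gamma \<theta> * Gamma (\<theta> + 2 * p) / (Gamma (\<theta> + p))\<^sup>2 - 1)) / Gamma_ratio (2 * p) \<theta>) \<longlongrightarrow> sigma2 \<alpha> p) at_top"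
    unfolding s using p0 by (intro tendsto_intros Gamma_second_difference tendsto_Gamma_ratio) auto
  then show ?thesis
  proof (rule Lim_transform_eventually)
    show "\<forall>\<^sub>F \<theta> in at_top. (d / c\<^sup>2 + \<alpha>) / Gamma_ratio (2 * p) \<theta>
       - (\<theta> * (Gamma \<theta> * Gamma (\<theta> + 2 * p) / (Gamma (\<theta> + p))\<^sup>2 - 1)) / Gamma_ratio (2 * p) \<theta>
        = (Gamma (1 - \<alpha>) / Gamma (p - \<alpha>) * \<theta> powr (p - 1 / 2))\<^sup>2 * pd_var \<alpha> p \<theta>"
      using eventually_gt_at_top[of 0]
    proof eventually_elim
      case (elim \<theta>)
      define x where "x = Gamma_ratio p \<theta>"
      define y where "y = Gamma_ratio (2 * p) \<theta>"
      have xy: "x > 0" "y > 0" using elim p0 by (auto simp: x_def y_def intro!: Gamma_ratio_pos)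
      have "Gamma \<theta> \<noteq> 0" "Gamma (\<theta> + p) \<noteq> 0" using elim p0 by (auto intro!: Gamma_real_nonzero)
      moreover have "\<theta> powr (2 * p) = (\<theta> powr p)\<^sup>2" using elim by (simp add: powr_power mult.commute)
      ultimately have D: "Gamma \<theta> * Gamma (\<theta> + 2 * p) / (Gamma (\<theta> + p))\<^sup>2 = y / x\<^sup>2"
        unfolding x_def y_def Gamma_ratio_def using elim by (simp add: power2_eq_square)
      have l: "(Gamma (1 - \<alpha>) / Gamma (p - \<alpha>) * \<theta> powr (p - 1 / 2))\<^sup>2 = \<theta> powr (2 * p - 1) / c\<^sup>2"
        using elim by (simp add: c_def power_mult_distrib power_divide powr_power algebra_simps)
      have m2: "pd_mean \<alpha> (2 * p) \<theta> = d * (\<theta> powr (1 - 2 * p) / y)"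
        unfolding d_def y_def using elim p0 by (intro pd_mean_eq_ratio) auto
      have pr: "pd_pair \<alpha> p \<theta> = c\<^sup>2 * (\<theta> + \<alpha>) * (\<theta> powr (1 - 2 * p) / y)"
        unfolding pd_pair_def c_def y_def using elim p0
        by (simp only: times_divide_eq_right[symmetric] Gamma_quotient_eq_ratio mult.assoc)
      have m1: "(pd_mean \<alpha> p \<theta>)\<^sup>2 = c\<^sup>2 * (\<theta> powr (1 - 2 * p) * \<theta> / x\<^sup>2)"
      proof -
        have "(\<theta> powr (1 - p))\<^sup>2 = \<theta> powr (1 - 2 * p) * \<theta>"
          using elim by (simp add: powr_power) (simp add: powr_mult_base algebra_simps)
        moreover have "pd_mean \<alpha> p \<theta> = c * (\<theta> powr (1 - p) / x)"
          unfolding c_def x_def using elim p0 by (intro pd_mean_eq_ratio) auto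
        ultimately show ?thesis by (simp add: power_mult_distrib power_divide)
      qed
      have "\<theta> powr (2 * p - 1) * \<theta> powr (1 - 2 * p) = 1" using elim by (simp flip: powr_add)
      moreover define t where "t = \<theta> powr (1 - 2 * p)"
      ultimately have t: "\<theta> powr (2 * p - 1) = 1 / t" "t > 0" using elim by (auto simp: field_simps)
      show ?case
        unfolding l pd_var_def m1 m2 pr D x_def[symmetric] y_def[symmetric] t t_def[symmetric]
        using xy c t by (simp add: field_simps power2_eq_square)
    qed
  qed
qed

text \<open>The two quantities are asymptotically equal, so the factor 2 leaves room. The purpose is
  to bound the squared mean, which has no one-step product formula, by the pair term, which has
  one.\<close>

lemma eventually_pd_mean_square_le:
  assumes p: "p > \<alpha>"
  shows "\<forall>\<^sub>F \<theta> in at_top. (pd_mean \<alpha> p \<theta>)\<^sup>2 \<le> 2 * pd_pair \<alpha> p \<theta>"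
proof -
  have p0: "p > 0" using assms \<alpha> by simp
  have "((\<lambda>\<theta>. Gamma_ratio (2 * p) \<theta> / (Gamma_ratio p \<theta>)\<^sup>2) \<longlongrightarrow> 1 / 1\<^sup>2) at_top"
    using p0 by (intro tendsto_intros tendsto_Gamma_ratio) auto
  then have "\<forall>\<^sub>F \<theta> in at_top. Gamma_ratio (2 * p) \<theta> / (Gamma_ratio p \<theta>)\<^sup>2 < 2"
    by (rule order_tendstoD) simp
  then show ?thesis
    using eventually_gt_at_top[of 0]
  proof eventually_elim
    case (elim \<theta>)
    define x where "x = Gamma_ratio p \<theta>"
    define y where "y = Gamma_ratio (2 * p) \<theta>"
    have xy: "x > 0" "y > 0" using elim p0 by (auto simp: x_def y_def intro!: Gamma_ratio_pos)
    define c where "c = Gamma (p - \<alpha>) / Gamma (1 - \<alpha>)"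
    have pr: "pd_pair \<alpha> p \<theta> = c\<^sup>2 * (\<theta> + \<alpha>) * (\<theta> powr (1 - 2 * p) / y)"
      unfolding pd_pair_def c_def y_def using elim p0
      by (simp only: times_divide_eq_right[symmetric] Gamma_quotient_eq_ratio mult.assoc)
    have "(\<theta> powr (1 - p))\<^sup>2 = \<theta> powr (1 - 2 * p) * \<theta>"
      using elim by (simp add: powr_power) (simp add: powr_mult_base algebra_simps)
    moreover have "pd_mean \<alpha> p \<theta> = c * (\<theta> powr (1 - p) / x)"
      unfolding c_def x_def using elim p0 by (intro pd_mean_eq_ratio) auto
    ultimately have "(pd_mean \<alpha> p \<theta>)\<^sup>2 = c\<^sup>2 * \<theta> * (\<theta> powr (1 - 2 * p) / y) * (y / x\<^sup>2)"
      using xy by (simp add: power_mult_distrib power_divide)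
    also have "\<dots> \<le> c\<^sup>2 * (\<theta> + \<alpha>) * (\<theta> powr (1 - 2 * p) / y) * 2"
      using xy elim \<alpha> by (intro mult_mono) (auto simp: x_def y_def)
    finally show ?case by (simp add: pr mult_ac)
  qed
qed

end

section \<open>The stick-breaking sequence\<close>

text \<open>Each factor is at most \<open>exp (- (b - a) / (t + k * s + b))\<close>, and the
  harmonic series diverges. It is applied with \<open>\<alpha> < q\<close> and with
  \<open>2 * \<alpha> < 2 * p\<close>.\<close>

lemma prod_ratio_tendsto_0:
  fixes a b s t :: real
  assumes "0 < t" "0 < s" "0 \<le> a" "a < b"
  shows "(\<lambda>n. \<Prod>k<n. (t + real k * s + a) / (t + real k * s + b)) \<longlonglongrightarrow> 0"
proof (rule tendsto_sandwich)
  define h where "h n = (\<Sum>k<n. 1 / (t + real k * s + b))" for n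
  have le: "(\<Prod>k<n. (t + real k * s + a) / (t + real k * s + b)) \<le> exp (- (b - a) * h n)" for n
  proof -
    have "(\<Prod>k<n. (t + real k * s + a) / (t + real k * s + b)) \<le> (\<Prod>k<n. exp (- (b - a) * (1 / (t + real k * s + b))))"
    proof (intro prod_mono conjI)
      fix k
      have pos: "t + real k * s + b > 0" using assms by (intro add_nonneg_pos) auto
      show "0 \<le> (t + real k * s + a) / (t + real k * s + b)"
        using assms pos by (intro divide_nonneg_pos) auto
      have "(t + real k * s + a) / (t + real k * s + b) = 1 + (- (b - a) * (1 / (t + real k * s + b)))"
        using pos by (simp add: field_simps)
      then show "(t + real k * s + a) / (t + real k * s + b) \<le> exp (- (b - a) * (1 / (t + real k * s + b)))"
        using exp_ge_add_one_self[of "- (b - a) * (1 / (t + real k * s + b))"] by simp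
    qed
    also have "\<dots> = exp (- (b - a) * h n)"
      by (simp add: h_def exp_sum sum_distrib_left)
    finally show ?thesis .
  qed
  show "\<forall>\<^sub>F n in sequentially. (\<Prod>k<n. (t + real k * s + a) / (t + real k * s + b)) \<le> exp (- (b - a) * h n)"
    using le by (intro always_eventually allI)
  show "\<forall>\<^sub>F n in sequentially. 0 \<le> (\<Prod>k<n. (t + real k * s + a) / (t + real k * s + b))"
    using assms by (intro always_eventually allI prod_nonneg divide_nonneg_nonneg) auto
  have "filterlim h at_top sequentially"
  proof -
    \<comment> \<open>Chosen so that \<open>t + k * s + b \<le> K * (k + 1)\<close> for every
      \<open>k\<close>.\<close>
    define K where "K = t + s + b"
    have K: "K > 0" using assms by (simp add: K_def)
    have lim: "filterlim (\<lambda>n. (1 / K) * harm n) at_top sequentially"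
      using K by (intro filterlim_tendsto_pos_mult_at_top[OF tendsto_const _ harm_at_top]) auto
    have le: "(1 / K) * harm n \<le> h n" for n
    proof -
      have "(1 / K) * harm n = (\<Sum>k<n. 1 / (K * real (Suc k)))"
        unfolding harm_def sum_distrib_left
        by (rule sum.reindex_bij_witness[of _ Suc "\<lambda>k. k - 1"]) (auto simp: field_simps)
      also have "\<dots> \<le> h n"
        unfolding h_def
      proof (intro sum_mono divide_left_mono)
        fix k
        show "t + real k * s + b \<le> K * real (Suc k)"
          using assms by (simp add: K_def algebra_simps)
        show "0 < K * real (Suc k) * (t + real k * s + b)"
          using assms K by (intro mult_pos_pos add_nonneg_pos) auto
      qed auto
      finally show ?thesis .
    qed
    show ?thesis
      by (rule filterlim_at_top_mono[OF lim]) (intro always_eventually allI le)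
  qed
  then have "filterlim (\<lambda>n. - (b - a) * h n) at_bot sequentially"
    by (rule filterlim_tendsto_neg_mult_at_bot[OF tendsto_const, rotated]) (use assms in simp)
  then show "(\<lambda>n. exp (- (b - a) * h n)) \<longlonglongrightarrow> 0"
    by (rule filterlim_compose[OF exp_at_bot])
qed auto

locale pd_seq = pd_param +
  fixes \<theta> p :: real
  assumes \<theta>: "\<theta> > 0" and p: "p > \<alpha>"
begin

abbreviation "\<theta>s k \<equiv> \<theta> + real k * \<alpha>"

text \<open>\<open>BM\<close> itself adds one \<open>\<alpha>\<close>, so coordinate
  \<open>i\<close> has second Beta parameter \<open>\<theta> + (i + 1) * \<alpha>\<close>, as in
  \<open>PD\<close>.\<close>

definition M :: "(nat \<Rightarrow> real) measure" where
  "M = PiM UNIV (\<lambda>i. BM (\<theta>s i))"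

text \<open>By independence this is the mean of \<open>R_k^q\<close>; see
  \<open>remaining_moment\<close>.\<close>

definition rho :: "real \<Rightarrow> nat \<Rightarrow> real" where
  "rho q k = (\<Prod>j<k. rem_mom \<alpha> q (\<theta>s j))"

definition remaining :: "nat \<Rightarrow> (nat \<Rightarrow> real) \<Rightarrow> real" where
  "remaining k y = (\<Prod>j<k. 1 - y j)"

lemma p0: "p > 0"
  using p \<alpha> by simp

lemma \<theta>s_pos [simp]: "\<theta>s k > 0"
  using \<theta> \<alpha> by (simp add: add_pos_nonneg)

lemma \<theta>s_Suc: "\<theta>s (Suc k) = \<theta>s k + \<alpha>"
  by (simp add: algebra_simps)

lemma M_eq: "M = PiM UNIV (\<lambda>i. beta_measure (1 - \<alpha>) (\<theta> + real (Suc i) * \<alpha>))"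
  unfolding M_def by (simp add: algebra_simps)

sublocale P: product_prob_space "\<lambda>i. BM (\<theta>s i)" UNIV
  by (rule product_prob_spaceI) (rule prob_space_BM[OF \<theta>s_pos])

sublocale prob_space M
  unfolding M_def by (rule P.P.prob_space_axioms)

lemma sets_M [measurable_cong]: "sets M = sets (PiM UNIV (\<lambda>_. borel))"
  unfolding M_def by (rule sets_PiM_cong) auto

lemma space_M [simp]: "space M = UNIV"
  by (simp add: M_def space_PiM PiE_def)

lemma distr_component: "distr M borel (\<lambda>y. y i) = BM (\<theta>s i)"
  unfolding M_def using P.PiM_component[of i] by (simp cong: distr_cong)

lemma has_bochner_integral_component:
  fixes f :: "real \<Rightarrow> real"
  assumes "has_bochner_integral (BM (\<theta>s i)) f I" and [measurable]: "f \<in> borel_measurable borel"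
  shows "has_bochner_integral M (\<lambda>y. f (y i)) I"
proof -
  have "has_bochner_integral (distr M borel (\<lambda>y. y i)) f I"
    using assms unfolding distr_component by simp
  then show ?thesis
    by (simp add: has_bochner_integral_iff integrable_distr_eq integral_distr)
qed

lemma AE_unit: "AE y in M. \<forall>i. 0 < y i \<and> y i < 1"
proof -
  have "AE y in M. 0 < y i \<and> y i < 1" for i
    unfolding M_def using AE_beta_measure by (intro P.AE_component) auto
  then show ?thesis by (simp add: AE_all_countable)
qed

lemma indep_coordinates: "indep_vars (\<lambda>_. borel) (\<lambda>i y. y i) UNIV"
proof (subst indep_vars_iff_distr_eq_PiM)
  have "distr M (PiM UNIV (\<lambda>_. borel)) (\<lambda>x. x) = M"
    by (rule distr_id2) (simp add: sets_M)
  then show "distr M (PiM UNIV (\<lambda>_. borel)) (\<lambda>x. \<lambda>i\<in>UNIV. x i) = PiM UNIV (\<lambda>i. distr M borel (\<lambda>y. y i))"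
    unfolding distr_component by (simp only: restrict_UNIV M_def)
qed auto

lemma indep_vars_functions:
  assumes "\<And>i. f i \<in> borel_measurable borel"
  shows "indep_vars (\<lambda>_. borel) (\<lambda>i y. (f i (y i) :: real)) A"
proof -
  have "indep_vars (\<lambda>_. borel) (\<lambda>i y. f i (y i)) UNIV"
    by (rule indep_vars_compose2[OF indep_coordinates assms])
  then show ?thesis by (rule indep_vars_subset) auto
qed

text \<open>\<open>prefix\<close> expresses that \<open>F\<close> depends only on the coordinates
  below \<open>N\<close>: zeroing the others changes nothing. Thus \<open>F\<close> factors through
  a restriction that is independent of coordinate \<open>N\<close>.\<close>

lemma has_bochner_integral_prefix_mult:
  fixes F :: "(nat \<Rightarrow> real) \<Rightarrow> real" and g :: "real \<Rightarrow> real"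
  assumes [measurable]: "F \<in> borel_measurable (PiM UNIV (\<lambda>_. borel))"
    and prefix: "\<And>y. F (\<lambda>i. if i < N then y i else 0) = F y"
    and F: "has_bochner_integral M F I"
    and g: "has_bochner_integral (BM (\<theta>s N)) g J" and [measurable]: "g \<in> borel_measurable borel"
  shows "has_bochner_integral M (\<lambda>y. F y * g (y N)) (I * J)"
proof -
  let ?A = "{..<N}" and ?B = "{N}"
  have G: "has_bochner_integral M (\<lambda>y. g (y N)) J"
    by (rule has_bochner_integral_component) fact+
  have ind: "indep_var (PiM ?A (\<lambda>_. borel)) (\<lambda>y. restrict (\<lambda>i. y i) ?A) (PiM ?B (\<lambda>_. borel)) (\<lambda>y. restrict (\<lambda>i. y i) ?B)"
    by (rule indep_var_restrict[OF indep_coordinates]) auto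
  have ext: "(\<lambda>z i. if i < N then z i else 0) \<in> measurable (PiM ?A (\<lambda>_. borel)) (PiM UNIV (\<lambda>_. borel :: real measure))"
  proof (rule measurable_PiM_single')
    show "(\<lambda>z. if i < N then z i else 0) \<in> measurable (PiM ?A (\<lambda>_. borel)) (borel :: real measure)" for i
      by (cases "i < N") (auto intro: measurable_component_singleton)
  qed auto
  have "(\<lambda>z. F (\<lambda>i. if i < N then z i else 0)) \<in> borel_measurable (PiM ?A (\<lambda>_. borel))"
    by (rule measurable_compose[OF ext]) measurable
  moreover have "(\<lambda>z. g (z N)) \<in> borel_measurable (PiM ?B (\<lambda>_. borel))"
    by measurable
  ultimately have "indep_var borel ((\<lambda>z. F (\<lambda>i. if i < N then z i else 0)) \<circ> (\<lambda>y. restrict (\<lambda>i. y i) ?A))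
      borel ((\<lambda>z. g (z N)) \<circ> (\<lambda>y. restrict (\<lambda>i. y i) ?B))"
    by (rule indep_var_compose[OF ind])
  moreover have "(\<lambda>z. F (\<lambda>i. if i < N then z i else 0)) \<circ> (\<lambda>y. restrict (\<lambda>i. y i) ?A) = F"
  proof
    fix y :: "nat \<Rightarrow> real"
    have "(\<lambda>i. if i < N then restrict y ?A i else 0) = (\<lambda>i. if i < N then y i else 0)" by auto
    then show "((\<lambda>z. F (\<lambda>i. if i < N then z i else 0)) \<circ> (\<lambda>y. restrict (\<lambda>i. y i) ?A)) y = F y"
      using prefix[of y] by (simp cong: if_cong)
  qed
  moreover have "(\<lambda>z. g (z N)) \<circ> (\<lambda>y. restrict (\<lambda>i. y i) ?B) = (\<lambda>y. g (y N))"
    by auto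
  ultimately have "indep_var borel F borel (\<lambda>y. g (y N))" by simp
  from indep_var_lebesgue_integral[OF this] indep_var_integrable[OF this]
  show ?thesis using F G by (auto simp: has_bochner_integral_iff)
qed

lemma remaining_measurable [measurable]: "remaining k \<in> borel_measurable (PiM UNIV (\<lambda>_. borel))"
  unfolding remaining_def[abs_def] by measurable

lemma remaining_prefix: "k \<le> N \<Longrightarrow> remaining k (\<lambda>i. if i < N then y i else 0) = remaining k y"
  unfolding remaining_def by (intro prod.cong) auto

lemma remaining_Suc: "remaining (Suc k) y = remaining k y * (1 - y k)"
  by (simp add: remaining_def)

lemma stick_breaking_remaining: "stick_breaking y k = remaining k y * y k"
  by (simp add: stick_breaking_def remaining_def)

lemma rho_0 [simp]: "rho q 0 = 1" and rho_Suc: "rho q (Suc k) = rho q k * rem_mom \<alpha> q (\<theta>s k)"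
  by (simp_all add: rho_def)

lemma rho_pos: "q \<ge> 0 \<Longrightarrow> rho q k > 0"
  unfolding rho_def by (intro prod_pos rem_mom_pos) auto

lemma remaining_moment:
  assumes "q \<ge> 0"
  shows "has_bochner_integral M (\<lambda>y. remaining k y powr q) (rho q k)"
proof (induction k)
  case 0
  show ?case using has_bochner_integral_constant[of 1] by (simp add: remaining_def)
next
  case (Suc k)
  have "has_bochner_integral M (\<lambda>y. remaining k y powr q * (1 - y k) powr q) (rho q k * rem_mom \<alpha> q (\<theta>s k))"
    using assms by (intro has_bochner_integral_prefix_mult[OF _ _ Suc BM_rem_mom]) (auto simp: remaining_prefix)
  then show ?case by (simp add: remaining_Suc rho_Suc powr_mult)
qed

lemma stick_moment:
  assumes "q \<ge> 0"
  shows "has_bochner_integral M (\<lambda>y. stick_breaking y k powr q) (rho q k * y_mom \<alpha> q (\<theta>s k))"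
  unfolding stick_breaking_remaining powr_mult
  using assms by (intro has_bochner_integral_prefix_mult[OF _ _ remaining_moment BM_y_mom]) (auto simp: remaining_prefix)

lemma sum_stick_moments:
  assumes "q > \<alpha>"
  shows "(\<Sum>k<N. rho q k * y_mom \<alpha> q (\<theta>s k)) = pd_mean \<alpha> q \<theta> - rho q N * pd_mean \<alpha> q (\<theta>s N)"
proof (induction N)
  case (Suc N)
  have "pd_mean \<alpha> q (\<theta>s N) = y_mom \<alpha> q (\<theta>s N) + rem_mom \<alpha> q (\<theta>s N) * pd_mean \<alpha> q (\<theta>s (Suc N))"
    unfolding \<theta>s_Suc using assms by (intro pd_mean_rec) auto
  then show ?case unfolding sum.lessThan_Suc Suc rho_Suc by (simp add: algebra_simps)
qed simp

lemma rho_pd_mean_tendsto_0: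
  assumes "q > \<alpha>"
  shows "(\<lambda>N. rho q N * pd_mean \<alpha> q (\<theta>s N)) \<longlonglongrightarrow> 0"
proof -
  have "rho q N * pd_mean \<alpha> q (\<theta>s N) = pd_mean \<alpha> q \<theta> * (\<Prod>k<N. (\<theta>s k + \<alpha>) / (\<theta>s k + q))" for N
  proof (induction N)
    case (Suc N)
    have "rho q (Suc N) * pd_mean \<alpha> q (\<theta>s (Suc N)) = rho q N * (rem_mom \<alpha> q (\<theta>s N) * pd_mean \<alpha> q (\<theta>s N + \<alpha>))"
      unfolding \<theta>s_Suc rho_Suc by simp
    also have "\<dots> = rho q N * pd_mean \<alpha> q (\<theta>s N) * ((\<theta>s N + \<alpha>) / (\<theta>s N + q))"
      by (subst rem_mom_pd_mean[OF assms \<theta>s_pos]) simp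
    finally show ?case unfolding Suc prod.lessThan_Suc by simp
  qed simp
  moreover have "(\<lambda>N. pd_mean \<alpha> q \<theta> * (\<Prod>k<N. (\<theta>s k + \<alpha>) / (\<theta>s k + q))) \<longlonglongrightarrow> pd_mean \<alpha> q \<theta> * 0"
    using \<alpha> \<theta> assms by (intro tendsto_mult tendsto_const prod_ratio_tendsto_0) auto
  ultimately show ?thesis by simp
qed

lemma rho_pd_pair_tendsto_0: "(\<lambda>N. rho (2 * p) N * pd_pair \<alpha> p (\<theta>s N)) \<longlonglongrightarrow> 0"
proof -
  have "rho (2 * p) N * pd_pair \<alpha> p (\<theta>s N) = pd_pair \<alpha> p \<theta> * (\<Prod>k<N. (\<theta>s k + 2 * \<alpha>) / (\<theta>s k + 2 * p))" for N
  proof (induction N)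
    case (Suc N)
    have "rho (2 * p) (Suc N) * pd_pair \<alpha> p (\<theta>s (Suc N)) = rho (2 * p) N * (rem_mom \<alpha> (2 * p) (\<theta>s N) * pd_pair \<alpha> p (\<theta>s N + \<alpha>))"
      unfolding \<theta>s_Suc rho_Suc by simp
    also have "\<dots> = rho (2 * p) N * pd_pair \<alpha> p (\<theta>s N) * ((\<theta>s N + 2 * \<alpha>) / (\<theta>s N + 2 * p))"
      by (subst rem_mom_pd_pair[OF p \<theta>s_pos]) simp
    finally show ?case unfolding Suc prod.lessThan_Suc by simp
  qed simp
  moreover have "(\<lambda>N. pd_pair \<alpha> p \<theta> * (\<Prod>k<N. (\<theta>s k + 2 * \<alpha>) / (\<theta>s k + 2 * p))) \<longlonglongrightarrow> pd_pair \<alpha> p \<theta> * 0"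
    using \<alpha> \<theta> p by (intro tendsto_mult tendsto_const prod_ratio_tendsto_0) auto
  ultimately show ?thesis by simp
qed

lemma rho_square_le: "q \<ge> 0 \<Longrightarrow> (rho q k)\<^sup>2 \<le> rho (2 * q) k"
  unfolding rho_def prod_power_distrib by (intro prod_mono conjI rem_mom_square_le) auto

lemma sum_innov_var:
  "(\<Sum>k<N. rho (2 * p) k * innov_var \<alpha> p (\<theta>s k)) = pd_var \<alpha> p \<theta> - rho (2 * p) N * pd_var \<alpha> p (\<theta>s N)"
proof (induction N)
  case (Suc N)
  have "pd_var \<alpha> p (\<theta>s N) = innov_var \<alpha> p (\<theta>s N) + rem_mom \<alpha> (2 * p) (\<theta>s N) * pd_var \<alpha> p (\<theta>s (Suc N))"
    unfolding \<theta>s_Suc using p by (intro pd_var_rec) auto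
  then show ?case unfolding sum.lessThan_Suc Suc rho_Suc by (simp add: algebra_simps)
qed simp

text \<open>The remaining variance has three parts. The mean for \<open>2 * p\<close> and the pair
  term vanish by their product formulas, and the squared mean is dominated by twice the pair term
  once \<open>\<theta>s N\<close> is large.\<close>

lemma sum_innov_var_tendsto:
  "(\<lambda>N. \<Sum>k<N. rho (2 * p) k * innov_var \<alpha> p (\<theta>s k)) \<longlonglongrightarrow> pd_var \<alpha> p \<theta>"
proof -
  have \<theta>s_lim: "filterlim \<theta>s at_top sequentially"
    using \<alpha> by real_asymp
  have mean: "(\<lambda>N. rho (2 * p) N * (pd_mean \<alpha> p (\<theta>s N))\<^sup>2) \<longlonglongrightarrow> 0"
  proof (rule tendsto_sandwich)
    show "\<forall>\<^sub>F N in sequentially. 0 \<le> rho (2 * p) N * (pd_mean \<alpha> p (\<theta>s N))\<^sup>2"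
      using rho_pos[of "2 * p"] p0 by (intro always_eventually allI mult_nonneg_nonneg) (auto simp: less_imp_le)
    show "\<forall>\<^sub>F N in sequentially. rho (2 * p) N * (pd_mean \<alpha> p (\<theta>s N))\<^sup>2 \<le> 2 * (rho (2 * p) N * pd_pair \<alpha> p (\<theta>s N))"
      using eventually_compose_filterlim[OF eventually_pd_mean_square_le[OF p] \<theta>s_lim]
    proof eventually_elim
      case (elim N)
      have "rho (2 * p) N * (pd_mean \<alpha> p (\<theta>s N))\<^sup>2 \<le> rho (2 * p) N * (2 * pd_pair \<alpha> p (\<theta>s N))"
        using elim rho_pos[of "2 * p" N] p0 by (intro mult_left_mono) auto
      then show ?case by simp
    qed
    show "(\<lambda>N. 2 * (rho (2 * p) N * pd_pair \<alpha> p (\<theta>s N))) \<longlonglongrightarrow> 0"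
      using tendsto_mult[OF tendsto_const[of 2] rho_pd_pair_tendsto_0] by simp
  qed auto
  have "(\<lambda>N. pd_var \<alpha> p \<theta> - (rho (2 * p) N * pd_mean \<alpha> (2 * p) (\<theta>s N) + rho (2 * p) N * pd_pair \<alpha> p (\<theta>s N)
        - rho (2 * p) N * (pd_mean \<alpha> p (\<theta>s N))\<^sup>2)) \<longlonglongrightarrow> pd_var \<alpha> p \<theta> - (0 + 0 - 0)"
    using p \<alpha> by (intro tendsto_diff tendsto_const tendsto_add mean rho_pd_mean_tendsto_0 rho_pd_pair_tendsto_0) auto
  then show ?thesis
    unfolding sum_innov_var pd_var_def[of _ _ "\<theta>s _"] by (simp add: algebra_simps)
qed

end

section \<open>Martingale decomposition of the power sum\<close>

lemma integrable_product_of_squares: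
  fixes f g :: "'a \<Rightarrow> real"
  assumes [measurable]: "f \<in> borel_measurable M" "g \<in> borel_measurable M"
    and "integrable M (\<lambda>x. (f x)\<^sup>2)" "integrable M (\<lambda>x. (g x)\<^sup>2)"
  shows "integrable M (\<lambda>x. f x * g x)"
proof (rule Bochner_Integration.integrable_bound)
  show "integrable M (\<lambda>x. (f x)\<^sup>2 + (g x)\<^sup>2)" using assms by simp
  show "AE x in M. norm (f x * g x) \<le> norm ((f x)\<^sup>2 + (g x)\<^sup>2)"
  proof (intro AE_I2)
    fix x
    have "2 * \<bar>f x\<bar> * \<bar>g x\<bar> \<le> \<bar>f x\<bar>\<^sup>2 + \<bar>g x\<bar>\<^sup>2" by (rule sum_squares_bound)
    moreover have "0 \<le> \<bar>f x\<bar> * \<bar>g x\<bar>" by simp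
    ultimately have "\<bar>f x\<bar> * \<bar>g x\<bar> \<le> (f x)\<^sup>2 + (g x)\<^sup>2"
      unfolding power2_abs mult.assoc by linarith
    then show "norm (f x * g x) \<le> norm ((f x)\<^sup>2 + (g x)\<^sup>2)" by (simp add: abs_mult)
  qed
qed measurable

text \<open>The factor for which \<open>W_p = scale * H_p - sqrt \<theta>\<close>: the
  \<open>sqrt \<theta>\<close> in front of \<open>W_p\<close> is absorbed into the power.\<close>

definition (in pd_param) scale :: "real \<Rightarrow> real \<Rightarrow> real" where
  "scale p \<theta> = Gamma (1 - \<alpha>) / Gamma (p - \<alpha>) * \<theta> powr (p - 1 / 2)"

context pd_seq
begin

definition mart_error :: "nat \<Rightarrow> (nat \<Rightarrow> real) \<Rightarrow> real" where
  "mart_error N y = (\<Sum>k<N. (remaining k y powr p - rho p k) * innov \<alpha> p (\<theta>s k) (y k))"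

lemma mart_error_measurable [measurable]: "mart_error N \<in> borel_measurable (PiM UNIV (\<lambda>_. borel))"
  unfolding mart_error_def[abs_def] by measurable

lemma mart_error_prefix: "mart_error N (\<lambda>i. if i < N then y i else 0) = mart_error N y"
  unfolding mart_error_def by (intro sum.cong) (auto simp: remaining_prefix)

text \<open>The increments are orthogonal: each cross term is a function of earlier coordinates
  times a centred innovation. The weight \<open>rho (2 * p) k - (rho p k)\<^sup>2\<close> is the
  variance of \<open>R_k^p\<close>.\<close>

lemma mart_error_square:
  "has_bochner_integral M (\<lambda>y. (mart_error N y)\<^sup>2) (\<Sum>k<N. (rho (2 * p) k - (rho p k)\<^sup>2) * innov_var \<alpha> p (\<theta>s k))"
proof (induction N)
  case 0
  show ?case using has_bochner_integral_constant[of 0] by (simp add: mart_error_def)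
next
  case (Suc N)
  define D where "D y = remaining N y powr p - rho p N" for y
  define Z where "Z = innov \<alpha> p (\<theta>s N)"
  have [measurable]: "D \<in> borel_measurable (PiM UNIV (\<lambda>_. borel))" "Z \<in> borel_measurable borel"
    unfolding D_def[abs_def] Z_def by measurable
  have Dpre: "D (\<lambda>i. if i < N then y i else 0) = D y" for y
    by (simp add: D_def remaining_prefix)
  have D2: "has_bochner_integral M (\<lambda>y. (D y)\<^sup>2) (rho (2 * p) N - (rho p N)\<^sup>2)"
  proof -
    have "has_bochner_integral M (\<lambda>y. remaining N y powr (2 * p) - remaining N y powr p * (2 * rho p N) + (rho p N)\<^sup>2)
       (rho (2 * p) N - rho p N * (2 * rho p N) + (rho p N)\<^sup>2)"
      using p0 by (intro has_bochner_integral_add has_bochner_integral_diff has_bochner_integral_mult_left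
          has_bochner_integral_constant remaining_moment) auto
    moreover have "AE y in M. (D y)\<^sup>2 = remaining N y powr (2 * p) - remaining N y powr p * (2 * rho p N) + (rho p N)\<^sup>2"
      using AE_unit
    proof eventually_elim
      case (elim y)
      have "remaining N y > 0" unfolding remaining_def using elim by (intro prod_pos) auto
      then have "remaining N y powr (2 * p) = (remaining N y powr p)\<^sup>2" by (simp add: powr_power mult.commute)
      then show ?case by (simp add: D_def power2_diff mult_ac)
    qed
    ultimately show ?thesis
      by (subst has_bochner_integral_cong_AE) (auto simp: power2_eq_square algebra_simps)
  qed
  have Z2: "has_bochner_integral (BM (\<theta>s N)) (\<lambda>y. (Z y)\<^sup>2) (innov_var \<alpha> p (\<theta>s N))"
    using pd_var_rec(1)[OF p \<theta>s_pos, of N] unfolding innov_var_def Z_def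
    by (rule has_bochner_integral_integrable)
  have Z1: "has_bochner_integral (BM (\<theta>s N)) Z 0"
    unfolding Z_def by (rule innov_mean[OF p \<theta>s_pos])
  have SD: "has_bochner_integral M (\<lambda>y. mart_error N y * D y) (expectation (\<lambda>y. mart_error N y * D y))"
    using Suc D2 by (intro has_bochner_integral_integrable integrable_product_of_squares) (auto simp: has_bochner_integral_iff)
  have 1: "has_bochner_integral M (\<lambda>y. (mart_error N y * D y) * Z (y N)) (expectation (\<lambda>y. mart_error N y * D y) * 0)"
    by (rule has_bochner_integral_prefix_mult[OF _ _ SD Z1]) (auto simp: mart_error_prefix Dpre)
  have 2: "has_bochner_integral M (\<lambda>y. (D y)\<^sup>2 * (Z (y N))\<^sup>2) ((rho (2 * p) N - (rho p N)\<^sup>2) * innov_var \<alpha> p (\<theta>s N))"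
    by (rule has_bochner_integral_prefix_mult[OF _ _ D2 Z2]) (auto simp: Dpre)
  have "has_bochner_integral M (\<lambda>y. (mart_error N y)\<^sup>2 + 2 * ((mart_error N y * D y) * Z (y N)) + (D y)\<^sup>2 * (Z (y N))\<^sup>2)
     ((\<Sum>k<N. (rho (2 * p) k - (rho p k)\<^sup>2) * innov_var \<alpha> p (\<theta>s k)) + 2 * (expectation (\<lambda>y. mart_error N y * D y) * 0)
        + (rho (2 * p) N - (rho p N)\<^sup>2) * innov_var \<alpha> p (\<theta>s N))"
    by (intro has_bochner_integral_add has_bochner_integral_mult_right Suc 1 2)
  moreover have "mart_error (Suc N) y = mart_error N y + D y * Z (y N)" for y
    by (simp add: mart_error_def D_def Z_def)
  then have "(\<lambda>y. (mart_error (Suc N) y)\<^sup>2) = (\<lambda>y. (mart_error N y)\<^sup>2 + 2 * ((mart_error N y * D y) * Z (y N)) + (D y)\<^sup>2 * (Z (y N))\<^sup>2)"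
    by (simp add: power2_eq_square algebra_simps)
  ultimately show ?case by simp
qed

text \<open>By the definition of \<open>innov\<close>, the \<open>N\<close>-th summand is
  \<open>R_N^p\<close> times the innovation, plus a difference of consecutive values of
  \<open>R_k^p * pd_mean \<alpha> p (\<theta>s k)\<close>, which telescopes.\<close>

lemma sum_stick_decomposition:
  "(\<Sum>k<N. stick_breaking y k powr p) = pd_mean \<alpha> p \<theta>
     + (\<Sum>k<N. rho p k * innov \<alpha> p (\<theta>s k) (y k)) + mart_error N y - remaining N y powr p * pd_mean \<alpha> p (\<theta>s N)"
proof (induction N)
  case 0
  then show ?case by (simp add: mart_error_def remaining_def)
next
  case (Suc N)
  have "stick_breaking y N powr p = remaining N y powr p * innov \<alpha> p (\<theta>s N) (y N)
     + remaining N y powr p * pd_mean \<alpha> p (\<theta>s N) - remaining (Suc N) y powr p * pd_mean \<alpha> p (\<theta>s (Suc N))"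
    unfolding stick_breaking_remaining remaining_Suc powr_mult innov_def \<theta>s_Suc by (simp add: algebra_simps)
  then show ?case
    unfolding sum.lessThan_Suc Suc by (simp add: mart_error_def algebra_simps)
qed

section \<open>The sum over sticks and the law of \<open>W_p\<close>\<close>

definition total :: "(nat \<Rightarrow> real) \<Rightarrow> real" where
  "total y = (\<Sum>k. stick_breaking y k powr p)"

lemma stick_breaking_coord_measurable [measurable]:
  "(\<lambda>y. stick_breaking y k) \<in> borel_measurable (PiM UNIV (\<lambda>_. borel))"
  unfolding stick_breaking_def by measurable

lemma total_measurable [measurable]: "total \<in> borel_measurable (PiM UNIV (\<lambda>_. borel))"
  unfolding total_def[abs_def] by measurable

lemma AE_stick_nonneg: "AE y in M. \<forall>k. 0 \<le> stick_breaking y k"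
  using AE_unit
proof eventually_elim
  case (elim y)
  then show ?case unfolding stick_breaking_def by (auto intro!: mult_nonneg_nonneg prod_nonneg simp: less_imp_le)
qed

text \<open>Tonelli and the telescoped moments. Finiteness yields almost sure summability of the
  \<open>p\<close>-th powers, which for \<open>p < 1\<close> is not implied by summability of the
  sticks.\<close>

lemma nn_integral_sum_sticks:
  "(\<integral>\<^sup>+y. (\<Sum>k. ennreal (stick_breaking y k powr p)) \<partial>M) = ennreal (pd_mean \<alpha> p \<theta>)"
proof -
  have "(\<integral>\<^sup>+y. (\<Sum>k. ennreal (stick_breaking y k powr p)) \<partial>M) = (\<Sum>k. \<integral>\<^sup>+y. ennreal (stick_breaking y k powr p) \<partial>M)"
    by (rule nn_integral_suminf) measurable
  also have "\<dots> = (\<Sum>k. ennreal (rho p k * y_mom \<alpha> p (\<theta>s k)))"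
    using stick_moment[of p] p0
    by (intro suminf_cong) (auto simp: has_bochner_integral_iff nn_integral_eq_integral)
  also have "\<dots> = ennreal (pd_mean \<alpha> p \<theta>)"
  proof (rule suminf_ennreal_eq)
    show "0 \<le> rho p k * y_mom \<alpha> p (\<theta>s k)" for k
      using rho_pos[of p k] y_mom_pos[of p "\<theta>s k"] p0 by simp
    have "(\<lambda>N. pd_mean \<alpha> p \<theta> - rho p N * pd_mean \<alpha> p (\<theta>s N)) \<longlonglongrightarrow> pd_mean \<alpha> p \<theta> - 0"
      by (intro tendsto_intros rho_pd_mean_tendsto_0 p)
    then show "(\<lambda>k. rho p k * y_mom \<alpha> p (\<theta>s k)) sums pd_mean \<alpha> p \<theta>"
      unfolding sums_def sum_stick_moments[OF p] by simp
  qed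
  finally show ?thesis .
qed

lemma AE_summable_sticks: "AE y in M. summable (\<lambda>k. stick_breaking y k powr p)"
proof -
  have "AE y in M. (\<Sum>k. ennreal (stick_breaking y k powr p)) \<noteq> \<infinity>"
    by (rule nn_integral_noteq_infinite) (auto simp: nn_integral_sum_sticks)
  then show ?thesis
    by eventually_elim (rule summable_suminf_not_top, auto simp: top_ennreal_def[symmetric])
qed

lemma total_mean: "has_bochner_integral M total (pd_mean \<alpha> p \<theta>)"
proof (rule has_bochner_integral_nn_integral)
  have "(\<integral>\<^sup>+y. ennreal (total y) \<partial>M) = (\<integral>\<^sup>+y. (\<Sum>k. ennreal (stick_breaking y k powr p)) \<partial>M)"
    using AE_summable_sticks
    by (intro nn_integral_cong_AE) (auto simp: total_def suminf_ennreal2)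
  then show "(\<integral>\<^sup>+y. ennreal (total y) \<partial>M) = ennreal (pd_mean \<alpha> p \<theta>)"
    by (simp add: nn_integral_sum_sticks)
  show "0 \<le> pd_mean \<alpha> p \<theta>" using pd_mean_pos[OF p \<theta>] by simp
  show "AE y in M. 0 \<le> total y"
    using AE_summable_sticks by eventually_elim (auto simp: total_def intro!: suminf_nonneg)
qed measurable

lemma AE_H_p_rearr: "AE y in M. H_p p (decr_rearr (stick_breaking y)) = total y"
  using AE_summable_sticks AE_stick_nonneg
proof eventually_elim
  case (elim y)
  \<comment> \<open>Summability forces the sticks to tend to 0, which is what the comparison with
    the rearrangement requires.\<close>
  have fin: "finite {i. stick_breaking y i > t}" if "t > 0" for t
  proof -
    have "(\<lambda>k. stick_breaking y k powr p) \<longlonglongrightarrow> 0" using elim(1) by (rule summable_LIMSEQ_zero)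
    then have "\<forall>\<^sub>F k in sequentially. stick_breaking y k powr p < t powr p"
      using that by (intro order_tendstoD) auto
    then obtain K where K: "\<And>k. k \<ge> K \<Longrightarrow> stick_breaking y k powr p < t powr p"
      by (auto simp: eventually_sequentially)
    have "{i. stick_breaking y i > t} \<subseteq> {..<K}"
    proof
      fix i assume "i \<in> {i. stick_breaking y i > t}"
      then have i: "stick_breaking y i > t" by simp
      have "t powr p \<le> stick_breaking y i powr p" using i that p0 by (intro powr_mono2) auto
      then show "i \<in> {..<K}" using K[of i] by (cases "i < K") auto
    qed
    then show ?thesis by (rule finite_subset) auto
  qed
  have eq: "(\<Sum>k. ennreal (decr_rearr (stick_breaking y) k powr p)) = (\<Sum>i. ennreal (stick_breaking y i powr p))"
    using elim fin p0 by (intro suminf_decr_rearr_powr) auto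
  have "(\<Sum>i. ennreal (stick_breaking y i powr p)) = ennreal (total y)"
    unfolding total_def using elim by (intro suminf_ennreal2) auto
  with eq have s: "(\<Sum>k. ennreal (decr_rearr (stick_breaking y) k powr p)) = ennreal (total y)" by simp
  then have "summable (\<lambda>k. decr_rearr (stick_breaking y) k powr p)"
    by (intro summable_suminf_not_top) auto
  then have "ennreal (H_p p (decr_rearr (stick_breaking y))) = ennreal (total y)"
    unfolding s[symmetric] H_p_def by (intro suminf_ennreal2[symmetric]) auto
  moreover have "0 \<le> total y" unfolding total_def using elim by (intro suminf_nonneg) auto
  moreover have "0 \<le> H_p p (decr_rearr (stick_breaking y))"
    unfolding H_p_def using \<open>summable (\<lambda>k. decr_rearr (stick_breaking y) k powr p)\<close> by (intro suminf_nonneg) auto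
  ultimately show ?case by simp
qed

abbreviation "lam \<equiv> scale p \<theta>"

lemma lam_pos: "lam > 0"
  unfolding scale_def using \<alpha> p \<theta> by (intro mult_pos_pos divide_pos_pos Gamma_real_pos) auto

lemma W_law_eq: "W_law \<alpha> \<theta> p = distr M borel (\<lambda>y. lam * total y - sqrt \<theta>)"
proof -
  have "W_law \<alpha> \<theta> p = distr M borel (W_p \<alpha> \<theta> p \<circ> (\<lambda>y. decr_rearr (stick_breaking y)))"
    unfolding W_law_def PD_def M_eq[symmetric]
    by (rule distr_distr) (auto intro: measurable_compose[OF _ decr_rearr_measurable_PiM] simp: sets_M cong: measurable_cong_sets)
  also have "\<dots> = distr M borel (\<lambda>y. lam * total y - sqrt \<theta>)"
  proof (rule distr_cong_AE)
    have "\<theta> powr (1 / 2) * \<theta> powr (p - 1) = \<theta> powr (p - 1 / 2)"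
      by (simp flip: powr_add)
    then have sq: "sqrt \<theta> * \<theta> powr (p - 1) = \<theta> powr (p - 1 / 2)"
      using \<theta> by (simp add: powr_half_sqrt)
    have W: "W_p \<alpha> \<theta> p V = lam * H_p p V - sqrt \<theta>" for V
      unfolding W_p_def scale_def sq[symmetric] by (simp add: algebra_simps)
    show "AE y in M. (W_p \<alpha> \<theta> p \<circ> (\<lambda>y. decr_rearr (stick_breaking y))) y = lam * total y - sqrt \<theta>"
      using AE_H_p_rearr by eventually_elim (simp add: W)
  qed auto
  finally show ?thesis .
qed

lemma real_distribution_W_law: "real_distribution (W_law \<alpha> \<theta> p)"
  unfolding W_law_eq by (rule real_distribution_distr) measurable

end

section \<open>Convergence of the characteristic functions\<close>

lemma abs_exp_minus_diff_le:
  fixes a b :: real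
  assumes "a \<ge> 0" "b \<ge> 0"
  shows "\<bar>exp (- a) - exp (- b)\<bar> \<le> \<bar>a - b\<bar>"
proof -
  have *: "\<bar>exp (- a) - exp (- b)\<bar> \<le> b - a" if "0 \<le> a" "a \<le> b" for a b :: real
  proof -
    have "exp (- a) - exp (- b) = exp (- a) * (1 - exp (- (b - a)))"
      by (simp add: algebra_simps flip: exp_add)
    also have "\<dots> \<le> 1 * (1 - exp (- (b - a)))"
      using that by (intro mult_right_mono) auto
    also have "\<dots> \<le> b - a" using exp_ge_add_one_self[of "- (b - a)"] unfolding mult_1 by linarith
    finally show ?thesis using that by simp
  qed
  show ?thesis using *[of a b] *[of b a] assms by (cases "a \<le> b") (auto simp: abs_minus_commute)
qed

section \<open>Explicit bounds at fixed \<theta>\<close>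

context pd_seq
begin

text \<open>The unscaled variance of the first \<open>N\<close> martingale increments. Subtracting
  \<open>error_var N\<close>, the mean square of \<open>mart_error N\<close>, leaves the variance of
  the sum with \<open>R_k^p\<close> replaced by its mean.\<close>

definition pred_var :: "nat \<Rightarrow> real" where
  "pred_var N = (\<Sum>k<N. rho (2 * p) k * innov_var \<alpha> p (\<theta>s k))"

definition error_var :: "nat \<Rightarrow> real" where
  "error_var N = (\<Sum>k<N. (rho (2 * p) k - (rho p k)\<^sup>2) * innov_var \<alpha> p (\<theta>s k))"

definition indep_fourth :: "nat \<Rightarrow> real" where
  "indep_fourth N = (\<Sum>k<N. (lam * rho p k) ^ 4 * (\<integral>x. innov \<alpha> p (\<theta>s k) x ^ 4 \<partial>BM (\<theta>s k)))"

lemma innov_var_nonneg: "innov_var \<alpha> p t \<ge> 0"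
  unfolding innov_var_def by simp

text \<open>Four errors are added: the deterministic centring, the sticks beyond \<open>N\<close>,
  the last term of \<open>sum_stick_decomposition\<close> and \<open>mart_error\<close>. The second
  and third have the same mean, hence the factor 2.\<close>

lemma char_W_law_diff_indep:
  "cmod (char (W_law \<alpha> \<theta> p) u - char (distr M borel (\<lambda>y. \<Sum>k<N. lam * rho p k * innov \<alpha> p (\<theta>s k) (y k))) u)
    \<le> \<bar>u\<bar> * (\<bar>lam * pd_mean \<alpha> p \<theta> - sqrt \<theta>\<bar> + 2 * (lam * (rho p N * pd_mean \<alpha> p (\<theta>s N))) + lam * sqrt (error_var N))"
proof -
  let ?tail = "\<lambda>y. total y - (\<Sum>k<N. stick_breaking y k powr p)"
  let ?mN = "pd_mean \<alpha> p (\<theta>s N)"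
  define Z where "Z y = \<bar>lam * pd_mean \<alpha> p \<theta> - sqrt \<theta>\<bar> + lam * ?tail y + lam * (remaining N y powr p * ?mN) + lam * \<bar>mart_error N y\<bar>" for y
  have mN: "?mN > 0" by (rule pd_mean_pos[OF p \<theta>s_pos])
  have sq: "integrable M (\<lambda>y. (mart_error N y)\<^sup>2)" "expectation (\<lambda>y. (mart_error N y)\<^sup>2) = error_var N"
    using mart_error_square[of N] by (auto simp: has_bochner_integral_iff error_var_def)
  have int_abs: "integrable M (\<lambda>y. \<bar>mart_error N y\<bar>)"
    using square_integrable_imp_integrable[OF _ sq(1)] by simp
  have "(expectation (\<lambda>y. \<bar>mart_error N y\<bar>))\<^sup>2 \<le> error_var N"
    using square_expectation_le[of "\<lambda>y. \<bar>mart_error N y\<bar>"] sq by simp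
  then have abs_le: "expectation (\<lambda>y. \<bar>mart_error N y\<bar>) \<le> sqrt (error_var N)"
    by (rule real_le_rsqrt)
  have tail: "has_bochner_integral M ?tail (rho p N * ?mN)"
  proof -
    have "has_bochner_integral M ?tail (pd_mean \<alpha> p \<theta> - (\<Sum>k<N. rho p k * y_mom \<alpha> p (\<theta>s k)))"
      using p0 by (intro has_bochner_integral_diff has_bochner_integral_sum total_mean stick_moment) auto
    then show ?thesis by (simp add: sum_stick_moments[OF p])
  qed
  have "has_bochner_integral M Z (\<bar>lam * pd_mean \<alpha> p \<theta> - sqrt \<theta>\<bar> + lam * (rho p N * ?mN) + lam * (rho p N * ?mN)
      + lam * expectation (\<lambda>y. \<bar>mart_error N y\<bar>))"
    unfolding Z_def using p0
    by (intro has_bochner_integral_add has_bochner_integral_mult_right has_bochner_integral_mult_left has_bochner_integral_constant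
          tail remaining_moment has_bochner_integral_integrable int_abs) auto
  then have Z: "integrable M Z" "expectation Z = \<bar>lam * pd_mean \<alpha> p \<theta> - sqrt \<theta>\<bar> + lam * (rho p N * ?mN) + lam * (rho p N * ?mN)
      + lam * expectation (\<lambda>y. \<bar>mart_error N y\<bar>)"
    by (auto simp: has_bochner_integral_iff)
  have "AE y in M. \<bar>(lam * total y - sqrt \<theta>) - (\<Sum>k<N. lam * rho p k * innov \<alpha> p (\<theta>s k) (y k))\<bar> \<le> Z y"
    using AE_summable_sticks
  proof eventually_elim
    case (elim y)
    have t: "0 \<le> ?tail y"
      unfolding total_def using sum_le_suminf[OF elim, of "{..<N}"] by simp
    have "(\<Sum>k<N. lam * rho p k * innov \<alpha> p (\<theta>s k) (y k)) = lam * (\<Sum>k<N. rho p k * innov \<alpha> p (\<theta>s k) (y k))"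
      by (simp add: sum_distrib_left mult.assoc)
    also have "(\<Sum>k<N. rho p k * innov \<alpha> p (\<theta>s k) (y k))
        = (\<Sum>k<N. stick_breaking y k powr p) - pd_mean \<alpha> p \<theta> - mart_error N y + remaining N y powr p * ?mN"
      using sum_stick_decomposition[where N = N and y = y] by simp
    finally have "(lam * total y - sqrt \<theta>) - (\<Sum>k<N. lam * rho p k * innov \<alpha> p (\<theta>s k) (y k))
       = (lam * pd_mean \<alpha> p \<theta> - sqrt \<theta>) + lam * ?tail y - lam * (remaining N y powr p * ?mN) + lam * mart_error N y"
      by (simp add: algebra_simps)
    moreover have "0 \<le> lam * ?tail y" "0 \<le> lam * (remaining N y powr p * ?mN)" "lam * \<bar>mart_error N y\<bar> = \<bar>lam * mart_error N y\<bar>"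
      using t lam_pos mN by (auto simp: abs_mult)
    ultimately show ?case unfolding Z_def by linarith
  qed
  then have "cmod (char (W_law \<alpha> \<theta> p) u - char (distr M borel (\<lambda>y. \<Sum>k<N. lam * rho p k * innov \<alpha> p (\<theta>s k) (y k))) u)
    \<le> \<bar>u\<bar> * expectation Z"
    unfolding W_law_eq by (intro cmod_char_distr_diff_le Z) measurable
  also have "\<dots> \<le> \<bar>u\<bar> * (\<bar>lam * pd_mean \<alpha> p \<theta> - sqrt \<theta>\<bar> + 2 * (lam * (rho p N * pd_mean \<alpha> p (\<theta>s N))) + lam * sqrt (error_var N))"
    unfolding Z using mult_left_mono[OF abs_le, of lam] lam_pos by (intro mult_left_mono) auto
  finally show ?thesis .
qed

lemma char_indep_bound:
  fixes N :: nat
  assumes "e > 0"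
  defines "s2 \<equiv> lam\<^sup>2 * (pred_var N - error_var N)"
  shows "cmod (char (distr M borel (\<lambda>y. \<Sum>k<N. lam * rho p k * innov \<alpha> p (\<theta>s k) (y k))) u - complex_of_real (exp (- (u\<^sup>2 * s2 / 2))))
    \<le> \<bar>u\<bar> ^ 3 / 12 * (e * s2 + indep_fourth N / e) + u ^ 4 / 4 * indep_fourth N"
proof -
  define X where "X k y = lam * rho p k * innov \<alpha> p (\<theta>s k) (y k)" for k and y :: "nat \<Rightarrow> real"
  have ind: "indep_vars (\<lambda>_. borel) X {..<N}"
    unfolding X_def[abs_def]
    by (rule indep_vars_functions[where f = "\<lambda>k x. lam * rho p k * innov \<alpha> p (\<theta>s k) x"]) measurable
  have 1: "expectation (X k) = 0" for k
  proof -
    have "has_bochner_integral M (\<lambda>y. innov \<alpha> p (\<theta>s k) (y k)) 0"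
      by (rule has_bochner_integral_component[OF innov_mean[OF p \<theta>s_pos]]) measurable
    then show ?thesis unfolding X_def by (simp add: has_bochner_integral_iff)
  qed
  have 2: "expectation (\<lambda>y. (X k y)\<^sup>2) = (lam * rho p k)\<^sup>2 * innov_var \<alpha> p (\<theta>s k)" for k
  proof -
    have "has_bochner_integral M (\<lambda>y. (innov \<alpha> p (\<theta>s k) (y k))\<^sup>2) (innov_var \<alpha> p (\<theta>s k))"
      unfolding innov_var_def
      by (rule has_bochner_integral_component[OF has_bochner_integral_integrable[OF pd_var_rec(1)[OF p \<theta>s_pos]]]) measurable
    then show ?thesis unfolding X_def by (simp add: has_bochner_integral_iff power_mult_distrib)
  qed
  have 4: "integrable M (\<lambda>y. X k y ^ 4)"
     "expectation (\<lambda>y. X k y ^ 4) = (lam * rho p k) ^ 4 * (\<integral>x. innov \<alpha> p (\<theta>s k) x ^ 4 \<partial>BM (\<theta>s k))" for k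
  proof -
    have "has_bochner_integral M (\<lambda>y. innov \<alpha> p (\<theta>s k) (y k) ^ 4) (\<integral>x. innov \<alpha> p (\<theta>s k) x ^ 4 \<partial>BM (\<theta>s k))"
      by (rule has_bochner_integral_component[OF has_bochner_integral_integrable[OF innov_fourth_le(1)[OF p \<theta>s_pos]]]) measurable
    then show "integrable M (\<lambda>y. X k y ^ 4)"
     "expectation (\<lambda>y. X k y ^ 4) = (lam * rho p k) ^ 4 * (\<integral>x. innov \<alpha> p (\<theta>s k) x ^ 4 \<partial>BM (\<theta>s k))"
      unfolding X_def by (simp_all add: has_bochner_integral_iff power_mult_distrib)
  qed
  have s2: "(\<Sum>k<N. expectation (\<lambda>y. (X k y)\<^sup>2)) = s2"
    unfolding 2 s2_def pred_var_def error_var_def sum_subtractf[symmetric] sum_distrib_left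
    by (intro sum.cong) (auto simp: algebra_simps power_mult_distrib)
  have s4: "(\<Sum>k<N. expectation (\<lambda>y. X k y ^ 4)) = indep_fourth N"
    unfolding 4 indep_fourth_def ..
  show ?thesis
    using char_sum_normal_bound[OF ind finite_lessThan 4(1) 1 \<open>e > 0\<close>, of u]
    unfolding s2 s4 unfolding X_def by simp
qed

text \<open>Telescoping with step \<open>\<alpha>\<close>, via
  \<open>1 / x\<^sup>2 \<le> 1 / (x * (x - \<alpha>))\<close>; the hypothesis gives
  \<open>1 / (\<theta> - \<alpha>) \<le> 2 / \<theta>\<close>. Uniformity in \<open>k\<close> is the
  point.\<close>

lemma sum_inverse_squares_le:
  assumes "\<theta> \<ge> 2 * \<alpha>"
  shows "(\<Sum>j<k. 1 / (\<theta>s j)\<^sup>2) \<le> 2 / (\<alpha> * \<theta>)"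
proof -
  have "(\<Sum>j<k. 1 / (\<theta>s j)\<^sup>2) \<le> (1 / \<alpha>) * (1 / (\<theta> - \<alpha>) - 1 / (\<theta>s k - \<alpha>))"
  proof (induction k)
    case (Suc k)
    define x where "x = \<theta>s k"
    have "0 \<le> real k * \<alpha>" using \<alpha> by simp
    then have x: "x - \<alpha> > 0" "x > 0" "\<alpha> > 0" unfolding x_def using assms \<alpha> by linarith+
    have "1 / x\<^sup>2 \<le> 1 / (x * (x - \<alpha>))"
      using x by (intro divide_left_mono) (auto simp: power2_eq_square)
    also have "\<dots> = (1 / \<alpha>) * (1 / (x - \<alpha>) - 1 / x)"
      using x by (simp add: field_simps)
    finally have "1 / x\<^sup>2 \<le> (1 / \<alpha>) * (1 / (x - \<alpha>) - 1 / x)" .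
    moreover have "\<theta>s (Suc k) - \<alpha> = x" unfolding \<theta>s_Suc x_def by simp
    ultimately show ?case using Suc unfolding sum.lessThan_Suc x_def[symmetric] \<open>\<theta>s (Suc k) - \<alpha> = x\<close> by (simp add: algebra_simps)
  qed simp
  also have "\<dots> \<le> (1 / \<alpha>) * (1 / (\<theta> - \<alpha>))"
  proof -
    have "0 \<le> real k * \<alpha>" using \<alpha> by simp
    then have "0 < \<theta>s k - \<alpha>" using assms \<alpha> by linarith
    then show ?thesis using \<alpha> by (intro mult_left_mono) auto
  qed
  also have "\<dots> \<le> (1 / \<alpha>) * (2 / \<theta>)"
    using assms \<alpha> \<theta> by (intro mult_left_mono) (auto simp: field_simps)
  finally show ?thesis by simp
qed

text \<open>Multiplying \<open>rem_mom_double_le\<close> over the sticks gives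
  \<open>rho (2 * p) k \<le> (rho p k)\<^sup>2 * exp D\<close> for all \<open>k\<close>, and
  \<open>exp (- D) \<ge> 1 - D\<close> finishes. Here \<open>D\<close> is
  \<open>8 * (max 1 p)\<^sup>2\<close> times the bound of
  \<open>sum_inverse_squares_le\<close>.\<close>

lemma error_var_le:
  assumes "\<theta> \<ge> 2 * max 1 p"
  shows "0 \<le> error_var N" "error_var N \<le> 16 * (max 1 p)\<^sup>2 / \<alpha> / \<theta> * pred_var N"
proof -
  define D where "D = 16 * (max 1 p)\<^sup>2 / \<alpha> / \<theta>"
  have diff: "0 \<le> rho (2 * p) k - (rho p k)\<^sup>2" "rho (2 * p) k - (rho p k)\<^sup>2 \<le> D * rho (2 * p) k" for k
  proof -
    show "0 \<le> rho (2 * p) k - (rho p k)\<^sup>2" using rho_square_le[of p k] p0 by simp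
    have "rho (2 * p) k \<le> (\<Prod>j<k. (rem_mom \<alpha> p (\<theta>s j))\<^sup>2 * exp (8 * (max 1 p)\<^sup>2 / (\<theta>s j)\<^sup>2))"
      unfolding rho_def
    proof (intro prod_mono conjI)
      fix j
      show "0 \<le> rem_mom \<alpha> (2 * p) (\<theta>s j)" using rem_mom_pos[of "2 * p" "\<theta>s j"] p0 by simp
      have "0 \<le> real j * \<alpha>" using \<alpha> by simp
      then show "rem_mom \<alpha> (2 * p) (\<theta>s j) \<le> (rem_mom \<alpha> p (\<theta>s j))\<^sup>2 * exp (8 * (max 1 p)\<^sup>2 / (\<theta>s j)\<^sup>2)"
        using assms p0 by (intro rem_mom_double_le) linarith+
    qed
    also have "\<dots> = (rho p k)\<^sup>2 * exp (8 * (max 1 p)\<^sup>2 * (\<Sum>j<k. 1 / (\<theta>s j)\<^sup>2))"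
      by (simp add: prod.distrib rho_def prod_power_distrib exp_sum sum_distrib_left)
    also have "\<dots> \<le> (rho p k)\<^sup>2 * exp (8 * (max 1 p)\<^sup>2 * (2 / (\<alpha> * \<theta>)))"
    proof -
      have "\<theta> \<ge> 2 * \<alpha>" using assms \<alpha> by (simp add: max_def split: if_splits)
      then show ?thesis
        by (intro mult_left_mono iffD2[OF exp_le_cancel_iff] sum_inverse_squares_le) auto
    qed
    also have "8 * (max 1 p)\<^sup>2 * (2 / (\<alpha> * \<theta>)) = D" by (simp add: D_def)
    finally have "rho (2 * p) k * exp (- D) \<le> (rho p k)\<^sup>2"
      by (simp add: exp_minus field_simps)
    moreover have "rho (2 * p) k * (1 - D) \<le> rho (2 * p) k * exp (- D)"
      using rho_pos[of "2 * p" k] p0 exp_ge_add_one_self[of "- D"] by (intro mult_left_mono) auto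
    ultimately show "rho (2 * p) k - (rho p k)\<^sup>2 \<le> D * rho (2 * p) k"
      by (simp add: algebra_simps)
  qed
  show "0 \<le> error_var N"
    unfolding error_var_def using diff(1) innov_var_nonneg by (intro sum_nonneg mult_nonneg_nonneg)
  have "error_var N \<le> (\<Sum>k<N. (D * rho (2 * p) k) * innov_var \<alpha> p (\<theta>s k))"
    unfolding error_var_def by (intro sum_mono mult_right_mono diff innov_var_nonneg)
  then show "error_var N \<le> 16 * (max 1 p)\<^sup>2 / \<alpha> / \<theta> * pred_var N"
    unfolding D_def[symmetric] pred_var_def by (simp add: sum_distrib_left mult.assoc)
qed

lemma pred_var_minus_error_var_nonneg: "0 \<le> pred_var N - error_var N"
  unfolding pred_var_def error_var_def sum_subtractf[symmetric]
  by (intro sum_nonneg) (auto simp: left_diff_distrib innov_var_nonneg)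

text \<open>Applying Jensen twice replaces \<open>rho p k ^ 4\<close> by
  \<open>rho (4 * p) k\<close>; the sum is then part of the telescoping sum for
  \<open>pd_mean\<close> at \<open>4 * p\<close>. The hypothesis covers all
  \<open>t \<ge> \<theta>\<close> because every \<open>\<theta>s k\<close> occurs.\<close>

lemma indep_fourth_le:
  assumes "\<And>t. t \<ge> \<theta> \<Longrightarrow> (\<integral>y. innov \<alpha> p t y ^ 4 \<partial>BM t) \<le> C * y_mom \<alpha> (4 * p) t" and "C > 0"
  shows "0 \<le> indep_fourth N" "indep_fourth N \<le> lam ^ 4 * C * pd_mean \<alpha> (4 * p) \<theta>"
proof -
  show "0 \<le> indep_fourth N"
    unfolding indep_fourth_def by (intro sum_nonneg mult_nonneg_nonneg) auto
  have rho4: "rho p k ^ 4 \<le> rho (4 * p) k" for k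
  proof -
    have "((rho p k)\<^sup>2)\<^sup>2 \<le> (rho (2 * p) k)\<^sup>2"
      using p0 by (intro power_mono rho_square_le) auto
    also have "\<dots> \<le> rho (2 * (2 * p)) k"
      using p0 by (intro rho_square_le) auto
    finally show ?thesis by simp
  qed
  have "indep_fourth N \<le> (\<Sum>k<N. (lam ^ 4 * rho (4 * p) k) * (C * y_mom \<alpha> (4 * p) (\<theta>s k)))"
    unfolding indep_fourth_def
  proof (intro sum_mono mult_mono)
    fix k
    show "(lam * rho p k) ^ 4 \<le> lam ^ 4 * rho (4 * p) k"
      unfolding power_mult_distrib using rho4 by (intro mult_left_mono) auto
    show "(\<integral>x. innov \<alpha> p (\<theta>s k) x ^ 4 \<partial>BM (\<theta>s k)) \<le> C * y_mom \<alpha> (4 * p) (\<theta>s k)"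
      using \<alpha> by (intro assms) auto
    show "0 \<le> lam ^ 4 * rho (4 * p) k"
      using rho_pos[of "4 * p" k] p0 by simp
  qed simp
  also have "\<dots> = lam ^ 4 * C * (\<Sum>k<N. rho (4 * p) k * y_mom \<alpha> (4 * p) (\<theta>s k))"
    by (simp add: sum_distrib_left mult_ac)
  also have "\<dots> \<le> lam ^ 4 * C * pd_mean \<alpha> (4 * p) \<theta>"
  proof (intro mult_left_mono)
    have "4 * p > \<alpha>" using p p0 by simp
    then show "(\<Sum>k<N. rho (4 * p) k * y_mom \<alpha> (4 * p) (\<theta>s k)) \<le> pd_mean \<alpha> (4 * p) \<theta>"
      unfolding sum_stick_moments[OF \<open>4 * p > \<alpha>\<close>]
      using rho_pos[of "4 * p" N] pd_mean_pos[of "4 * p" "\<theta>s N"] p0 by simp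
  qed (use \<open>C > 0\<close> in auto)
  finally show "indep_fourth N \<le> lam ^ 4 * C * pd_mean \<alpha> (4 * p) \<theta>" .
qed

text \<open>For each \<open>N\<close> the triangle inequality passes through the independent sum and
  the Gaussian with its variance \<open>s2\<close>. Letting \<open>N\<close> tend to infinity
  removes the tail \<open>T\<close> and replaces the partial variance \<open>P N\<close> by
  \<open>X\<close>.\<close>

lemma char_W_law_bound:
  assumes fourth: "\<And>t. t \<ge> \<theta> \<Longrightarrow> (\<integral>y. innov \<alpha> p t y ^ 4 \<partial>BM t) \<le> C * y_mom \<alpha> (4 * p) t" and "C > 0"
    and big: "\<theta> \<ge> 2 * max 1 p" and "e > 0"
  defines "X \<equiv> lam\<^sup>2 * pd_var \<alpha> p \<theta>" and "Q \<equiv> lam ^ 4 * C * pd_mean \<alpha> (4 * p) \<theta>"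
    and "D \<equiv> 16 * (max 1 p)\<^sup>2 / \<alpha> / \<theta>"
  shows "cmod (char (W_law \<alpha> \<theta> p) u - complex_of_real (exp (- (u\<^sup>2 * X / 2))))
    \<le> \<bar>u\<bar> * (\<bar>lam * pd_mean \<alpha> p \<theta> - sqrt \<theta>\<bar> + sqrt (D * X)) + \<bar>u\<bar> ^ 3 / 12 * (e * X + Q / e) + u ^ 4 / 4 * Q
      + u\<^sup>2 / 2 * (D * X)"
proof -
  define b where "b = \<bar>lam * pd_mean \<alpha> p \<theta> - sqrt \<theta>\<bar>"
  define P where "P N = lam\<^sup>2 * pred_var N" for N
  define T where "T N = lam * (rho p N * pd_mean \<alpha> p (\<theta>s N))" for N
  let ?R = "\<lambda>N. \<bar>u\<bar> * (b + 2 * T N + sqrt (D * P N)) + \<bar>u\<bar> ^ 3 / 12 * (e * P N + Q / e) + u ^ 4 / 4 * Q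
      + u\<^sup>2 / 2 * (D * P N + \<bar>P N - X\<bar>)"
  have P_lim: "P \<longlonglongrightarrow> X"
    unfolding P_def[abs_def] X_def pred_var_def using sum_innov_var_tendsto by (intro tendsto_mult tendsto_const)
  have T_lim: "T \<longlonglongrightarrow> 0"
    unfolding T_def[abs_def] using tendsto_mult[OF tendsto_const rho_pd_mean_tendsto_0[OF p]] by simp
  have P0: "0 \<le> P N" for N
    unfolding P_def pred_var_def using rho_pos[of "2 * p"] p0 innov_var_nonneg
    by (intro mult_nonneg_nonneg sum_nonneg) (auto simp: less_imp_le)
  have X0: "0 \<le> X" by (rule LIMSEQ_le_const[OF P_lim]) (auto simp: P0)
  have D0: "0 \<le> D" unfolding D_def using \<alpha> \<theta> by simp
  have bound: "cmod (char (W_law \<alpha> \<theta> p) u - complex_of_real (exp (- (u\<^sup>2 * X / 2)))) \<le> ?R N" for N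
  proof -
    define s2 where "s2 = lam\<^sup>2 * (pred_var N - error_var N)"
    let ?c = "char (distr M borel (\<lambda>y. \<Sum>k<N. lam * rho p k * innov \<alpha> p (\<theta>s k) (y k))) u"
    have ev: "lam\<^sup>2 * error_var N \<le> D * P N"
      using mult_left_mono[OF error_var_le(2)[OF big], of "lam\<^sup>2" N] unfolding P_def D_def by (simp add: mult_ac)
    have s2_eq: "s2 = P N - lam\<^sup>2 * error_var N"
      by (simp add: s2_def P_def algebra_simps)
    have s2: "0 \<le> s2" "s2 \<le> P N"
      unfolding s2_def using pred_var_minus_error_var_nonneg apply simp
      using s2_eq error_var_le(1)[OF big, of N] s2_def by simp
    have e1: "cmod (char (W_law \<alpha> \<theta> p) u - ?c) \<le> \<bar>u\<bar> * (b + 2 * T N + sqrt (D * P N))"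
    proof -
      have "lam * sqrt (error_var N) = sqrt (lam\<^sup>2 * error_var N)"
        using lam_pos by (simp add: real_sqrt_mult)
      also have "\<dots> \<le> sqrt (D * P N)" using ev by simp
      finally have "\<bar>u\<bar> * (b + 2 * T N + lam * sqrt (error_var N)) \<le> \<bar>u\<bar> * (b + 2 * T N + sqrt (D * P N))"
        by (intro mult_left_mono) auto
      then show ?thesis using char_W_law_diff_indep[of u N] unfolding b_def T_def by linarith
    qed
    have e2: "cmod (?c - complex_of_real (exp (- (u\<^sup>2 * s2 / 2)))) \<le> \<bar>u\<bar> ^ 3 / 12 * (e * P N + Q / e) + u ^ 4 / 4 * Q"
    proof -
      have Q: "indep_fourth N \<le> Q" unfolding Q_def by (rule indep_fourth_le(2)[OF fourth \<open>C > 0\<close>])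
      have "cmod (?c - complex_of_real (exp (- (u\<^sup>2 * s2 / 2)))) \<le> \<bar>u\<bar> ^ 3 / 12 * (e * s2 + indep_fourth N / e) + u ^ 4 / 4 * indep_fourth N"
        unfolding s2_def by (rule char_indep_bound[OF \<open>e > 0\<close>])
      also have "\<dots> \<le> \<bar>u\<bar> ^ 3 / 12 * (e * P N + Q / e) + u ^ 4 / 4 * Q"
        using Q s2 \<open>e > 0\<close> by (intro add_mono mult_left_mono divide_right_mono) auto
      finally show ?thesis .
    qed
    have e3: "cmod (complex_of_real (exp (- (u\<^sup>2 * s2 / 2))) - complex_of_real (exp (- (u\<^sup>2 * X / 2)))) \<le> u\<^sup>2 / 2 * (D * P N + \<bar>P N - X\<bar>)"
    proof -
      have "cmod (complex_of_real (exp (- (u\<^sup>2 * s2 / 2))) - complex_of_real (exp (- (u\<^sup>2 * X / 2))))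
          = \<bar>exp (- (u\<^sup>2 * s2 / 2)) - exp (- (u\<^sup>2 * X / 2))\<bar>"
        by (simp only: of_real_diff[symmetric] norm_of_real)
      also have "\<dots> \<le> \<bar>u\<^sup>2 * s2 / 2 - u\<^sup>2 * X / 2\<bar>"
        using s2 X0 by (intro abs_exp_minus_diff_le) auto
      also have "\<dots> = u\<^sup>2 / 2 * \<bar>s2 - X\<bar>"
      proof -
        have "u\<^sup>2 * s2 / 2 - u\<^sup>2 * X / 2 = u\<^sup>2 / 2 * (s2 - X)" by (simp add: algebra_simps)
        then show ?thesis by (simp only: abs_mult) simp
      qed
      also have "\<dots> \<le> u\<^sup>2 / 2 * (D * P N + \<bar>P N - X\<bar>)"
      proof (intro mult_left_mono)
        have "0 \<le> lam\<^sup>2 * error_var N" using error_var_le(1)[OF big, of N] by simp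
        then show "\<bar>s2 - X\<bar> \<le> D * P N + \<bar>P N - X\<bar>" using ev s2_eq by linarith
      qed simp
      finally show ?thesis .
    qed
    have "cmod (char (W_law \<alpha> \<theta> p) u - complex_of_real (exp (- (u\<^sup>2 * X / 2))))
      \<le> cmod (char (W_law \<alpha> \<theta> p) u - ?c) + cmod (?c - complex_of_real (exp (- (u\<^sup>2 * s2 / 2))))
        + cmod (complex_of_real (exp (- (u\<^sup>2 * s2 / 2))) - complex_of_real (exp (- (u\<^sup>2 * X / 2))))"
      by norm
    then show ?thesis using e1 e2 e3 by linarith
  qed
  have "?R \<longlonglongrightarrow> \<bar>u\<bar> * (b + 2 * 0 + sqrt (D * X)) + \<bar>u\<bar> ^ 3 / 12 * (e * X + Q / e) + u ^ 4 / 4 * Q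
      + u\<^sup>2 / 2 * (D * X + \<bar>X - X\<bar>)"
    by (intro tendsto_intros P_lim T_lim)
  then have "cmod (char (W_law \<alpha> \<theta> p) u - complex_of_real (exp (- (u\<^sup>2 * X / 2))))
    \<le> \<bar>u\<bar> * (b + 2 * 0 + sqrt (D * X)) + \<bar>u\<bar> ^ 3 / 12 * (e * X + Q / e) + u ^ 4 / 4 * Q + u\<^sup>2 / 2 * (D * X + \<bar>X - X\<bar>)"
    by (rule LIMSEQ_le_const) (use bound in blast)
  then show ?thesis by (simp add: b_def)
qed

end

section \<open>Passage to the limit of large \<theta>\<close>

context pd_param
begin

lemma char_W_law_tendsto:
  assumes p: "p > \<alpha>"
  shows "((\<lambda>\<theta>. char (W_law \<alpha> \<theta> p) u) \<longlongrightarrow> complex_of_real (exp (- (u\<^sup>2 * sigma2 \<alpha> p / 2)))) at_top"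
proof -
  obtain C \<theta>0 where C: "C > 0" "\<theta>0 > 0"
    "\<And>\<theta>. \<theta> \<ge> \<theta>0 \<Longrightarrow> (\<integral>y. innov \<alpha> p \<theta> y ^ 4 \<partial>BM \<theta>) \<le> C * y_mom \<alpha> (4 * p) \<theta>"
    using eventually_innov_fourth_le[OF p] by blast
  define X where "X \<theta> = (scale p \<theta>)\<^sup>2 * pd_var \<alpha> p \<theta>" for \<theta>
  define Q where "Q \<theta> = scale p \<theta> ^ 4 * C * pd_mean \<alpha> (4 * p) \<theta>" for \<theta>
  define D where "D \<theta> = 16 * (max 1 p)\<^sup>2 / \<alpha> / \<theta>" for \<theta>
  define b where "b \<theta> = \<bar>scale p \<theta> * pd_mean \<alpha> p \<theta> - sqrt \<theta>\<bar>" for \<theta>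
  define B where "B \<theta> = \<bar>u\<bar> * (b \<theta> + sqrt (D \<theta> * X \<theta>)) + \<bar>u\<bar> ^ 3 / 12 * (1 / sqrt \<theta> * X \<theta> + Q \<theta> * sqrt \<theta>) + u ^ 4 / 4 * Q \<theta>
      + u\<^sup>2 / 2 * (D \<theta> * X \<theta>)" for \<theta>
  have bound: "cmod (char (W_law \<alpha> \<theta> p) u - complex_of_real (exp (- (u\<^sup>2 * X \<theta> / 2)))) \<le> B \<theta>"
    if "\<theta> \<ge> max \<theta>0 (2 * max 1 p)" for \<theta>
  proof -
    have \<theta>: "\<theta> > 0" using that C by auto
    interpret S: pd_seq \<alpha> \<theta> p by unfold_locales (use \<theta> p in auto)
    \<comment> \<open>The free weight \<open>e\<close>: as \<open>Q\<close> is
      \<open>O(1 / \<theta>)\<close>, both \<open>e * X\<close> and \<open>Q / e\<close> are then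
      \<open>O(1 / sqrt \<theta>)\<close>.\<close>
    have "1 / sqrt \<theta> > 0" using \<theta> by simp
    from S.char_W_law_bound[OF C(3) C(1) _ this, of u] that \<theta>
    show ?thesis
      unfolding B_def X_def Q_def D_def b_def by simp
  qed
  have X: "(X \<longlongrightarrow> sigma2 \<alpha> p) at_top"
    unfolding X_def[abs_def] scale_def by (rule tendsto_pd_var[OF p])
  have D: "(D \<longlongrightarrow> 0) at_top"
    unfolding D_def[abs_def] by real_asymp
  have b: "(b \<longlongrightarrow> 0) at_top"
  proof -
    have "((\<lambda>\<theta>. \<bar>sqrt \<theta> * (Gamma (1 - \<alpha>) / Gamma (p - \<alpha>) * \<theta> powr (p - 1) * pd_mean \<alpha> p \<theta> - 1)\<bar>) \<longlongrightarrow> \<bar>0\<bar>) at_top"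
      by (intro tendsto_rabs pd_centering p)
    then have "((\<lambda>\<theta>. \<bar>sqrt \<theta> * (Gamma (1 - \<alpha>) / Gamma (p - \<alpha>) * \<theta> powr (p - 1) * pd_mean \<alpha> p \<theta> - 1)\<bar>) \<longlongrightarrow> 0) at_top"
      by simp
    then show ?thesis
    proof (rule Lim_transform_eventually)
      show "\<forall>\<^sub>F \<theta> in at_top. \<bar>sqrt \<theta> * (Gamma (1 - \<alpha>) / Gamma (p - \<alpha>) * \<theta> powr (p - 1) * pd_mean \<alpha> p \<theta> - 1)\<bar> = b \<theta>"
        using eventually_gt_at_top[of 0]
      proof eventually_elim
        case (elim \<theta>)
        have "\<theta> powr (1 / 2) * \<theta> powr (p - 1) = \<theta> powr (p - 1 / 2)"
          by (simp flip: powr_add)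
        then have sq: "sqrt \<theta> * \<theta> powr (p - 1) = \<theta> powr (p - 1 / 2)"
          using elim by (simp add: powr_half_sqrt)
        show ?case unfolding b_def scale_def sq[symmetric] by (simp add: algebra_simps)
      qed
    qed
  qed
  define K where "K = (Gamma (1 - \<alpha>) / Gamma (p - \<alpha>)) ^ 4 * C"
  \<comment> \<open>\<open>scale ^ 4\<close> contributes \<open>\<theta> powr (4 * p - 2)\<close>
    and the mean has order \<open>\<theta> powr (1 - 4 * p)\<close>, leaving
    \<open>1 / \<theta>\<close>.\<close>
  have Q_eq: "Q \<theta> = K * (pd_mean \<alpha> (4 * p) \<theta> * \<theta> powr (4 * p - 1)) * (1 / \<theta>)" if "\<theta> > 0" for \<theta>
  proof -
    have "(\<theta> powr (p - 1 / 2)) ^ 4 = \<theta> powr (4 * p - 2)"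
      using that by (simp add: powr_power algebra_simps)
    also have "\<dots> = \<theta> powr (4 * p - 1) * (1 / \<theta>)"
      using that by (simp add: powr_diff power2_eq_square)
    finally show ?thesis unfolding Q_def scale_def K_def power_mult_distrib by simp
  qed
  have m4: "((\<lambda>\<theta>. pd_mean \<alpha> (4 * p) \<theta> * \<theta> powr (4 * p - 1)) \<longlongrightarrow> Gamma (4 * p - \<alpha>) / Gamma (1 - \<alpha>)) at_top"
    using p \<alpha> by (intro tendsto_pd_mean) auto
  have Q: "(Q \<longlongrightarrow> 0) at_top"
  proof -
    have "((\<lambda>\<theta>. K * (pd_mean \<alpha> (4 * p) \<theta> * \<theta> powr (4 * p - 1)) * (1 / \<theta>)) \<longlongrightarrow> K * (Gamma (4 * p - \<alpha>) / Gamma (1 - \<alpha>)) * 0) at_top"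
      by (intro tendsto_mult tendsto_const m4) real_asymp
    then have "((\<lambda>\<theta>. K * (pd_mean \<alpha> (4 * p) \<theta> * \<theta> powr (4 * p - 1)) * (1 / \<theta>)) \<longlongrightarrow> 0) at_top" by simp
    then show ?thesis
      by (rule Lim_transform_eventually) (use eventually_gt_at_top[of 0] in \<open>eventually_elim, simp add: Q_eq\<close>)
  qed
  have Qs: "((\<lambda>\<theta>. Q \<theta> * sqrt \<theta>) \<longlongrightarrow> 0) at_top"
  proof -
    have "((\<lambda>\<theta>. K * (pd_mean \<alpha> (4 * p) \<theta> * \<theta> powr (4 * p - 1)) * (1 / \<theta> * sqrt \<theta>)) \<longlongrightarrow> K * (Gamma (4 * p - \<alpha>) / Gamma (1 - \<alpha>)) * 0) at_top"
      by (intro tendsto_mult tendsto_const m4) real_asymp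
    then have "((\<lambda>\<theta>. K * (pd_mean \<alpha> (4 * p) \<theta> * \<theta> powr (4 * p - 1)) * (1 / \<theta> * sqrt \<theta>)) \<longlongrightarrow> 0) at_top" by simp
    then show ?thesis
      by (rule Lim_transform_eventually) (use eventually_gt_at_top[of 0] in \<open>eventually_elim, simp add: Q_eq\<close>)
  qed
  have "((\<lambda>\<theta>. 1 / sqrt \<theta>) \<longlongrightarrow> 0) at_top" by real_asymp
  then have "(B \<longlongrightarrow> \<bar>u\<bar> * (0 + sqrt (0 * sigma2 \<alpha> p)) + \<bar>u\<bar> ^ 3 / 12 * (0 * sigma2 \<alpha> p + 0) + u ^ 4 / 4 * 0
      + u\<^sup>2 / 2 * (0 * sigma2 \<alpha> p)) at_top"
    unfolding B_def[abs_def] by (intro tendsto_intros X D b Q Qs)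
  then have B: "(B \<longlongrightarrow> 0) at_top" by simp
  have "((\<lambda>\<theta>. char (W_law \<alpha> \<theta> p) u - complex_of_real (exp (- (u\<^sup>2 * X \<theta> / 2)))) \<longlongrightarrow> 0) at_top"
    by (rule Lim_null_comparison[OF _ B]) (rule eventually_at_top_linorderI[OF bound])
  moreover have "((\<lambda>\<theta>. complex_of_real (exp (- (u\<^sup>2 * X \<theta> / 2)))) \<longlongrightarrow> complex_of_real (exp (- (u\<^sup>2 * sigma2 \<alpha> p / 2)))) at_top"
    by (intro tendsto_intros X) auto
  ultimately show ?thesis
    by (rule Lim_transform[rotated])
qed

end

text \<open>\<open>weak_conv_m\<close> is a notion for sequences, so convergence in the real
  parameter is expressed through all positive sequences tending to infinity. Levy's continuity
  theorem concludes; positivity of \<open>sigma2\<close> makes the limiting normal density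
  nondegenerate.\<close>

theorem theorem6p5:
  fixes \<alpha> p :: real
  assumes "0 < \<alpha>" "\<alpha> < 1" "p > \<alpha>" "p \<noteq> 1"
  shows "(\<forall>\<theta>s :: nat \<Rightarrow> real. (\<forall>n. \<theta>s n > 0) \<longrightarrow> filterlim \<theta>s at_top sequentially \<longrightarrow>
            weak_conv_m (\<lambda>n. W_law \<alpha> (\<theta>s n) p)
              (density lborel (\<lambda>x. ennreal (normal_density 0 (sqrt (sigma2 \<alpha> p)) x))))
         \<and> sigma2 \<alpha> p > 0"
proof (intro conjI allI impI)
  show pos: "sigma2 \<alpha> p > 0"
    by (rule sigma2_pos) fact+
  interpret pd_param \<alpha> by unfold_locales fact+
  fix \<theta>s :: "nat \<Rightarrow> real"
  assume \<theta>s: "\<forall>n. \<theta>s n > 0" "filterlim \<theta>s at_top sequentially"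
  show "weak_conv_m (\<lambda>n. W_law \<alpha> (\<theta>s n) p) (density lborel (\<lambda>x. ennreal (normal_density 0 (sqrt (sigma2 \<alpha> p)) x)))"
  proof (rule levy_continuity)
    show "real_distribution (W_law \<alpha> (\<theta>s n) p)" for n
    proof -
      interpret S: pd_seq \<alpha> "\<theta>s n" p by unfold_locales (use \<theta>s assms in auto)
      show ?thesis by (rule S.real_distribution_W_law)
    qed
    show "real_distribution (density lborel (\<lambda>x. ennreal (normal_density 0 (sqrt (sigma2 \<alpha> p)) x)))"
      using pos by (intro char_normal_density) simp
    show "(\<lambda>n. char (W_law \<alpha> (\<theta>s n) p) t) \<longlonglongrightarrow>
        char (density lborel (\<lambda>x. ennreal (normal_density 0 (sqrt (sigma2 \<alpha> p)) x))) t" for t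
      using filterlim_compose[OF char_W_law_tendsto[OF assms(3), of t] \<theta>s(2)] pos
      by (simp add: char_normal_density)
  qed
qed

end
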